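(* Let $\Lambda$ be a locally-convex, row-finite $k$-graph and $J\subseteq C^*(\Lambda)$ a gauge-invariant ideal. Then (i) $J^\perp=I(\Lambda^0\setminus\overline{H}(J))$; (ii) $J^{\perp\perp}=I(\{w\in\Lambda^0: T(w)\subseteq\overline{H}(J)\})$; (iii) $J$ is regular if and only if $H(J)=\{w\in\Lambda^0:T(w)\subseteq\overline{H}(J)\}$.
   Context: A $k$-graph $(\Lambda,d)$ is a countable category with a functor $d:\Lambda\to\mathbb{N}^k$ with unique factorization; vertices $\Lambda^0$ are degree-$0$ paths, $r,s$ range and source, $e_i$ standard generators. Row-finite: finitely many paths of each degree with each range. $\Lambda^{\le n}=\{\lambda:d(\lambda)\le n,\ d(\lambda)_i<n_i\Rightarrow s(\lambda)\Lambda^{e_i}=\emptyset\}$. Locally-convex: for $i\ne j$, $\lambda\in v\Lambda^{e_i}$, $\mu\in v\Lambda^{e_j}$, $s(\lambda)\Lambda^{e_j}\ne\emptyset\ne s(\mu)\Lambda^{e_i}$. $C^*(\Lambda)$ is generated by a universal Cuntz–Krieger family $\{s_\lambda\}$ of partial isometries with $\{s_v\}$ mutually orthogonal projections, $s_{\lambda\mu}=s_\lambda s_\mu$, $s_\lambda^*s_\lambda=s_{s(\lambda)}$, $s_v=\sum_{\lambda\in v\Lambda^{\le m}}s_\lambda s_\lambda^*$; $p_v=s_v$. The gauge action satisfies $\gamma_z(s_\lambda)=z^{d(\lambda)}s_\lambda$ ($z\in\mathbb{T}^k$); an ideal is gauge-invariant if $\gamma_z(I)\subseteq I$ for all $z$.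 Ideals are closed two-sided. For an ideal $I$: $H(I)=\{v:p_v\in I\}$, $\overline{H}(I)=\{r(\lambda):s(\lambda)\in H(I)\}$, $I^\perp=\{a:ax=xa=0\ \forall x\in I\}$, and $I$ is regular if $I^{\perp\perp}=I$. For $H\subseteq\Lambda^0$, $I(H)$ is the closed ideal generated by $\{p_v:v\in H\}$. For $w\in\Lambda^0$, $T(w)=\{s(\lambda):\lambda\in\Lambda,\ r(\lambda)=w\}$. *)

theory Defs
  imports Complex_Main "HOL-Library.Countable_Set"
begin

text \<open>A k-graph is represented as a category whose morphisms (paths) form the set
 kg_paths; objects are identified with their identity morphisms; kg_r / kg_s are
 range and source, kg_comp l m is the composite l m (defined when s l = r m),
 and kg_deg is the degree functor into N^k, where N^k is represented as
 functions nat => nat vanishing outside {..<k}.\<close>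

record 'p kgraph =
  kg_paths :: "'p set"
  kg_r :: "'p \<Rightarrow> 'p"
  kg_s :: "'p \<Rightarrow> 'p"
  kg_comp :: "'p \<Rightarrow> 'p \<Rightarrow> 'p"
  kg_deg :: "'p \<Rightarrow> nat \<Rightarrow> nat"

definition Nk :: "nat \<Rightarrow> (nat \<Rightarrow> nat) set" where
  "Nk k = {n. \<forall>i\<ge>k. n i = 0}"

definition unitvec :: "nat \<Rightarrow> nat \<Rightarrow> nat" where
  "unitvec i = (\<lambda>j. if j = i then 1 else 0)"

definition is_kgraph :: "'p kgraph \<Rightarrow> nat \<Rightarrow> bool" where
  "is_kgraph L k \<longleftrightarrow>
     countable (kg_paths L) \<and>
     (\<forall>l\<in>kg_paths L. kg_r L l \<in> kg_paths L \<and> kg_s L l \<in> kg_paths L \<and>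
        kg_r L (kg_r L l) = kg_r L l \<and> kg_s L (kg_r L l) = kg_r L l \<and>
        kg_r L (kg_s L l) = kg_s L l \<and> kg_s L (kg_s L l) = kg_s L l \<and>
        kg_comp L (kg_r L l) l = l \<and> kg_comp L l (kg_s L l) = l \<and>
        kg_deg L l \<in> Nk k) \<and>
     (\<forall>l\<in>kg_paths L. \<forall>m\<in>kg_paths L. kg_s L l = kg_r L m \<longrightarrow>
        kg_comp L l m \<in> kg_paths L \<and> kg_r L (kg_comp L l m) = kg_r L l \<and>
        kg_s L (kg_comp L l m) = kg_s L m \<and>
        kg_deg L (kg_comp L l m) = (\<lambda>i. kg_deg L l i + kg_deg L m i)) \<and>
     (\<forall>l\<in>kg_paths L. \<forall>m\<in>kg_paths L. \<forall>n\<in>kg_paths L.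
        kg_s L l = kg_r L m \<longrightarrow> kg_s L m = kg_r L n \<longrightarrow>
        kg_comp L (kg_comp L l m) n = kg_comp L l (kg_comp L m n)) \<and>
     (\<forall>l\<in>kg_paths L. \<forall>m\<in>Nk k. \<forall>n\<in>Nk k.
        kg_deg L l = (\<lambda>i. m i + n i) \<longrightarrow>
        (\<exists>!(a, b). a \<in> kg_paths L \<and> b \<in> kg_paths L \<and> kg_s L a = kg_r L b \<and>
            kg_deg L a = m \<and> kg_deg L b = n \<and> kg_comp L a b = l))"

definition vertices :: "'p kgraph \<Rightarrow> 'p set" where
  "vertices L = {l \<in> kg_paths L. kg_deg L l = (\<lambda>_. 0)}"

definition row_finite :: "'p kgraph \<Rightarrow> nat \<Rightarrow> bool" where
  "row_finite L k \<longleftrightarrow> (\<forall>v\<in>vertices L. \<forall>n\<in>Nk k.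
     finite {l \<in> kg_paths L. kg_r L l = v \<and> kg_deg L l = n})"

definition locally_convex :: "'p kgraph \<Rightarrow> nat \<Rightarrow> bool" where
  "locally_convex L k \<longleftrightarrow> (\<forall>i<k. \<forall>j<k. i \<noteq> j \<longrightarrow>
     (\<forall>l\<in>kg_paths L. \<forall>m\<in>kg_paths L.
        kg_r L l = kg_r L m \<and> kg_deg L l = unitvec i \<and> kg_deg L m = unitvec j \<longrightarrow>
        (\<exists>a\<in>kg_paths L. kg_r L a = kg_s L l \<and> kg_deg L a = unitvec j) \<and>
        (\<exists>b\<in>kg_paths L. kg_r L b = kg_s L m \<and> kg_deg L b = unitvec i)))"

definition paths_le :: "'p kgraph \<Rightarrow> nat \<Rightarrow> 'p \<Rightarrow> (nat \<Rightarrow> nat) \<Rightarrow> 'p set" where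
  "paths_le L k v n = {l \<in> kg_paths L. kg_r L l = v \<and> (\<forall>i. kg_deg L l i \<le> n i) \<and>
     (\<forall>i<k. kg_deg L l i < n i \<longrightarrow>
        \<not> (\<exists>a\<in>kg_paths L. kg_r L a = kg_s L l \<and> kg_deg L a = unitvec i))}"

definition Tset :: "'p kgraph \<Rightarrow> 'p \<Rightarrow> 'p set" where
  "Tset L w = {kg_s L l | l. l \<in> kg_paths L \<and> kg_r L l = w}"

record 'a cstar =
  c_carrier :: "'a set"
  c_zero :: 'a
  c_add :: "'a \<Rightarrow> 'a \<Rightarrow> 'a"
  c_smul :: "complex \<Rightarrow> 'a \<Rightarrow> 'a"
  c_mult :: "'a \<Rightarrow> 'a \<Rightarrow> 'a"
  c_star :: "'a \<Rightarrow> 'a"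
  c_norm :: "'a \<Rightarrow> real"

definition c_diff :: "'a cstar \<Rightarrow> 'a \<Rightarrow> 'a \<Rightarrow> 'a" where
  "c_diff A x y = c_add A x (c_smul A (-1) y)"

definition c_converges :: "'a cstar \<Rightarrow> (nat \<Rightarrow> 'a) \<Rightarrow> 'a \<Rightarrow> bool" where
  "c_converges A x a \<longleftrightarrow> (\<forall>e>0. \<exists>N. \<forall>n\<ge>N. c_norm A (c_diff A (x n) a) < e)"

definition c_cauchy :: "'a cstar \<Rightarrow> (nat \<Rightarrow> 'a) \<Rightarrow> bool" where
  "c_cauchy A x \<longleftrightarrow> (\<forall>e>0. \<exists>N. \<forall>m\<ge>N. \<forall>n\<ge>N. c_norm A (c_diff A (x m) (x n)) < e)"

definition is_cstar :: "'a cstar \<Rightarrow> bool" where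
  "is_cstar A \<longleftrightarrow> (let C = c_carrier A in
     c_zero A \<in> C \<and>
     (\<forall>x\<in>C. \<forall>y\<in>C. c_add A x y \<in> C \<and> c_mult A x y \<in> C) \<and>
     (\<forall>a. \<forall>x\<in>C. c_smul A a x \<in> C) \<and> (\<forall>x\<in>C. c_star A x \<in> C) \<and>
     (\<forall>x\<in>C. \<forall>y\<in>C. \<forall>z\<in>C.
        c_add A (c_add A x y) z = c_add A x (c_add A y z) \<and>
        c_mult A (c_mult A x y) z = c_mult A x (c_mult A y z) \<and>
        c_mult A x (c_add A y z) = c_add A (c_mult A x y) (c_mult A x z) \<and>
        c_mult A (c_add A x y) z = c_add A (c_mult A x z) (c_mult A y z)) \<and>
     (\<forall>x\<in>C. \<forall>y\<in>C. c_add A x y = c_add A y x) \<and>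
     (\<forall>x\<in>C. c_add A x (c_zero A) = x \<and> c_add A x (c_smul A (-1) x) = c_zero A \<and>
        c_smul A 1 x = x) \<and>
     (\<forall>a b. \<forall>x\<in>C. c_smul A (a + b) x = c_add A (c_smul A a x) (c_smul A b x) \<and>
        c_smul A a (c_smul A b x) = c_smul A (a * b) x) \<and>
     (\<forall>a. \<forall>x\<in>C. \<forall>y\<in>C. c_smul A a (c_add A x y) = c_add A (c_smul A a x) (c_smul A a y) \<and>
        c_smul A a (c_mult A x y) = c_mult A (c_smul A a x) y \<and>
        c_smul A a (c_mult A x y) = c_mult A x (c_smul A a y)) \<and>
     (\<forall>x\<in>C. \<forall>y\<in>C. c_star A (c_star A x) = x \<and>
        c_star A (c_add A x y) = c_add A (c_star A x) (c_star A y) \<and>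
        c_star A (c_mult A x y) = c_mult A (c_star A y) (c_star A x)) \<and>
     (\<forall>a. \<forall>x\<in>C. c_star A (c_smul A a x) = c_smul A (cnj a) (c_star A x)) \<and>
     (\<forall>x\<in>C. 0 \<le> c_norm A x \<and> (c_norm A x = 0 \<longleftrightarrow> x = c_zero A)) \<and>
     (\<forall>a. \<forall>x\<in>C. c_norm A (c_smul A a x) = cmod a * c_norm A x) \<and>
     (\<forall>x\<in>C. \<forall>y\<in>C. c_norm A (c_add A x y) \<le> c_norm A x + c_norm A y \<and>
        c_norm A (c_mult A x y) \<le> c_norm A x * c_norm A y) \<and>
     (\<forall>x\<in>C. c_norm A (c_mult A (c_star A x) x) = (c_norm A x)\<^sup>2) \<and>
     (\<forall>x. (\<forall>n. x n \<in> C) \<and> c_cauchy A x \<longrightarrow> (\<exists>a\<in>C. c_converges A x a)))"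

definition c_closed_set :: "'a cstar \<Rightarrow> 'a set \<Rightarrow> bool" where
  "c_closed_set A S \<longleftrightarrow> (\<forall>x a. (\<forall>n. x n \<in> S) \<and> a \<in> c_carrier A \<and> c_converges A x a \<longrightarrow> a \<in> S)"

definition c_sum :: "'a cstar \<Rightarrow> ('b \<Rightarrow> 'a) \<Rightarrow> 'b set \<Rightarrow> 'a" where
  "c_sum A f S = Finite_Set.fold (\<lambda>x acc. c_add A (f x) acc) (c_zero A) S"

definition star_hom :: "'a cstar \<Rightarrow> 'b cstar \<Rightarrow> ('a \<Rightarrow> 'b) \<Rightarrow> bool" where
  "star_hom A B f \<longleftrightarrow> (\<forall>x\<in>c_carrier A. f x \<in> c_carrier B \<and> f (c_star A x) = c_star B (f x) \<and>
     (\<forall>a. f (c_smul A a x) = c_smul B a (f x)) \<and>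
     (\<forall>y\<in>c_carrier A. f (c_add A x y) = c_add B (f x) (f y) \<and>
        f (c_mult A x y) = c_mult B (f x) (f y)))"

definition closed_star_subalg :: "'a cstar \<Rightarrow> 'a set \<Rightarrow> bool" where
  "closed_star_subalg A S \<longleftrightarrow> S \<subseteq> c_carrier A \<and> c_zero A \<in> S \<and>
     (\<forall>x\<in>S. \<forall>y\<in>S. c_add A x y \<in> S \<and> c_mult A x y \<in> S) \<and>
     (\<forall>a. \<forall>x\<in>S. c_smul A a x \<in> S) \<and> (\<forall>x\<in>S. c_star A x \<in> S) \<and> c_closed_set A S"

definition gen_subalg :: "'a cstar \<Rightarrow> 'a set \<Rightarrow> 'a set" where
  "gen_subalg A X = \<Inter>{S. closed_star_subalg A S \<and> X \<subseteq> S}"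

definition is_ideal :: "'a cstar \<Rightarrow> 'a set \<Rightarrow> bool" where
  "is_ideal A J \<longleftrightarrow> J \<subseteq> c_carrier A \<and> c_zero A \<in> J \<and>
     (\<forall>x\<in>J. \<forall>y\<in>J. c_add A x y \<in> J) \<and> (\<forall>a. \<forall>x\<in>J. c_smul A a x \<in> J) \<and>
     (\<forall>x\<in>J. \<forall>b\<in>c_carrier A. c_mult A b x \<in> J \<and> c_mult A x b \<in> J) \<and>
     c_closed_set A J"

definition ideal_gen :: "'a cstar \<Rightarrow> 'a set \<Rightarrow> 'a set" where
  "ideal_gen A X = \<Inter>{J. is_ideal A J \<and> X \<subseteq> J}"

definition annihilator :: "'a cstar \<Rightarrow> 'a set \<Rightarrow> 'a set" where
  "annihilator A J = {a \<in> c_carrier A. \<forall>x\<in>J. c_mult A a x = c_zero A \<and> c_mult A x a = c_zero A}"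

definition regular_ideal :: "'a cstar \<Rightarrow> 'a set \<Rightarrow> bool" where
  "regular_ideal A J \<longleftrightarrow> annihilator A (annihilator A J) = J"

definition CK_family :: "'p kgraph \<Rightarrow> nat \<Rightarrow> 'a cstar \<Rightarrow> ('p \<Rightarrow> 'a) \<Rightarrow> bool" where
  "CK_family L k B t \<longleftrightarrow>
     (\<forall>l\<in>kg_paths L. t l \<in> c_carrier B) \<and>
     (\<forall>v\<in>vertices L. c_star B (t v) = t v \<and> c_mult B (t v) (t v) = t v) \<and>
     (\<forall>v\<in>vertices L. \<forall>w\<in>vertices L. v \<noteq> w \<longrightarrow> c_mult B (t v) (t w) = c_zero B) \<and>
     (\<forall>l\<in>kg_paths L. \<forall>m\<in>kg_paths L. kg_s L l = kg_r L m \<longrightarrow>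
        t (kg_comp L l m) = c_mult B (t l) (t m)) \<and>
     (\<forall>l\<in>kg_paths L. c_mult B (c_star B (t l)) (t l) = t (kg_s L l)) \<and>
     (\<forall>v\<in>vertices L. \<forall>m\<in>Nk k.
        t v = c_sum B (\<lambda>l. c_mult B (t l) (c_star B (t l))) (paths_le L k v m))"

definition universal_CK :: "'p kgraph \<Rightarrow> nat \<Rightarrow> 'a cstar \<Rightarrow> ('p \<Rightarrow> 'a) \<Rightarrow> bool" where
  "universal_CK L k A s \<longleftrightarrow> is_cstar A \<and> CK_family L k A s \<and>
     gen_subalg A (s ` kg_paths L) = c_carrier A \<and>
     (\<forall>(B :: (nat \<Rightarrow> complex) cstar) t. is_cstar B \<and> CK_family L k B t \<longrightarrow>
        (\<exists>\<pi>. star_hom A B \<pi> \<and> (\<forall>l\<in>kg_paths L. \<pi> (s l) = t l)))"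

definition zpow :: "nat \<Rightarrow> (nat \<Rightarrow> complex) \<Rightarrow> (nat \<Rightarrow> nat) \<Rightarrow> complex" where
  "zpow k z n = (\<Prod>i<k. z i ^ n i)"

text \<open>Gauge-invariance: J is invariant under every gauge automorphism gamma_z, i.e. the
 (unique) *-endomorphism with gamma_z(s_l) = z^{d(l)} s_l.\<close>
definition gauge_invariant :: "'p kgraph \<Rightarrow> nat \<Rightarrow> 'a cstar \<Rightarrow> ('p \<Rightarrow> 'a) \<Rightarrow> 'a set \<Rightarrow> bool" where
  "gauge_invariant L k A s J \<longleftrightarrow>
     (\<forall>z. (\<forall>i<k. cmod (z i) = 1) \<longrightarrow>
        (\<forall>\<phi>. star_hom A A \<phi> \<and>
              (\<forall>l\<in>kg_paths L. \<phi> (s l) = c_smul A (zpow k z (kg_deg L l)) (s l))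
           \<longrightarrow> \<phi> ` J \<subseteq> J))"

definition Hset :: "'p kgraph \<Rightarrow> 'a cstar \<Rightarrow> ('p \<Rightarrow> 'a) \<Rightarrow> 'a set \<Rightarrow> 'p set" where
  "Hset L A s J = {v \<in> vertices L. s v \<in> J}"

definition Hbar :: "'p kgraph \<Rightarrow> 'a cstar \<Rightarrow> ('p \<Rightarrow> 'a) \<Rightarrow> 'a set \<Rightarrow> 'p set" where
  "Hbar L A s J = {kg_r L l | l. l \<in> kg_paths L \<and> kg_s L l \<in> Hset L A s J}"

end

theory Submission
  imports Defs "HOL-Analysis.Analysis"
begin

text \<open>The key fact is that a gauge-invariant ideal \<open>J\<close> is generated by its vertex projections. Given \<open>a \<in> J\<close>, Fejer means
  reduce the claim to homogeneous elements. A homogeneous finite sum of terms \<open>s\<^sub>\<lambda> s\<^sub>\<mu>\<^sup>*\<close> can be refined to a matrix over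
  \<open>\<Lambda>\<^bsup>\<le>n\<^esup>\<close>; the matrix units whose source lies in \<open>H(J)\<close> belong to the ideal generated by \<open>H(J)\<close>, and on the others
  the quotient by \<open>J\<close> is isometric. As the annihilator of a gauge-invariant ideal is gauge-invariant, and as all \<open>p\<^sub>v\<close> are
  nonzero (boundary path representation), \<open>H(J\<^sup>\<bottom>)\<close> is the complement of the set of ranges of paths with source in \<open>H(J)\<close>, and the three claims follow by applying this
  twice.\<close>

section \<open>The product of all C*-algebras on a type\<close>

text \<open>Homogeneity makes the refinement possible: if d(lambda) - d(mu) is the same for all
  terms, bringing every mu to level n brings every lambda to one level n', so star c * c is a square
  matrix over a finite part of \<open>LE n\<close>. Quotients are never formed; the quotient norm of
  c appears only through norm (c + x) for x in J. Positivity enters at a single place: the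
  Cuntz-Krieger relations say that the range projections of a level sum to the vertex projection,
  and their mutual orthogonality has to be deduced. That, and the contractivity of star
  homomorphisms, are obtained from norm estimates alone. Two obstacles shape the first half.
  Algebras are records with a carrier, so they are embedded into a type-class algebra; the class
  assumes no unit, since C*(L) has none when there are infinitely many vertices. And the universal
  property is stated for algebras on one type, whereas the gauge automorphisms and the
  representation that keeps vertex projections nonzero live on others.\<close>

class cstar_alg = real_normed_algebra + banach +
  fixes cscale :: "complex \<Rightarrow> 'a \<Rightarrow> 'a" and star :: "'a \<Rightarrow> 'a"
  assumes cscale_add_right: "cscale a (x + y) = cscale a x + cscale a y"
    and cscale_add_left: "cscale (a + b) x = cscale a x + cscale b x"
    and cscale_cscale [simp]: "cscale a (cscale b x) = cscale (a * b) x"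
    and scaleR_cscale: "scaleR r x = cscale (complex_of_real r) x"
    and cscale_mult_left [simp]: "cscale a x * y = cscale a (x * y)"
    and cscale_mult_right [simp]: "x * cscale a y = cscale a (x * y)"
    and norm_cscale [simp]: "norm (cscale a x) = cmod a * norm x"
    and star_star [simp]: "star (star x) = x"
    and star_add: "star (x + y) = star x + star y"
    and star_mult: "star (x * y) = star y * star x"
    and star_cscale [simp]: "star (cscale a x) = cscale (cnj a) (star x)"
    and norm_star_mult: "norm (star x * x) = (norm x)\<^sup>2"

section \<open>C*-algebra records and their axioms as rules\<close>

locale cstar_record =
  fixes A :: "'a cstar"
  assumes is_cstar: "is_cstar A"
begin

lemma zero_closed [simp, intro]: "c_zero A \<in> c_carrier A"
  and add_closed [simp, intro]: "\<lbrakk>x \<in> c_carrier A; y \<in> c_carrier A\<rbrakk> \<Longrightarrow> c_add A x y \<in> c_carrier A"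
  and mult_closed [simp, intro]: "\<lbrakk>x \<in> c_carrier A; y \<in> c_carrier A\<rbrakk> \<Longrightarrow> c_mult A x y \<in> c_carrier A"
  and smul_closed [simp, intro]: "x \<in> c_carrier A \<Longrightarrow> c_smul A a x \<in> c_carrier A"
  and star_closed [simp, intro]: "x \<in> c_carrier A \<Longrightarrow> c_star A x \<in> c_carrier A"
  using is_cstar by (auto simp: is_cstar_def Let_def)

lemma diff_closed [simp, intro]:
  "\<lbrakk>x \<in> c_carrier A; y \<in> c_carrier A\<rbrakk> \<Longrightarrow> c_diff A x y \<in> c_carrier A"
  by (simp add: c_diff_def)

lemma
  assumes "x \<in> c_carrier A"
  shows add_zero: "c_add A x (c_zero A) = x"
    and add_minus: "c_add A x (c_smul A (-1) x) = c_zero A"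
    and smul_one: "c_smul A 1 x = x"
    and smul_add_left: "c_smul A (a + b) x = c_add A (c_smul A a x) (c_smul A b x)"
    and smul_smul: "c_smul A a (c_smul A b x) = c_smul A (a * b) x"
    and star_star: "c_star A (c_star A x) = x"
    and star_smul: "c_star A (c_smul A a x) = c_smul A (cnj a) (c_star A x)"
    and norm_nonneg: "0 \<le> c_norm A x"
    and norm_eq_zero: "c_norm A x = 0 \<longleftrightarrow> x = c_zero A"
    and norm_smul: "c_norm A (c_smul A a x) = cmod a * c_norm A x"
    and norm_star_mult: "c_norm A (c_mult A (c_star A x) x) = (c_norm A x)\<^sup>2"
  using is_cstar assms unfolding is_cstar_def Let_def by (simp_all only: simp_thms; metis)+

lemma
  assumes "x \<in> c_carrier A" "y \<in> c_carrier A"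
  shows add_commute: "c_add A x y = c_add A y x"
    and smul_add_right: "c_smul A a (c_add A x y) = c_add A (c_smul A a x) (c_smul A a y)"
    and smul_mult_left: "c_mult A (c_smul A a x) y = c_smul A a (c_mult A x y)"
    and smul_mult_right: "c_mult A x (c_smul A a y) = c_smul A a (c_mult A x y)"
    and star_add: "c_star A (c_add A x y) = c_add A (c_star A x) (c_star A y)"
    and star_mult: "c_star A (c_mult A x y) = c_mult A (c_star A y) (c_star A x)"
    and norm_triangle: "c_norm A (c_add A x y) \<le> c_norm A x + c_norm A y"
    and norm_mult_le: "c_norm A (c_mult A x y) \<le> c_norm A x * c_norm A y"
  using is_cstar assms unfolding is_cstar_def Let_def by (simp_all only: simp_thms; metis)+

lemma
  assumes "x \<in> c_carrier A" "y \<in> c_carrier A" "z \<in> c_carrier A"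
  shows add_assoc: "c_add A (c_add A x y) z = c_add A x (c_add A y z)"
    and mult_assoc: "c_mult A (c_mult A x y) z = c_mult A x (c_mult A y z)"
    and distrib_left: "c_mult A x (c_add A y z) = c_add A (c_mult A x y) (c_mult A x z)"
    and distrib_right: "c_mult A (c_add A x y) z = c_add A (c_mult A x z) (c_mult A y z)"
  using is_cstar assms unfolding is_cstar_def Let_def by (simp_all only: simp_thms; metis)+

lemma complete:
  assumes "\<And>n. x n \<in> c_carrier A" "c_cauchy A x"
  shows "\<exists>a\<in>c_carrier A. c_converges A x a"
  using is_cstar assms unfolding is_cstar_def Let_def by metis

lemma smul_zero_left: "x \<in> c_carrier A \<Longrightarrow> c_smul A 0 x = c_zero A"
  using smul_add_left[of x 1 "-1"] smul_one[of x] add_minus[of x] by simp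

lemma norm_zero: "c_norm A (c_zero A) = 0"
  using norm_eq_zero[of "c_zero A"] by simp

end

text \<open>The bounded product over all C*-algebra structures carried by subsets of a type is itself a C*-algebra whose carrier is
  a whole type, so that it can be an instance of a type class. Each factor sits in it isometrically as a closed ideal
  (\<open>emb\<close> below), which allows class-based reasoning about records.\<close>

definition cprod_fns :: "('a cstar \<Rightarrow> 'a) set" where
  "cprod_fns = {f. (\<forall>A. if is_cstar A then f A \<in> c_carrier A else f A = undefined) \<and>
     (\<exists>B. \<forall>A. is_cstar A \<longrightarrow> c_norm A (f A) \<le> B)}"

typedef 'a cprod = "cprod_fns :: ('a cstar \<Rightarrow> 'a) set"
proof
  show "(\<lambda>A. if is_cstar A then c_zero A else undefined) \<in> cprod_fns"
    by (auto simp: cprod_fns_def cstar_record_def cstar_record.norm_zero cstar_record.zero_closed)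
qed

setup_lifting type_definition_cprod

lemma Rep_cprod_closed [simp, intro]: "is_cstar A \<Longrightarrow> Rep_cprod f A \<in> c_carrier A"
  using Rep_cprod[of f] by (auto simp: cprod_fns_def split: if_splits)

lemma Rep_cprod_outside: "\<not> is_cstar A \<Longrightarrow> Rep_cprod f A = undefined"
  using Rep_cprod[of f] by (auto simp: cprod_fns_def split: if_splits)

lemma Rep_cprod_bdd: "\<exists>B. \<forall>A. is_cstar A \<longrightarrow> c_norm A (Rep_cprod f A) \<le> B"
  using Rep_cprod[of f] by (auto simp: cprod_fns_def)

text \<open>Families are pinned to \<open>undefined\<close> away from C*-algebras, so only the
  genuine factors can distinguish two elements.\<close>

lemma cprod_eqI: "(\<And>A. is_cstar A \<Longrightarrow> Rep_cprod f A = Rep_cprod g A) \<Longrightarrow> f = g"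
  by (metis Rep_cprod_inject Rep_cprod_outside ext)

lemma cprod_fnsI:
  assumes "\<And>A. is_cstar A \<Longrightarrow> f A \<in> c_carrier A" "\<And>A. \<not> is_cstar A \<Longrightarrow> f A = undefined"
    and "\<And>A. is_cstar A \<Longrightarrow> c_norm A (f A) \<le> B"
  shows "f \<in> cprod_fns"
  unfolding cprod_fns_def using assms by auto

text \<open>Serves negation, real and complex scaling and the star; the factor K keeps the resulting
  family bounded.\<close>

lemma cprod_fns_op1:
  assumes "\<And>A x. is_cstar A \<Longrightarrow> x \<in> c_carrier A \<Longrightarrow> h A x \<in> c_carrier A"
    and "\<And>A x. is_cstar A \<Longrightarrow> x \<in> c_carrier A \<Longrightarrow> c_norm A (h A x) \<le> K * c_norm A x" and "0 \<le> K"
    and f: "f \<in> cprod_fns"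
  shows "(\<lambda>A. if is_cstar A then h A (f A) else undefined) \<in> cprod_fns"
proof -
  obtain B where B: "\<And>A. is_cstar A \<Longrightarrow> c_norm A (f A) \<le> B" using f by (auto simp: cprod_fns_def)
  have cl: "is_cstar A \<Longrightarrow> f A \<in> c_carrier A" for A using f by (auto simp: cprod_fns_def split: if_splits)
  show ?thesis
  proof (rule cprod_fnsI[where B="K * B"])
    fix A :: "'a cstar" assume A: "is_cstar A"
    have "c_norm A (h A (f A)) \<le> K * c_norm A (f A)" using assms(2) A cl by auto
    also have "\<dots> \<le> K * B" using B[OF A] \<open>0 \<le> K\<close> by (simp add: mult_left_mono)
    finally show "c_norm A (if is_cstar A then h A (f A) else undefined) \<le> K * B" using A by simp
  qed (use assms(1) cl in auto)
qed

instantiation cprod :: (type) "{zero, plus, minus, uminus, times, scaleR}"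
begin

lift_definition zero_cprod :: "'a cprod" is "\<lambda>A. if is_cstar A then c_zero A else undefined"
  by (rule cprod_fnsI[where B=0]) (auto simp: cstar_record_def cstar_record.norm_zero cstar_record.zero_closed)

lift_definition plus_cprod :: "'a cprod \<Rightarrow> 'a cprod \<Rightarrow> 'a cprod" is
  "\<lambda>f g A. if is_cstar A then c_add A (f A) (g A) else undefined"
proof -
  fix f g :: "'a cstar \<Rightarrow> 'a" assume f: "f \<in> cprod_fns" and g: "g \<in> cprod_fns"
  obtain B where B: "\<And>A. is_cstar A \<Longrightarrow> c_norm A (f A) \<le> B" using f by (auto simp: cprod_fns_def)
  obtain B' where B': "\<And>A. is_cstar A \<Longrightarrow> c_norm A (g A) \<le> B'" using g by (auto simp: cprod_fns_def)
  have cl: "is_cstar A \<Longrightarrow> f A \<in> c_carrier A" "is_cstar A \<Longrightarrow> g A \<in> c_carrier A" for A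
    using f g by (auto simp: cprod_fns_def split: if_splits)
  show "(\<lambda>A. if is_cstar A then c_add A (f A) (g A) else undefined) \<in> cprod_fns"
  proof (rule cprod_fnsI[where B="B + B'"])
    fix A :: "'a cstar" assume A: "is_cstar A"
    then interpret cstar_record A by unfold_locales
    show "c_norm A (if is_cstar A then c_add A (f A) (g A) else undefined) \<le> B + B'"
      using norm_triangle[of "f A" "g A"] A cl B B' by (smt (verit))
  qed (use cl in \<open>auto intro!: cstar_record.add_closed simp: cstar_record_def\<close>)
qed

lift_definition times_cprod :: "'a cprod \<Rightarrow> 'a cprod \<Rightarrow> 'a cprod" is
  "\<lambda>f g A. if is_cstar A then c_mult A (f A) (g A) else undefined"
proof -
  fix f g :: "'a cstar \<Rightarrow> 'a" assume f: "f \<in> cprod_fns" and g: "g \<in> cprod_fns"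
  obtain B where B: "\<And>A. is_cstar A \<Longrightarrow> c_norm A (f A) \<le> B" using f by (auto simp: cprod_fns_def)
  obtain B' where B': "\<And>A. is_cstar A \<Longrightarrow> c_norm A (g A) \<le> B'" using g by (auto simp: cprod_fns_def)
  have cl: "is_cstar A \<Longrightarrow> f A \<in> c_carrier A" "is_cstar A \<Longrightarrow> g A \<in> c_carrier A" for A
    using f g by (auto simp: cprod_fns_def split: if_splits)
  show "(\<lambda>A. if is_cstar A then c_mult A (f A) (g A) else undefined) \<in> cprod_fns"
  proof (rule cprod_fnsI[where B="B * B'"])
    fix A :: "'a cstar" assume A: "is_cstar A"
    then interpret cstar_record A by unfold_locales
    have "c_norm A (f A) * c_norm A (g A) \<le> B * B'"
      using A cl B[OF A] B'[OF A] norm_nonneg[of "f A"] norm_nonneg[of "g A"]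
      by (intro mult_mono) auto
    then show "c_norm A (if is_cstar A then c_mult A (f A) (g A) else undefined) \<le> B * B'"
      using norm_mult_le[of "f A" "g A"] A cl by (smt (verit))
  qed (use cl in \<open>auto intro!: cstar_record.mult_closed simp: cstar_record_def\<close>)
qed

lift_definition uminus_cprod :: "'a cprod \<Rightarrow> 'a cprod" is
  "\<lambda>f A. if is_cstar A then c_smul A (-1) (f A) else undefined"
  by (rule cprod_fns_op1[where K=1]) (auto simp: cstar_record_def cstar_record.norm_smul cstar_record.smul_closed)

lift_definition scaleR_cprod :: "real \<Rightarrow> 'a cprod \<Rightarrow> 'a cprod" is
  "\<lambda>r f A. if is_cstar A then c_smul A (complex_of_real r) (f A) else undefined"
  subgoal for r by (rule cprod_fns_op1[where K="\<bar>r\<bar>"]) (auto simp: cstar_record_def cstar_record.norm_smul cstar_record.smul_closed)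
  done

definition minus_cprod :: "'a cprod \<Rightarrow> 'a cprod \<Rightarrow> 'a cprod" where "minus_cprod f g = f + - g"

instance ..

end

lemmas cprod_rep = zero_cprod.rep_eq plus_cprod.rep_eq times_cprod.rep_eq uminus_cprod.rep_eq
  scaleR_cprod.rep_eq

lemma Rep_cprod_minus:
  "is_cstar A \<Longrightarrow> Rep_cprod (f - g) A = c_diff A (Rep_cprod f A) (Rep_cprod g A)"
  by (simp add: minus_cprod_def cprod_rep c_diff_def)

text \<open>The extra 0 makes the set visibly nonempty and the norm nonnegative without exhibiting a
  C*-algebra on the type.\<close>

definition cprod_norm :: "'a cprod \<Rightarrow> real" where
  "cprod_norm f = Sup (insert 0 {c_norm A (Rep_cprod f A) | A. is_cstar A})"

lemma cprod_norm_bdd: "bdd_above (insert 0 {c_norm A (Rep_cprod f A) | A. is_cstar A})"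
proof -
  obtain B where "\<And>A. is_cstar A \<Longrightarrow> c_norm A (Rep_cprod f A) \<le> B" using Rep_cprod_bdd[of f] by auto
  then show ?thesis by (intro bdd_aboveI[of _ "max 0 B"]) force
qed

lemma cprod_norm_upper: "is_cstar A \<Longrightarrow> c_norm A (Rep_cprod f A) \<le> cprod_norm f"
  unfolding cprod_norm_def by (rule cSup_upper[OF _ cprod_norm_bdd]) auto

lemma cprod_norm_nonneg: "0 \<le> cprod_norm f"
  unfolding cprod_norm_def by (rule cSup_upper[OF _ cprod_norm_bdd]) auto

lemma cprod_norm_least:
  "0 \<le> B \<Longrightarrow> (\<And>A. is_cstar A \<Longrightarrow> c_norm A (Rep_cprod f A) \<le> B) \<Longrightarrow> cprod_norm f \<le> B"
  unfolding cprod_norm_def by (rule cSup_least) auto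

instance cprod :: (type) ring
proof
  fix a b c :: "'a cprod"
  show "a + b + c = a + (b + c)"
    by (rule cprod_eqI) (simp add: cprod_rep cstar_record_def cstar_record.add_assoc)
  show "a + b = b + a"
    by (rule cprod_eqI) (simp add: cprod_rep cstar_record_def cstar_record.add_commute)
  show "0 + a = a"
  proof (rule cprod_eqI)
    fix A :: "'a cstar" assume "is_cstar A"
    then interpret cstar_record A by unfold_locales
    show "Rep_cprod (0 + a) A = Rep_cprod a A"
      using is_cstar add_commute[of "c_zero A" "Rep_cprod a A"] by (simp add: cprod_rep add_zero)
  qed
  show "- a + a = 0"
  proof (rule cprod_eqI)
    fix A :: "'a cstar" assume "is_cstar A"
    then interpret cstar_record A by unfold_locales
    show "Rep_cprod (- a + a) A = Rep_cprod 0 A"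
      using is_cstar add_commute[of "c_smul A (-1) (Rep_cprod a A)" "Rep_cprod a A"]
      by (simp add: cprod_rep add_minus)
  qed
  show "a - b = a + - b" by (simp add: minus_cprod_def)
  show "a * b * c = a * (b * c)"
    by (rule cprod_eqI) (simp add: cprod_rep cstar_record_def cstar_record.mult_assoc)
  show "(a + b) * c = a * c + b * c"
    by (rule cprod_eqI) (simp add: cprod_rep cstar_record_def cstar_record.distrib_right)
  show "a * (b + c) = a * b + a * c"
    by (rule cprod_eqI) (simp add: cprod_rep cstar_record_def cstar_record.distrib_left)
qed

instance cprod :: (type) real_algebra
proof
  fix a b :: real and x y :: "'a cprod"
  show "a *\<^sub>R (x + y) = a *\<^sub>R x + a *\<^sub>R y"
    by (rule cprod_eqI) (simp add: cprod_rep cstar_record_def cstar_record.smul_add_right)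
  show "(a + b) *\<^sub>R x = a *\<^sub>R x + b *\<^sub>R x"
    by (rule cprod_eqI) (simp add: cprod_rep cstar_record_def cstar_record.smul_add_left)
  show "a *\<^sub>R b *\<^sub>R x = (a * b) *\<^sub>R x"
    by (rule cprod_eqI) (simp add: cprod_rep cstar_record_def cstar_record.smul_smul)
  show "1 *\<^sub>R x = x"
    by (rule cprod_eqI) (simp add: cprod_rep cstar_record_def cstar_record.smul_one)
  show "a *\<^sub>R x * y = a *\<^sub>R (x * y)"
    by (rule cprod_eqI) (simp add: cprod_rep cstar_record_def cstar_record.smul_mult_left)
  show "x * a *\<^sub>R y = a *\<^sub>R (x * y)"
    by (rule cprod_eqI) (simp add: cprod_rep cstar_record_def cstar_record.smul_mult_right)
qed

instantiation cprod :: (type) real_normed_algebra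
begin

definition norm_cprod :: "'a cprod \<Rightarrow> real" where "norm_cprod = cprod_norm"
definition sgn_cprod :: "'a cprod \<Rightarrow> 'a cprod" where "sgn_cprod x = x /\<^sub>R norm x"
definition dist_cprod :: "'a cprod \<Rightarrow> 'a cprod \<Rightarrow> real" where "dist_cprod x y = norm (x - y)"
definition uniformity_cprod :: "('a cprod \<times> 'a cprod) filter"
  where "uniformity_cprod = (INF e\<in>{0<..}. principal {(x, y). dist x y < e})"
definition open_cprod :: "'a cprod set \<Rightarrow> bool"
  where "open_cprod U = (\<forall>x\<in>U. \<forall>\<^sub>F (x', y) in uniformity. x' = x \<longrightarrow> y \<in> U)"

instance
proof
  fix x y :: "'a cprod" and r :: real
  show "dist x y = norm (x - y)" by (rule dist_cprod_def)
  show "sgn x = x /\<^sub>R norm x" by (rule sgn_cprod_def)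
  show "uniformity = (INF e\<in>{0<..}. principal {(x :: 'a cprod, y). dist x y < e})"
    by (rule uniformity_cprod_def)
  show "open U \<longleftrightarrow> (\<forall>x\<in>U. \<forall>\<^sub>F (x', y) in uniformity. x' = x \<longrightarrow> y \<in> U)" for U :: "'a cprod set"
    by (simp add: open_cprod_def)
  show "(norm x = 0) = (x = 0)"
  proof
    assume "norm x = 0"
    show "x = 0"
    proof (rule cprod_eqI)
      fix A :: "'a cstar" assume A: "is_cstar A"
      then interpret cstar_record A by unfold_locales
      have "c_norm A (Rep_cprod x A) = 0"
        using cprod_norm_upper[OF A, of x] norm_nonneg[of "Rep_cprod x A"] \<open>norm x = 0\<close> A
        by (auto simp: norm_cprod_def)
      then show "Rep_cprod x A = Rep_cprod 0 A"
        using A norm_eq_zero[of "Rep_cprod x A"] by (auto simp: cprod_rep)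
    qed
  next
    assume "x = 0"
    have "cprod_norm x \<le> 0"
      by (rule cprod_norm_least) (auto simp: \<open>x = 0\<close> cprod_rep cstar_record_def cstar_record.norm_zero)
    then show "norm x = 0" using cprod_norm_nonneg[of x] by (simp add: norm_cprod_def)
  qed
  show "norm (x + y) \<le> norm x + norm y"
    unfolding norm_cprod_def
  proof (rule cprod_norm_least)
    fix A :: "'a cstar" assume A: "is_cstar A"
    then interpret cstar_record A by unfold_locales
    show "c_norm A (Rep_cprod (x + y) A) \<le> cprod_norm x + cprod_norm y"
      using norm_triangle[of "Rep_cprod x A" "Rep_cprod y A"] cprod_norm_upper[OF A, of x]
        cprod_norm_upper[OF A, of y] A by (simp add: cprod_rep)
  qed (simp add: cprod_norm_nonneg)
  have le: "norm (r *\<^sub>R x) \<le> \<bar>r\<bar> * norm x" for r and x :: "'a cprod"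
    unfolding norm_cprod_def
  proof (rule cprod_norm_least)
    fix A :: "'a cstar" assume A: "is_cstar A"
    then interpret cstar_record A by unfold_locales
    show "c_norm A (Rep_cprod (r *\<^sub>R x) A) \<le> \<bar>r\<bar> * cprod_norm x"
      using cprod_norm_upper[OF A, of x] A by (simp add: cprod_rep norm_smul mult_left_mono)
  qed (simp add: cprod_norm_nonneg)
  show "norm (r *\<^sub>R x) = \<bar>r\<bar> * norm x"
  proof (cases "r = 0")
    case False
    have "\<bar>r\<bar> * norm x = \<bar>r\<bar> * norm (inverse r *\<^sub>R (r *\<^sub>R x))" using False by simp
    also have "\<dots> \<le> \<bar>r\<bar> * (\<bar>inverse r\<bar> * norm (r *\<^sub>R x))" by (intro mult_left_mono le) simp
    finally show ?thesis using False le[of r x] by (simp flip: mult.assoc abs_mult)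
  next
    case True
    then show ?thesis using le[of r x] cprod_norm_nonneg[of "r *\<^sub>R x"] by (auto simp: norm_cprod_def)
  qed
  show "norm (x * y) \<le> norm x * norm y"
    unfolding norm_cprod_def
  proof (rule cprod_norm_least)
    fix A :: "'a cstar" assume A: "is_cstar A"
    then interpret cstar_record A by unfold_locales
    have "c_norm A (Rep_cprod (x * y) A) \<le> c_norm A (Rep_cprod x A) * c_norm A (Rep_cprod y A)"
      using norm_mult_le[of "Rep_cprod x A" "Rep_cprod y A"] A by (simp add: cprod_rep)
    also have "\<dots> \<le> cprod_norm x * cprod_norm y"
      using A by (intro mult_mono cprod_norm_upper cprod_norm_nonneg norm_nonneg) auto
    finally show "c_norm A (Rep_cprod (x * y) A) \<le> cprod_norm x * cprod_norm y" .
  qed (simp add: cprod_norm_nonneg)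
qed

end

lemma c_norm_Rep_cprod_le: "is_cstar A \<Longrightarrow> c_norm A (Rep_cprod f A) \<le> norm f"
  by (simp add: norm_cprod_def cprod_norm_upper)

lemma c_norm_Rep_cprod_diff_le:
  "is_cstar A \<Longrightarrow> c_norm A (c_diff A (Rep_cprod f A) (Rep_cprod g A)) \<le> norm (f - g)"
  by (metis Rep_cprod_minus c_norm_Rep_cprod_le)

instance cprod :: (type) banach
proof
  fix X :: "nat \<Rightarrow> 'a cprod" assume X: "Cauchy X"
  have Xc: "\<exists>N. \<forall>m\<ge>N. \<forall>n\<ge>N. norm (X m - X n) < e" if "e > 0" for e
    using X that unfolding Cauchy_def dist_norm by blast
  have "\<exists>a\<in>c_carrier A. c_converges A (\<lambda>n. Rep_cprod (X n) A) a" if A: "is_cstar A" for A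
  proof -
    interpret cstar_record A using A by unfold_locales
    show ?thesis
    proof (rule complete)
      show "c_cauchy A (\<lambda>n. Rep_cprod (X n) A)"
        unfolding c_cauchy_def using Xc c_norm_Rep_cprod_diff_le[OF A] by (meson le_less_trans)
    qed (use A in auto)
  qed
  then obtain l where l: "\<And>A. is_cstar A \<Longrightarrow> l A \<in> c_carrier A"
      "\<And>A. is_cstar A \<Longrightarrow> c_converges A (\<lambda>n. Rep_cprod (X n) A) (l A)"
    by metis
  \<comment> \<open>The Cauchy estimate passes to the limit in each factor with a bound that does
    not depend on A; this uniformity gives convergence in the supremum norm.\<close>
  have close: "c_norm A (c_diff A (Rep_cprod (X m) A) (l A)) \<le> e"
    if A: "is_cstar A" and "\<forall>n\<ge>N. norm (X m - X n) < e" for A m N e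
  proof (rule field_le_epsilon)
    fix d :: real assume "d > 0"
    interpret cstar_record A using A by unfold_locales
    from l(2)[OF A] \<open>d > 0\<close> obtain N' where N': "\<And>n. n \<ge> N' \<Longrightarrow> c_norm A (c_diff A (Rep_cprod (X n) A) (l A)) < d"
      unfolding c_converges_def by blast
    define n where "n = max N N'"
    let ?x = "Rep_cprod (X m) A" and ?y = "Rep_cprod (X n) A"
    have cl: "?x \<in> c_carrier A" "?y \<in> c_carrier A" "l A \<in> c_carrier A" using A l(1) by auto
    have "c_diff A ?x (l A) = c_add A (c_add A ?x (c_add A (c_smul A (-1) ?y) ?y)) (c_smul A (-1) (l A))"
      using cl by (simp add: c_diff_def add_commute[of "c_smul A (-1) ?y"] add_minus add_zero)
    also have "\<dots> = c_add A (c_diff A ?x ?y) (c_diff A ?y (l A))"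
      using cl by (simp add: c_diff_def add_assoc)
    finally have "c_norm A (c_diff A ?x (l A)) \<le> c_norm A (c_diff A ?x ?y) + c_norm A (c_diff A ?y (l A))"
      using cl by (metis norm_triangle diff_closed)
    also have "\<dots> \<le> e + d"
      using c_norm_Rep_cprod_diff_le[OF A, of "X m" "X n"] that(2) N'[of n]
      by (smt (verit) n_def max.cobounded1 max.cobounded2)
    finally show "c_norm A (c_diff A (Rep_cprod (X m) A) (l A)) \<le> e + d" .
  qed
  define L where "L = (\<lambda>A. if is_cstar A then l A else undefined)"
  obtain N1 where N1: "\<forall>m\<ge>N1. \<forall>n\<ge>N1. norm (X m - X n) < 1" using Xc[of 1] by auto
  have "L \<in> cprod_fns"
  proof (rule cprod_fnsI[where B="norm (X N1) + 1"])
    fix A :: "'a cstar" assume A: "is_cstar A"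
    then interpret cstar_record A by unfold_locales
    let ?x = "Rep_cprod (X N1) A"
    have cl: "?x \<in> c_carrier A" "l A \<in> c_carrier A" using A l(1) by auto
    have "c_add A ?x (c_smul A (-1) (c_diff A ?x (l A))) = c_add A (c_add A ?x (c_smul A (-1) ?x)) (l A)"
      using cl by (simp add: c_diff_def smul_add_right smul_smul smul_one add_assoc)
    also have "\<dots> = l A" using cl add_commute[of "c_zero A" "l A"] by (simp add: add_minus add_zero)
    finally have "c_norm A (l A) \<le> c_norm A ?x + c_norm A (c_smul A (-1) (c_diff A ?x (l A)))"
      using cl by (metis norm_triangle diff_closed smul_closed)
    also have "\<dots> \<le> norm (X N1) + 1"
      using cl c_norm_Rep_cprod_le[OF A, of "X N1"] close[OF A, of N1 N1 1] N1 by (simp add: norm_smul)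
    finally show "c_norm A (L A) \<le> norm (X N1) + 1" using A by (simp add: L_def)
  qed (auto simp: L_def l)
  then have "Rep_cprod (Abs_cprod L) = L" by (rule Abs_cprod_inverse)
  then have RL: "Rep_cprod (Abs_cprod L) A = l A" if "is_cstar A" for A using that by (simp add: L_def)
  have "X \<longlonglongrightarrow> Abs_cprod L"
  proof (rule LIMSEQ_I)
    fix e :: real assume "e > 0"
    then obtain N where N: "\<forall>m\<ge>N. \<forall>n\<ge>N. norm (X m - X n) < e/2" using Xc[of "e/2"] by auto
    have "norm (X n - Abs_cprod L) < e" if "n \<ge> N" for n
    proof -
      have "cprod_norm (X n - Abs_cprod L) \<le> e/2"
        using close[of _ N n "e/2"] N that \<open>e > 0\<close>
        by (intro cprod_norm_least) (auto simp: Rep_cprod_minus RL)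
      then show ?thesis using \<open>e > 0\<close> by (simp add: norm_cprod_def)
    qed
    then show "\<exists>N. \<forall>n\<ge>N. norm (X n - Abs_cprod L) < e" by blast
  qed
  then show "convergent X" by (auto simp: convergent_def)
qed

instantiation cprod :: (type) cstar_alg
begin

lift_definition cscale_cprod :: "complex \<Rightarrow> 'a cprod \<Rightarrow> 'a cprod" is
  "\<lambda>r f A. if is_cstar A then c_smul A r (f A) else undefined"
  subgoal for r by (rule cprod_fns_op1[where K="cmod r"]) (auto simp: cstar_record_def cstar_record.norm_smul cstar_record.smul_closed)
  done

lift_definition star_cprod :: "'a cprod \<Rightarrow> 'a cprod" is
  "\<lambda>f A. if is_cstar A then c_star A (f A) else undefined"
proof (rule cprod_fns_op1[where h=c_star and K=1])
  fix A :: "'a cstar" and x assume "is_cstar A" and x: "x \<in> c_carrier A"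
  then interpret cstar_record A by unfold_locales
  have "(c_norm A (c_star A x))\<^sup>2 \<le> c_norm A x * c_norm A (c_star A x)"
    using norm_star_mult[of "c_star A x"] norm_mult_le[of x "c_star A x"] x by (simp add: star_star)
  then show "c_norm A (c_star A x) \<le> 1 * c_norm A x"
    using norm_nonneg[of "c_star A x"] norm_nonneg[of x] x
    by (cases "c_norm A (c_star A x) = 0") (auto simp: power2_eq_square)
qed (auto simp: cstar_record_def cstar_record.star_closed)

instance
proof
  note cprod_rep = cprod_rep cscale_cprod.rep_eq
  fix a b :: complex and x y z :: "'a cprod"
  show "cscale a (x + y) = cscale a x + cscale a y"
    by (rule cprod_eqI) (simp add: cprod_rep cstar_record_def cstar_record.smul_add_right)
  show "cscale (a + b) x = cscale a x + cscale b x"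
    by (rule cprod_eqI) (simp add: cprod_rep cstar_record_def cstar_record.smul_add_left)
  show "cscale a (cscale b x) = cscale (a * b) x"
    by (rule cprod_eqI) (simp add: cprod_rep cstar_record_def cstar_record.smul_smul)
  show "r *\<^sub>R x = cscale (complex_of_real r) x" for r
    by (rule cprod_eqI) (simp add: cprod_rep)
  show "cscale a x * y = cscale a (x * y)"
    by (rule cprod_eqI) (simp add: cprod_rep cstar_record_def cstar_record.smul_mult_left)
  show "x * cscale a y = cscale a (x * y)"
    by (rule cprod_eqI) (simp add: cprod_rep cstar_record_def cstar_record.smul_mult_right)
  have le: "norm (cscale r x) \<le> cmod r * norm x" for r and x :: "'a cprod"
    unfolding norm_cprod_def
  proof (rule cprod_norm_least)
    fix A :: "'a cstar" assume A: "is_cstar A"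
    then interpret cstar_record A by unfold_locales
    show "c_norm A (Rep_cprod (cscale r x) A) \<le> cmod r * cprod_norm x"
      using cprod_norm_upper[OF A, of x] A by (simp add: cprod_rep norm_smul mult_left_mono)
  qed (simp add: cprod_norm_nonneg)
  show "norm (cscale a x) = cmod a * norm x"
  proof (cases "a = 0")
    case False
    have "cscale (inverse a) (cscale a x) = x" using False
      by (intro cprod_eqI) (simp add: cprod_rep cstar_record_def cstar_record.smul_smul cstar_record.smul_one)
    then have "cmod a * norm x = cmod a * norm (cscale (inverse a) (cscale a x))" by simp
    also have "\<dots> \<le> cmod a * (cmod (inverse a) * norm (cscale a x))" by (intro mult_left_mono le) simp
    finally show ?thesis using False le[of a x] by (simp flip: mult.assoc norm_mult)
  next
    case True
    then show ?thesis using le[of a x] by simp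
  qed
  show "star (star x) = x"
    by (rule cprod_eqI) (simp add: star_cprod.rep_eq cstar_record_def cstar_record.star_star)
  show "star (x + y) = star x + star y"
    by (rule cprod_eqI) (simp add: star_cprod.rep_eq cprod_rep cstar_record_def cstar_record.star_add)
  show "star (x * y) = star y * star x"
    by (rule cprod_eqI) (simp add: star_cprod.rep_eq cprod_rep cstar_record_def cstar_record.star_mult)
  show "star (cscale a x) = cscale (cnj a) (star x)"
    by (rule cprod_eqI) (simp add: star_cprod.rep_eq cprod_rep cstar_record_def cstar_record.star_smul)
  have sq: "c_norm A (Rep_cprod (star x * x) A) = (c_norm A (Rep_cprod x A))\<^sup>2" if "is_cstar A" for A
    using that by (simp add: star_cprod.rep_eq cprod_rep cstar_record_def cstar_record.norm_star_mult)
  show "norm (star x * x) = (norm x)\<^sup>2"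
  proof (rule antisym)
    show "norm (star x * x) \<le> (norm x)\<^sup>2"
      unfolding norm_cprod_def
    proof (rule cprod_norm_least)
      fix A :: "'a cstar" assume A: "is_cstar A"
      then interpret cstar_record A by unfold_locales
      show "c_norm A (Rep_cprod (star x * x) A) \<le> (cprod_norm x)\<^sup>2"
        unfolding sq[OF A] by (intro power_mono cprod_norm_upper A norm_nonneg) (use A in auto)
    qed simp
    have "norm x \<le> sqrt (norm (star x * x))"
      unfolding norm_cprod_def
    proof (rule cprod_norm_least)
      fix A :: "'a cstar" assume A: "is_cstar A"
      show "c_norm A (Rep_cprod x A) \<le> sqrt (cprod_norm (star x * x))"
        using cprod_norm_upper[OF A, of "star x * x"] sq[OF A] by (simp add: real_le_rsqrt)
    qed (simp add: cprod_norm_nonneg)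
    then have "(norm x)\<^sup>2 \<le> (sqrt (norm (star x * x)))\<^sup>2" by (intro power_mono) auto
    then show "(norm x)\<^sup>2 \<le> norm (star x * x)" by simp
  qed
qed

end

lemmas cprod_rep' = cprod_rep cscale_cprod.rep_eq star_cprod.rep_eq

section \<open>The isometric embedding of one factor\<close>

definition emb :: "'a cstar \<Rightarrow> 'a \<Rightarrow> 'a cprod" where
  "emb A x = Abs_cprod (\<lambda>B. if is_cstar B then (if B = A then x else c_zero B) else undefined)"

context cstar_record
begin

lemma Rep_emb:
  assumes "x \<in> c_carrier A" "is_cstar B"
  shows "Rep_cprod (emb A x) B = (if B = A then x else c_zero B)"
proof -
  have "(\<lambda>B. if is_cstar B then (if B = A then x else c_zero B) else undefined) \<in> cprod_fns"
    by (rule cprod_fnsI[where B="c_norm A x"])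
       (use assms norm_nonneg[of x] in \<open>auto simp: cstar_record_def cstar_record.norm_zero cstar_record.zero_closed\<close>)
  then show ?thesis using assms by (simp add: emb_def Abs_cprod_inverse)
qed

lemma Rep_emb_same [simp]: "x \<in> c_carrier A \<Longrightarrow> Rep_cprod (emb A x) A = x"
  by (simp add: Rep_emb is_cstar)

lemma zero_absorb:
  assumes "x \<in> c_carrier A"
  shows "c_mult A x (c_zero A) = c_zero A" "c_mult A (c_zero A) x = c_zero A"
    "c_add A (c_zero A) x = x" "c_smul A a (c_zero A) = c_zero A" "c_star A (c_zero A) = c_zero A"
proof -
  have z: "c_smul A 0 x = c_zero A" using assms by (rule smul_zero_left)
  show "c_mult A x (c_zero A) = c_zero A"
    using smul_mult_right[of x x 0] smul_zero_left[of "c_mult A x x"] z assms by simp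
  show "c_mult A (c_zero A) x = c_zero A"
    using smul_mult_left[of x x 0] smul_zero_left[of "c_mult A x x"] z assms by simp
  show "c_add A (c_zero A) x = x" using assms add_commute[of "c_zero A" x] by (simp add: add_zero)
  show *: "c_smul A a (c_zero A) = c_zero A" for a
    using smul_smul[of x a 0] z assms by (metis mult_zero_right)
  show "c_star A (c_zero A) = c_zero A"
    using star_smul[of x 0] z assms smul_zero_left[of "c_star A x"] by simp
qed

lemma emb_zero [simp]: "emb A (c_zero A) = 0"
  by (rule cprod_eqI) (simp add: Rep_emb cprod_rep)

lemma emb_add [simp]: "\<lbrakk>x \<in> c_carrier A; y \<in> c_carrier A\<rbrakk> \<Longrightarrow> emb A (c_add A x y) = emb A x + emb A y"
  by (rule cprod_eqI) (auto simp: Rep_emb cprod_rep cstar_record_def cstar_record.zero_absorb cstar_record.zero_closed)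

lemma emb_smul [simp]: "x \<in> c_carrier A \<Longrightarrow> emb A (c_smul A a x) = cscale a (emb A x)"
  by (rule cprod_eqI) (auto simp: Rep_emb cprod_rep' cstar_record_def cstar_record.zero_absorb(4)[OF _ cstar_record.zero_closed])

lemma emb_star [simp]: "x \<in> c_carrier A \<Longrightarrow> emb A (c_star A x) = star (emb A x)"
  by (rule cprod_eqI) (auto simp: Rep_emb cprod_rep' cstar_record_def cstar_record.zero_absorb(5)[OF _ cstar_record.zero_closed])

text \<open>An arbitrary element of the product acts on the image of A through its A-coordinate.
  Hence the image is an ideal and not merely a subalgebra.\<close>

lemma emb_mult_left: "x \<in> c_carrier A \<Longrightarrow> emb A x * b = emb A (c_mult A x (Rep_cprod b A))"
  by (rule cprod_eqI) (auto simp: Rep_emb cprod_rep' is_cstar cstar_record_def cstar_record.zero_absorb)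

lemma emb_mult_right: "x \<in> c_carrier A \<Longrightarrow> b * emb A x = emb A (c_mult A (Rep_cprod b A) x)"
  by (rule cprod_eqI) (auto simp: Rep_emb cprod_rep' is_cstar cstar_record_def cstar_record.zero_absorb)

lemma emb_mult [simp]: "\<lbrakk>x \<in> c_carrier A; y \<in> c_carrier A\<rbrakk> \<Longrightarrow> emb A (c_mult A x y) = emb A x * emb A y"
  by (simp add: emb_mult_left)

lemma emb_inject [simp]: "\<lbrakk>x \<in> c_carrier A; y \<in> c_carrier A\<rbrakk> \<Longrightarrow> emb A x = emb A y \<longleftrightarrow> x = y"
  by (metis Rep_emb_same)

lemma emb_eq_zero [simp]: "x \<in> c_carrier A \<Longrightarrow> emb A x = 0 \<longleftrightarrow> x = c_zero A"
  using emb_inject[of x "c_zero A"] by simp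

lemma emb_diff [simp]: "\<lbrakk>x \<in> c_carrier A; y \<in> c_carrier A\<rbrakk> \<Longrightarrow> emb A (c_diff A x y) = emb A x - emb A y"
  using scaleR_cscale[of "-1" "emb A y"] by (simp add: c_diff_def)

lemma norm_emb [simp]:
  assumes "x \<in> c_carrier A"
  shows "norm (emb A x) = c_norm A x"
proof (rule antisym)
  show "norm (emb A x) \<le> c_norm A x"
    unfolding norm_cprod_def using assms
    by (intro cprod_norm_least) (auto simp: Rep_emb norm_nonneg cstar_record_def cstar_record.norm_zero)
  show "c_norm A x \<le> norm (emb A x)"
    using c_norm_Rep_cprod_le[OF is_cstar, of "emb A x"] assms by simp
qed

lemma c_converges_iff:
  assumes "\<And>n. x n \<in> c_carrier A" "a \<in> c_carrier A"
  shows "c_converges A x a \<longleftrightarrow> (\<lambda>n. emb A (x n)) \<longlonglongrightarrow> emb A a"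
  unfolding c_converges_def LIMSEQ_iff using assms by (simp flip: norm_emb)

text \<open>Coordinates are norm-decreasing, so every coordinate other than A of a limit
  vanishes.\<close>

lemma closed_emb_carrier: "closed (emb A ` c_carrier A)"
  unfolding closed_sequential_limits
proof safe
  fix x l assume x: "\<forall>n. x n \<in> emb A ` c_carrier A" and l: "x \<longlonglongrightarrow> l"
  have "l = emb A (Rep_cprod l A)"
  proof (rule cprod_eqI)
    fix B :: "'a cstar" assume B: "is_cstar B"
    interpret B: cstar_record B using B by unfold_locales
    show "Rep_cprod l B = Rep_cprod (emb A (Rep_cprod l A)) B"
    proof (cases "B = A")
      case True then show ?thesis using B by simp
    next
      case False
      have "c_norm B (Rep_cprod l B) \<le> norm (l - x n)" for n
      proof -
        obtain y where y: "y \<in> c_carrier A" "x n = emb A y" using x by blast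
        then have "Rep_cprod (l - x n) B = Rep_cprod l B"
          using B False by (simp add: Rep_cprod_minus Rep_emb c_diff_def B.zero_absorb(4)[OF B.zero_closed] B.add_zero)
        then show ?thesis using c_norm_Rep_cprod_le[OF B, of "l - x n"] by simp
      qed
      moreover have "(\<lambda>n. norm (l - x n)) \<longlonglongrightarrow> norm (l - l)" by (intro tendsto_intros l)
      ultimately have "c_norm B (Rep_cprod l B) \<le> 0" by (intro LIMSEQ_le_const) auto
      then have "Rep_cprod l B = c_zero B"
        using B.norm_nonneg[of "Rep_cprod l B"] B.norm_eq_zero[of "Rep_cprod l B"] B by auto
      then show ?thesis using False B is_cstar by (simp add: Rep_emb)
    qed
  qed
  then show "l \<in> emb A ` c_carrier A" using is_cstar by blast
qed

lemma c_closed_set_iff: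
  assumes "S \<subseteq> c_carrier A"
  shows "c_closed_set A S \<longleftrightarrow> closed (emb A ` S)"
proof
  assume S: "c_closed_set A S"
  show "closed (emb A ` S)"
    unfolding closed_sequential_limits
  proof safe
    fix x l assume x: "\<forall>n. x n \<in> emb A ` S" and l: "x \<longlonglongrightarrow> l"
    define y where "y n = Rep_cprod (x n) A" for n
    have y: "y n \<in> S" "x n = emb A (y n)" for n
    proof -
      obtain z where "z \<in> S" "x n = emb A z" using x by blast
      then show "y n \<in> S" "x n = emb A (y n)" using assms by (auto simp: y_def)
    qed
    have "l \<in> emb A ` c_carrier A"
      using closed_sequentially[OF closed_emb_carrier, of x l] x l assms by blast
    then obtain a where a: "a \<in> c_carrier A" "l = emb A a" by blast
    have "c_converges A y a" using l y a assms by (subst c_converges_iff) (auto simp flip: y(2))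
    then show "l \<in> emb A ` S" using S y a unfolding c_closed_set_def by blast
  qed
next
  assume S: "closed (emb A ` S)"
  show "c_closed_set A S"
    unfolding c_closed_set_def
  proof safe
    fix x a assume x: "\<forall>n. x n \<in> S" and a: "a \<in> c_carrier A" and "c_converges A x a"
    then have "(\<lambda>n. emb A (x n)) \<longlonglongrightarrow> emb A a" using assms by (subst (asm) c_converges_iff) auto
    then have "emb A a \<in> emb A ` S" using closed_sequentially[OF S, of "\<lambda>n. emb A (x n)"] x by blast
    then show "a \<in> S" using a assms by auto
  qed
qed

text \<open>The step function of \<open>c_sum\<close> commutes only on the carrier, so the fold is
  analysed through its graph: every value in the graph embeds to the same class sum, which makes the
  value unique.\<close>

lemma fold_graph_emb:
  assumes "fold_graph (\<lambda>x acc. c_add A (f x) acc) (c_zero A) S y" "finite S" "\<And>x. x \<in> S \<Longrightarrow> f x \<in> c_carrier A"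
  shows "y \<in> c_carrier A \<and> emb A y = (\<Sum>x\<in>S. emb A (f x))"
  using assms
proof (induction rule: fold_graph.induct)
  case (insertI x S y)
  then show ?case by simp
qed simp

lemma
  assumes "finite S" "\<And>x. x \<in> S \<Longrightarrow> f x \<in> c_carrier A"
  shows c_sum_closed: "c_sum A f S \<in> c_carrier A"
    and emb_c_sum: "emb A (c_sum A f S) = (\<Sum>x\<in>S. emb A (f x))"
proof -
  let ?P = "fold_graph (\<lambda>x acc. c_add A (f x) acc) (c_zero A) S"
  obtain y where y: "?P y" using finite_imp_fold_graph[OF assms(1)] by metis
  have "z = y" if "?P z" for z
    using fold_graph_emb[OF that assms] fold_graph_emb[OF y assms] emb_inject by metis
  then have "(THE z. ?P z) = y" using y by (intro the_equality)
  then have "c_sum A f S = y" using assms(1) by (simp add: c_sum_def Finite_Set.fold_def)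
  then show "c_sum A f S \<in> c_carrier A" "emb A (c_sum A f S) = (\<Sum>x\<in>S. emb A (f x))"
    using fold_graph_emb[OF y assms] by auto
qed

end

section \<open>Positivity and homomorphisms without spectral theory\<close>

lemma cscale_zero_left [simp]: "cscale 0 (x :: 'a::cstar_alg) = 0"
  using scaleR_cscale[of 0 x] by simp

lemma cscale_one [simp]: "cscale 1 (x :: 'a::cstar_alg) = x"
  using scaleR_cscale[of 1 x] by simp

lemma cscale_zero_right [simp]: "cscale a (0 :: 'a::cstar_alg) = 0"
  using cscale_add_right[of a 0 "0::'a"] by simp

lemma cscale_minus_left: "cscale (- a) (x :: 'a::cstar_alg) = - cscale a x"
  using cscale_add_left[of a "- a" x] by (simp add: eq_neg_iff_add_eq_0 add.commute)

lemma cscale_minus_right: "cscale a (- x :: 'a::cstar_alg) = - cscale a x"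
  using cscale_add_right[of a x "- x"] by (simp add: eq_neg_iff_add_eq_0 add.commute)

lemma cscale_diff_right: "cscale a (x - y :: 'a::cstar_alg) = cscale a x - cscale a y"
  using cscale_add_right[of a x "- y"] by (simp add: cscale_minus_right)

lemma cscale_sum_right: "cscale a (\<Sum>i\<in>S. f i :: 'a::cstar_alg) = (\<Sum>i\<in>S. cscale a (f i))"
  by (induction S rule: infinite_finite_induct) (auto simp: cscale_add_right)

lemma cscale_sum_left: "cscale (\<Sum>i\<in>S. f i) (x :: 'a::cstar_alg) = (\<Sum>i\<in>S. cscale (f i) x)"
  by (induction S rule: infinite_finite_induct) (auto simp: cscale_add_left)

lemma norm_star [simp]: "norm (star x :: 'a::cstar_alg) = norm x"
proof -
  have "norm y \<le> norm (star y)" for y :: 'a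
  proof (cases "norm y = 0")
    case False
    have "norm y * norm y \<le> norm (star y) * norm y"
      using norm_star_mult[of y] norm_mult_ineq[of "star y" y] by (simp add: power2_eq_square)
    then show ?thesis using False by simp
  qed simp
  from this[of x] this[of "star x"] show ?thesis by simp
qed

lemma bounded_linear_star: "bounded_linear (star :: 'a::cstar_alg \<Rightarrow> 'a)"
  by (rule bounded_linear_intro[where K=1]) (auto simp: star_add scaleR_cscale)

lemma star_zero [simp]: "star (0 :: 'a::cstar_alg) = 0"
  using norm_star[of "0::'a"] by (simp del: norm_star)

lemma star_minus: "star (- x :: 'a::cstar_alg) = - star x"
  using star_add[of x "- x"] by (simp add: eq_neg_iff_add_eq_0 add.commute)

lemma star_diff: "star (x - y :: 'a::cstar_alg) = star x - star y"
  using star_add[of x "- y"] by (simp add: star_minus)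

lemma star_sum: "star (\<Sum>i\<in>S. f i :: 'a::cstar_alg) = (\<Sum>i\<in>S. star (f i))"
  by (induction S rule: infinite_finite_induct) (auto simp: star_add)

lemma star_mult_self_eq_0_iff [simp]: "star x * x = 0 \<longleftrightarrow> (x :: 'a::cstar_alg) = 0"
  using norm_star_mult[of x] by auto

lemma norm_square_self_adjoint: "star x = x \<Longrightarrow> norm (x * x :: 'a::cstar_alg) = (norm x)\<^sup>2"
  using norm_star_mult[of x] by simp

lemma norm_projection_le_one:
  fixes p :: "'a::cstar_alg"
  assumes "star p = p" "p * p = p"
  shows "norm p \<le> 1"
  using norm_star_mult[of p] assms by (cases "norm p = 0") (auto simp: power2_eq_square)

lemma norm_diff_projection_le:
  fixes q a :: "'a::cstar_alg"
  assumes "star q = q" "q * q = q"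
  shows "norm (a - q * a) \<le> norm a"
proof -
  let ?b = "a - q * a"
  have "q * (q * a) = q * a" by (simp add: assms(2) flip: mult.assoc)
  then have "star ?b * ?b = star ?b * a"
    by (simp add: star_diff star_mult assms algebra_simps)
  then have "norm ?b * norm ?b \<le> norm ?b * norm a"
    using norm_star_mult[of ?b] norm_mult_ineq[of "star ?b" a] by (simp add: power2_eq_square)
  then show ?thesis by (cases "norm ?b = 0") auto
qed

text \<open>The bound on m excludes nonzero multiples of N; for m \<noteq> 0 the sum is therefore
  geometric with a ratio that is an N-th root of unity different from 1.\<close>

lemma sum_cis_roots_of_unity:
  fixes m :: int
  assumes "\<bar>m\<bar> < int N"
  shows "(\<Sum>j<N. cis (2 * pi * real j * real_of_int m / real N)) = (if m = 0 then of_nat N else 0)"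
proof (cases "m = 0")
  case False
  have N: "N > 0" using assms by simp
  define w where "w = cis (2 * pi * real_of_int m / real N)"
  have pw: "cis (2 * pi * real j * real_of_int m / real N) = w ^ j" for j
    unfolding w_def Complex.DeMoivre by (rule arg_cong[where f=cis]) simp
  have "w \<noteq> 1"
  proof
    assume "w = 1"
    then have "cos (2 * pi * real_of_int m / real N) = 1"
      unfolding w_def by (metis cis.sel(1) one_complex.sel(1))
    then obtain n :: int where "2 * pi * real_of_int m / real N = real_of_int n * 2 * pi"
      by (auto simp: cos_one_2pi_int)
    then have "real_of_int m = real_of_int n * real N" using N by (simp add: field_simps)
    then have "m = n * int N" by (metis of_int_eq_iff of_int_mult of_int_of_nat_eq)
    then have "\<bar>m\<bar> = \<bar>n\<bar> * int N" by (simp add: abs_mult)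
    moreover have "\<bar>n\<bar> \<ge> 1" using False \<open>m = n * int N\<close> by auto
    ultimately show False using assms mult_right_mono[of 1 "\<bar>n\<bar>" "int N"] by simp
  qed
  have "w ^ N = cis (2 * pi * real_of_int m)" using N by (simp add: w_def Complex.DeMoivre)
  also have "\<dots> = 1" using cis_multiple_2pi[of "real_of_int m"] by (simp add: mult.commute mult.left_commute)
  finally show ?thesis using False \<open>w \<noteq> 1\<close> geometric_sum[of w N] by (simp add: pw)
qed simp

text \<open>Liouville's theorem in disguise: the polynomials \<open>(p + \<zeta>h)\<^sup>n\<close> are bounded by 1 on the unit disc, hence so is
  their linear coefficient \<open>nh\<close>, which is extracted by averaging over roots of unity.\<close>

lemma zero_if_disc_bounded:
  fixes p h :: "'a::cstar_alg"
  assumes pp: "p * p = p" and ph: "p * h = h" and hp: "h * p = h"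
    and bd: "\<And>\<zeta>. cmod \<zeta> \<le> 1 \<Longrightarrow> norm (p + cscale \<zeta> h) \<le> 1"
  shows "h = 0"
proof -
  \<comment> \<open>\<open>pw n \<zeta>\<close> is p (p + \<zeta>h)^n; the recursion starts at p,
    which acts as a unit on h.\<close>
  define pw where "pw n \<zeta> = rec_nat p (\<lambda>_ x. x * (p + cscale \<zeta> h)) n" for n \<zeta>
  have pw0 [simp]: "pw 0 \<zeta> = p" and pwS [simp]: "pw (Suc n) \<zeta> = pw n \<zeta> * (p + cscale \<zeta> h)" for n \<zeta>
    by (auto simp: pw_def)
  have npw: "norm (pw n \<zeta>) \<le> 1" if "cmod \<zeta> \<le> 1" for n \<zeta>
  proof (induction n)
    case 0 show ?case using bd[of 0] by simp
  next
    case (Suc n)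
    have "norm (pw (Suc n) \<zeta>) \<le> norm (pw n \<zeta>) * norm (p + cscale \<zeta> h)" by (simp add: norm_mult_ineq)
    also have "\<dots> \<le> 1 * 1" by (intro mult_mono Suc bd that) auto
    finally show ?case by simp
  qed
  have main: "real n * norm h \<le> 1" for n
  proof -
    \<comment> \<open>N exceeds the degree n, and N \<ge> 2 lets the base case separate the indices
      0 and 1.\<close>
    define N where "N = n + 2"
    have N: "N > 0" by (simp add: N_def)
    define W where "W j m = cis (- (2 * pi * real j * real_of_int m / real N))" for j :: nat and m :: int
    \<comment> \<open>Discrete Fourier inversion: up to aliasing modulo N, \<open>c n m\<close> is N
      times the coefficient of \<zeta>^m in \<open>pw n \<zeta>\<close>.\<close>
    define c where "c n m = (\<Sum>j<N. cscale (W j m) (pw n (W j (-1))))" for n m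
    have W_mult: "W j m * W j m' = W j (m + m')" for j m m'
      unfolding W_def cis_mult by (rule arg_cong[where f=cis]) (simp add: algebra_simps add_divide_distrib)
    have cS: "c (Suc n) m = c n m * p + c n (m - 1) * h" for n m
      unfolding c_def
      by (simp add: algebra_simps sum_distrib_right sum.distrib cscale_add_right W_mult)
    have c0: "c 0 m = (if m = 0 then cscale (of_nat N) p else 0)" if "\<bar>m\<bar> < int N" for m
    proof -
      have "c 0 m = cscale (\<Sum>j<N. cis (2 * pi * real j * real_of_int (-m) / real N)) p"
        by (simp add: c_def W_def cscale_sum_left)
      then show ?thesis using that by (subst (asm) sum_cis_roots_of_unity) auto
    qed
    \<comment> \<open>A negative index m is aliased with m + N, which exceeds the degree n', so that
      coefficient vanishes.\<close>
    have "n' < N \<Longrightarrow> (\<forall>m. int n' - int N < m \<and> m < 0 \<longrightarrow> c n' m = 0) \<and>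
        c n' 0 = cscale (of_nat N) p \<and> c n' 1 = cscale (of_nat (N * n')) h" for n'
    proof (induction n')
      case 0
      then show ?case using c0 by (auto simp: N_def)
    next
      case (Suc n')
      then show ?case
        by (auto simp: cS pp ph hp simp flip: cscale_add_left) (simp add: algebra_simps)
    qed
    from this[of n] have "c n 1 = cscale (of_nat (N * n)) h" by (simp add: N_def)
    then have "real N * (real n * norm h) = norm (c n 1)" by (simp add: norm_mult)
    also have "\<dots> \<le> (\<Sum>j<N. norm (cscale (W j 1) (pw n (W j (-1)))))" unfolding c_def by (rule norm_sum)
    also have "\<dots> \<le> (\<Sum>j<N. 1)" by (intro sum_mono) (simp add: W_def npw)
    finally show ?thesis using N by simp
  qed
  show "h = 0"
  proof (rule ccontr)
    assume "h \<noteq> 0"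
    then obtain n where "1 / norm h < real n" using reals_Archimedean2 by blast
    then show False using main[of n] \<open>h \<noteq> 0\<close> by (simp add: field_simps)
  qed
qed

text \<open>Extremality of p in the unit ball of its corner, for self-adjoint directions. The
  parallelogram identity bounds p + h * h, which is star u * u for u = p + i h and for u = p - i h.
  So the directions 1, -1, i, -i are all controlled; their convex hull contains the disc of radius
  1/2, and the disc criterion applies to h/2.\<close>

lemma zero_if_two_sided_bounded:
  fixes p h :: "'a::cstar_alg"
  assumes p: "star p = p" "p * p = p" and h: "star h = h" "p * h = h" "h * p = h"
    and bd: "norm (p + h) \<le> 1" "norm (p - h) \<le> 1"
  shows "h = 0"
proof -
  have "norm ((p + h) * (p + h) + (p - h) * (p - h)) \<le> norm (p + h) * norm (p + h) + norm (p - h) * norm (p - h)"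
    by (intro order.trans[OF norm_triangle_ineq] add_mono norm_mult_ineq)
  also have "\<dots> \<le> 1 * 1 + 1 * 1" by (intro add_mono mult_mono bd) auto
  also have "(p + h) * (p + h) + (p - h) * (p - h) = 2 *\<^sub>R (p + h * h)"
    by (simp add: p h algebra_simps scaleR_2)
  finally have sq: "norm (p + h * h) \<le> 1" by simp
  have i: "norm (p + cscale z h) \<le> 1" if "z = \<i> \<or> z = - \<i>" for z
  proof -
    have "star (p + cscale z h) * (p + cscale z h) = p + h * h"
      using that by (auto simp: p h algebra_simps star_add cscale_minus_left cscale_minus_right cscale_add_right cscale_diff_right)
    then have "(norm (p + cscale z h))\<^sup>2 \<le> 1" using norm_star_mult[of "p + cscale z h"] sq by simp
    then show ?thesis by (simp add: power_le_one_iff)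
  qed
  have "cscale (1/2) h = 0"
  proof (rule zero_if_disc_bounded[of p])
    fix \<zeta> assume \<zeta>: "cmod \<zeta> \<le> 1"
    define a b where "a = Re \<zeta> / 2" and "b = Im \<zeta> / 2"
    have ab: "\<bar>a\<bar> + \<bar>b\<bar> \<le> 1" using abs_Re_le_cmod[of \<zeta>] abs_Im_le_cmod[of \<zeta>] \<zeta> by (simp add: a_def b_def)
    have A: "norm (\<bar>a\<bar> *\<^sub>R p + a *\<^sub>R h) \<le> \<bar>a\<bar>"
    proof -
      have "\<bar>a\<bar> *\<^sub>R p + a *\<^sub>R h = \<bar>a\<bar> *\<^sub>R (if a \<ge> 0 then p + h else p - h)" by (simp add: algebra_simps)
      then show ?thesis using bd by (simp add: mult_left_le)
    qed
    have B: "norm (\<bar>b\<bar> *\<^sub>R p + b *\<^sub>R cscale \<i> h) \<le> \<bar>b\<bar>"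
    proof -
      have "\<bar>b\<bar> *\<^sub>R p + b *\<^sub>R cscale \<i> h = \<bar>b\<bar> *\<^sub>R (if b \<ge> 0 then p + cscale \<i> h else p + cscale (-\<i>) h)"
        by (simp add: algebra_simps cscale_minus_left)
      then show ?thesis using i by (simp add: mult_left_le)
    qed
    have "\<zeta> / 2 = complex_of_real a + complex_of_real b * \<i>" by (simp add: a_def b_def complex_eq_iff)
    then have "cscale (\<zeta> / 2) h = cscale (complex_of_real a + complex_of_real b * \<i>) h" by (simp only:)
    then have "cscale (\<zeta> / 2) h = a *\<^sub>R h + b *\<^sub>R cscale \<i> h"
      by (simp add: scaleR_cscale cscale_add_left)
    \<comment> \<open>A convex combination of p with one of p + h, p - h and one of p + i h, p - i
      h; the weights are 1 - |a| - |b|, |a| and |b|.\<close>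
    then have "p + cscale \<zeta> (cscale (1/2) h)
        = (\<bar>a\<bar> *\<^sub>R p + a *\<^sub>R h) + (\<bar>b\<bar> *\<^sub>R p + b *\<^sub>R cscale \<i> h) + (1 - \<bar>a\<bar> - \<bar>b\<bar>) *\<^sub>R p"
      by (simp add: algebra_simps)
    also have "norm \<dots> \<le> \<bar>a\<bar> + \<bar>b\<bar> + (1 - \<bar>a\<bar> - \<bar>b\<bar>)"
      using ab norm_projection_le_one[OF p]
      by (intro order.trans[OF norm_triangle_ineq] add_mono A B) (auto simp: mult_left_le)
    finally show "norm (p + cscale \<zeta> (cscale (1/2) h)) \<le> 1" by simp
  qed (auto simp: p h)
  then have "norm (cscale (1/2) h) = 0" by simp
  then show ?thesis by simp
qed

text \<open>The condition \<open>norm (p - h) \<le> 1\<close> says that \<open>h\<close> is positive with \<open>h \<le> 2p\<close>; this way no spectral theory is needed.\<close>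

lemma positive_summands_zero:
  fixes p :: "'a::cstar_alg" and h :: "'i \<Rightarrow> 'a"
  assumes p: "star p = p" "p * p = p"
    and h: "\<And>i. i \<in> S \<Longrightarrow> star (h i) = h i \<and> p * h i = h i \<and> h i * p = h i \<and> norm (p - h i) \<le> 1"
    and "finite S" "(\<Sum>i\<in>S. h i) = 0" "j \<in> S"
  shows "h j = 0"
proof -
  let ?S = "S - {j}"
  define T where "T = real (card S)"
  have card: "card S \<ge> 1" using \<open>finite S\<close> \<open>j \<in> S\<close> by (metis One_nat_def Suc_leI card_gt_0_iff empty_iff)
  then have T: "T \<ge> 1" by (simp add: T_def)
  have cT: "real (card ?S) = T - 1" using \<open>finite S\<close> \<open>j \<in> S\<close> card by (simp add: T_def of_nat_diff)
  \<comment> \<open>Since all h i sum to 0, the terms other than j sum to - h j. So h j is bounded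
    from both sides; T = card S is a common scale for the two bounds.\<close>
  have "(\<Sum>i\<in>?S. p - h i) = real (card ?S) *\<^sub>R p - (\<Sum>i\<in>?S. h i)"
    by (simp add: sum_subtractf sum_constant_scaleR)
  also have "\<dots> = (T - 1) *\<^sub>R p + h j"
    unfolding cT using assms(4-6) by (simp add: sum_diff1)
  finally have "norm ((T - 1) *\<^sub>R p + h j) \<le> (\<Sum>i\<in>?S. norm (p - h i))" by (metis norm_sum)
  also have "\<dots> \<le> (\<Sum>i\<in>?S. 1)" by (intro sum_mono) (use h in auto)
  also have "\<dots> = T - 1" using cT by simp
  finally have 1: "norm ((T - 1) *\<^sub>R p + h j) \<le> T - 1" .
  have np: "norm p \<le> 1" by (rule norm_projection_le_one[OF p])
  have "norm (((T - 1) *\<^sub>R p + h j) + p) \<le> (T - 1) + 1"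
    by (intro order.trans[OF norm_triangle_ineq] add_mono 1 np)
  then have A: "norm (T *\<^sub>R p + h j) \<le> T" by (simp add: algebra_simps)
  have "norm ((T - 1) *\<^sub>R p + (p - h j)) \<le> (T - 1) + 1"
    using T np h[OF \<open>j \<in> S\<close>]
    by (intro order.trans[OF norm_triangle_ineq] add_mono) (auto simp: mult_left_le)
  then have B: "norm (T *\<^sub>R p - h j) \<le> T" by (simp add: algebra_simps)
  have "(1 / T) *\<^sub>R h j = 0"
  proof (rule zero_if_two_sided_bounded[OF p])
    have "p + (1 / T) *\<^sub>R h j = (1 / T) *\<^sub>R (T *\<^sub>R p + h j)" "p - (1 / T) *\<^sub>R h j = (1 / T) *\<^sub>R (T *\<^sub>R p - h j)"
      using T by (simp_all add: algebra_simps)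
    then have "norm (p + (1 / T) *\<^sub>R h j) = norm (T *\<^sub>R p + h j) / T"
        "norm (p - (1 / T) *\<^sub>R h j) = norm (T *\<^sub>R p - h j) / T"
      using T by (simp_all only: norm_scaleR) simp_all
    then show "norm (p + (1 / T) *\<^sub>R h j) \<le> 1" "norm (p - (1 / T) *\<^sub>R h j) \<le> 1"
      using A B T by simp_all
    show "star ((1 / T) *\<^sub>R h j) = (1 / T) *\<^sub>R h j" using h[OF \<open>j \<in> S\<close>] by (simp add: scaleR_cscale)
  qed (use h[OF \<open>j \<in> S\<close>] in auto)
  then show ?thesis using T by simp
qed

text \<open>Compressing P to q i gives q i = q i + (sum over j \<noteq> i of q i * q j * q i). The
  compressed terms are positive and sum to 0, so each is 0, and each is star (q j * q i) * (q j * q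
  i).\<close>

lemma projections_sum_orthogonal:
  fixes q :: "'i \<Rightarrow> 'a::cstar_alg"
  assumes q: "\<And>i. i \<in> S \<Longrightarrow> star (q i) = q i \<and> q i * q i = q i \<and> P * q i = q i"
    and "finite S" "P = (\<Sum>i\<in>S. q i)" "i \<in> S" "j \<in> S" "i \<noteq> j"
  shows "q j * q i = 0"
proof -
  let ?p = "q i"
  have p: "star ?p = ?p" "?p * ?p = ?p" using q \<open>i \<in> S\<close> by auto
  have "?p = ?p * (P * ?p)" using q \<open>i \<in> S\<close> by auto
  also have "\<dots> = (\<Sum>j\<in>S. ?p * q j * ?p)"
    by (simp add: assms(3) sum_distrib_left sum_distrib_right mult.assoc)
  also have "\<dots> = ?p + (\<Sum>j\<in>S - {i}. ?p * q j * ?p)"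
    using \<open>finite S\<close> \<open>i \<in> S\<close> by (subst sum.remove[of S i]) (auto simp: p)
  finally have sum0: "(\<Sum>j\<in>S - {i}. ?p * q j * ?p) = 0" by simp
  have "?p * q j * ?p = 0"
  proof (rule positive_summands_zero[OF p _ _ sum0])
    fix j assume "j \<in> S - {i}"
    then have qj: "star (q j) = q j" "q j * q j = q j" using q by auto
    let ?x = "?p - q j * ?p"
    have "q j * (q j * x) = q j * x" for x by (simp add: qj flip: mult.assoc)
    then have "star ?x * ?x = ?p - ?p * q j * ?p"
      by (simp add: star_diff star_mult p qj algebra_simps)
    then have "norm (?p - ?p * q j * ?p) = (norm ?x)\<^sup>2" using norm_star_mult[of ?x] by simp
    also have "\<dots> \<le> 1\<^sup>2"
      using norm_diff_projection_le[OF qj, of ?p] norm_projection_le_one[OF p] by (intro power_mono) auto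
    finally have *: "norm (?p - ?p * q j * ?p) \<le> 1" by simp
    have "?p * (?p * x) = ?p * x" for x by (simp add: p flip: mult.assoc)
    then show "star (?p * q j * ?p) = ?p * q j * ?p \<and> ?p * (?p * q j * ?p) = ?p * q j * ?p \<and>
        ?p * q j * ?p * ?p = ?p * q j * ?p \<and> norm (?p - ?p * q j * ?p) \<le> 1"
      using * by (simp add: star_mult p qj mult.assoc)
  qed (use assms in auto)
  moreover have "star (q j * ?p) * (q j * ?p) = ?p * q j * ?p"
  proof -
    have "q j * (q j * x) = q j * x" for x using q[OF \<open>j \<in> S\<close>] by (simp flip: mult.assoc)
    then show ?thesis using q[OF \<open>j \<in> S\<close>] by (simp add: star_mult p mult.assoc)
  qed
  ultimately show ?thesis by (metis star_mult_self_eq_0_iff)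
qed

section \<open>Contractivity of star homomorphisms\<close>

definition star_homomorphism :: "('a::cstar_alg \<Rightarrow> 'b::cstar_alg) \<Rightarrow> bool" where
  "star_homomorphism \<phi> \<longleftrightarrow> (\<forall>x y. \<phi> (x + y) = \<phi> x + \<phi> y \<and> \<phi> (x * y) = \<phi> x * \<phi> y) \<and>
     (\<forall>a x. \<phi> (cscale a x) = cscale a (\<phi> x)) \<and> (\<forall>x. \<phi> (star x) = star (\<phi> x))"

lemma
  assumes "star_homomorphism \<phi>"
  shows hom_add: "\<phi> (x + y) = \<phi> x + \<phi> y"
    and hom_mult: "\<phi> (x * y) = \<phi> x * \<phi> y"
    and hom_cscale: "\<phi> (cscale a x) = cscale a (\<phi> x)"
    and hom_star: "\<phi> (star x) = star (\<phi> x)"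
    and hom_zero: "\<phi> 0 = 0"
    and hom_scaleR: "\<phi> (r *\<^sub>R x) = r *\<^sub>R \<phi> x"
    and hom_diff: "\<phi> (x - y) = \<phi> x - \<phi> y"
proof -
  show *: "\<phi> (x + y) = \<phi> x + \<phi> y" "\<phi> (x * y) = \<phi> x * \<phi> y" "\<phi> (cscale a x) = cscale a (\<phi> x)"
    "\<phi> (star x) = star (\<phi> x)" for x y a using assms by (auto simp: star_homomorphism_def)
  show "\<phi> 0 = 0" using *(1)[of 0 0] by simp
  show "\<phi> (r *\<^sub>R x) = r *\<^sub>R \<phi> x" by (simp add: scaleR_cscale *)
  show "\<phi> (x - y) = \<phi> x - \<phi> y" using *(1)[of "x - y" y] by (simp add: algebra_simps)
qed

text \<open>For \<open>\<parallel>h\<parallel> < 1\<close> this is \<open>g = 1 - sqrt (1 - h\<^sup>2)\<close>, obtained as a fixed point so that no unit is needed.\<close>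

lemma self_adjoint_sqrt_complement:
  fixes h :: "'a::cstar_alg"
  assumes "star h = h" "norm h < 1"
  obtains g where "star g = g" "g * h = h * g" "h * h + g * g = 2 *\<^sub>R g"
proof -
  define \<rho> where "\<rho> = norm h"
  \<comment> \<open>On the ball of radius norm h < 1 the map T contracts with that constant.
    Self-adjointness and commutation with h are closed conditions that T preserves, so the fixed
    point inherits them.\<close>
  define S where "S = {g. star g = g \<and> g * h = h * g \<and> norm g \<le> \<rho>}"
  define T where "T g = (1/2) *\<^sub>R (h * h + g * g)" for g
  have "closed S"
  proof -
    have "S = {g. star g = g} \<inter> {g. g * h = h * g} \<inter> {g. norm g \<le> \<rho>}" by (auto simp: S_def)
    then show ?thesis
      using linear_continuous_on[OF bounded_linear_star]
      by (auto intro!: closed_Int closed_Collect_eq closed_Collect_le continuous_intros)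
  qed
  have "\<exists>!g\<in>S. T g = g"
  proof (rule Banach_fix[where c="\<rho>"])
    show "complete S" using \<open>closed S\<close> by (simp add: complete_eq_closed)
    show "S \<noteq> {}" by (auto simp: S_def \<rho>_def intro!: exI[of _ 0])
    show "0 \<le> \<rho>" "\<rho> < 1" using assms by (auto simp: \<rho>_def)
    show "T ` S \<subseteq> S"
    proof safe
      fix g assume g: "g \<in> S"
      then have c: "g * h = h * g" by (simp add: S_def)
      have "g * g * h = h * (g * g)" by (metis c mult.assoc)
      have "norm (h * h + g * g) \<le> \<rho> * 1 + \<rho> * 1"
      proof (intro order.trans[OF norm_triangle_ineq] add_mono order.trans[OF norm_mult_ineq])
        show "norm h * norm h \<le> \<rho> * 1" using assms by (intro mult_mono) (auto simp: \<rho>_def)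
        show "norm g * norm g \<le> \<rho> * 1" using assms g by (intro mult_mono) (auto simp: \<rho>_def S_def)
      qed
      then have "norm (T g) \<le> \<rho>" by (simp add: T_def)
      moreover have "star (T g) = T g" "T g * h = h * T g"
        using g assms \<open>g * g * h = h * (g * g)\<close>
        by (simp_all add: S_def T_def scaleR_cscale star_add star_mult algebra_simps)
      ultimately show "T g \<in> S" by (simp add: S_def)
    qed
    show "dist (T x) (T y) \<le> \<rho> * dist x y" if "x \<in> S" "y \<in> S" for x y
    proof -
      have "T x - T y = (1/2) *\<^sub>R (x * (x - y) + (x - y) * y)" by (simp add: T_def algebra_simps)
      then have "norm (T x - T y) = (1/2) * norm (x * (x - y) + (x - y) * y)" by simp
      also have "\<dots> \<le> (1/2) * (\<rho> * norm (x - y) + norm (x - y) * \<rho>)"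
        using that
        by (intro mult_left_mono order.trans[OF norm_triangle_ineq] add_mono order.trans[OF norm_mult_ineq] mult_mono)
          (auto simp: S_def \<rho>_def)
      finally show ?thesis by (simp add: dist_norm algebra_simps)
    qed
  qed
  then obtain g where g: "g \<in> S" "T g = g" by blast
  have "h * h + g * g = 2 *\<^sub>R T g" by (simp add: T_def)
  then show ?thesis using g that[of g] by (simp add: S_def)
qed

text \<open>With \<open>g\<close> as above, \<open>u = \<phi> h + i(1 - \<phi> g)\<close> is unitary, and \<open>\<phi> h\<close> is its real part.\<close>

lemma norm_hom_self_adjoint_le_one:
  fixes \<phi> :: "'a::cstar_alg \<Rightarrow> 'b::cstar_alg"
  assumes \<phi>: "star_homomorphism \<phi>" and h: "star h = h" "norm h < 1"
  shows "norm (\<phi> h) \<le> 1"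
proof -
  obtain g where g: "star g = g" "g * h = h * g" "h * h + g * g = 2 *\<^sub>R g"
    using self_adjoint_sqrt_complement[OF h] .
  define x y where "x = \<phi> h" and "y = \<phi> g"
  have x: "star x = x" and y: "star y = y" and yx: "y * x = x * y"
    unfolding x_def y_def using g h by (auto simp flip: hom_star[OF \<phi>] hom_mult[OF \<phi>])
  have xy: "x * x + y * y = 2 *\<^sub>R y"
    unfolding x_def y_def using g(3) by (simp flip: hom_add[OF \<phi>] hom_mult[OF \<phi>] hom_scaleR[OF \<phi>])
  \<comment> \<open>Left multiplication by the formal unitary x + z (1 - y), written on an argument
    b so that no unit occurs.\<close>
  have iso: "norm (x * b + cscale z (b - y * b)) = norm b" if z: "z = \<i> \<or> z = - \<i>" for b z
  proof -
    let ?u = "x * b + cscale z (b - y * b)"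
    have "x * x = 2 *\<^sub>R y - y * y" using xy by (simp add: algebra_simps)
    then have "x * (x * b) = (2 *\<^sub>R y - y * y) * b" by (simp flip: mult.assoc)
    then have xx: "x * (x * b) = y * b + y * b - y * (y * b)" by (simp add: algebra_simps scaleR_2)
    have yx': "y * (x * b) = x * (y * b)" using yx by (simp flip: mult.assoc)
    have zz: "z * z = -1" "cnj z = - z" using z by auto
    have "star ?u * ?u = star b * b"
      by (simp add: star_add star_mult star_diff x y cscale_diff_right cscale_add_right cscale_minus_left algebra_simps xx yx' zz)
    then have "(norm ?u)\<^sup>2 = (norm b)\<^sup>2" by (metis norm_star_mult)
    then show ?thesis by simp
  qed
  \<comment> \<open>Twice x is the sum of the two unitaries; applied to x this gives norm (x * x)
    \<le> norm x, and the left side is (norm x)^2.\<close>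
  have "2 *\<^sub>R (x * x) = (x * x + cscale \<i> (x - y * x)) + (x * x + cscale (-\<i>) (x - y * x))"
    by (simp add: cscale_minus_left scaleR_2)
  then have "2 * norm (x * x) \<le> norm (x * x + cscale \<i> (x - y * x)) + norm (x * x + cscale (-\<i>) (x - y * x))"
    using norm_triangle_ineq by (metis norm_scaleR abs_numeral)
  also have "\<dots> = 2 * norm x" using iso by simp
  finally have "(norm x)\<^sup>2 \<le> norm x" using norm_square_self_adjoint[OF x] by simp
  then show ?thesis by (cases "norm x = 0") (auto simp: x_def power2_eq_square)
qed

text \<open>Continuity is automatic: self-adjoint elements are rescaled to norm below 1, and the
  general case follows by applying this to star x * x.\<close>

lemma norm_hom_le:
  fixes \<phi> :: "'a::cstar_alg \<Rightarrow> 'b::cstar_alg"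
  assumes \<phi>: "star_homomorphism \<phi>"
  shows "norm (\<phi> x) \<le> norm x"
proof -
  have sa: "norm (\<phi> h) \<le> norm h" if h: "star h = h" for h
  proof (rule field_le_epsilon)
    fix e :: real assume "e > 0"
    define c where "c = norm h + e"
    have c: "c > 0" "norm h < c" using \<open>e > 0\<close> by (auto simp: c_def add_nonneg_pos)
    have "norm (\<phi> ((1/c) *\<^sub>R h)) \<le> 1"
      by (rule norm_hom_self_adjoint_le_one[OF \<phi>]) (use c h in \<open>auto simp: scaleR_cscale norm_divide\<close>)
    then show "norm (\<phi> h) \<le> norm h + e" using c by (simp add: hom_scaleR[OF \<phi>] field_simps c_def)
  qed
  have "(norm (\<phi> x))\<^sup>2 = norm (\<phi> (star x * x))" by (simp add: hom_mult[OF \<phi>] hom_star[OF \<phi>] norm_star_mult)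
  also have "\<dots> \<le> norm (star x * x)" by (rule sa) (simp add: star_mult)
  also have "\<dots> = (norm x)\<^sup>2" by (rule norm_star_mult)
  finally show ?thesis by simp
qed

section \<open>Paths in a k-graph\<close>

locale kgraph =
  fixes L :: "'p kgraph" and k :: nat
  assumes is_kgraph: "is_kgraph L k"
begin

abbreviation "P \<equiv> kg_paths L"
abbreviation "rng \<equiv> kg_r L"
abbreviation "src \<equiv> kg_s L"
abbreviation "deg \<equiv> kg_deg L"
abbreviation comp (infixl \<open>\<odot>\<close> 70) where "l \<odot> m \<equiv> kg_comp L l m"

lemma
  assumes "l \<in> P"
  shows rng_closed [simp, intro]: "rng l \<in> P" and src_closed [simp, intro]: "src l \<in> P"
    and rng_rng [simp]: "rng (rng l) = rng l" and src_rng [simp]: "src (rng l) = rng l"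
    and rng_src [simp]: "rng (src l) = src l" and src_src [simp]: "src (src l) = src l"
    and rng_comp [simp]: "rng l \<odot> l = l" and comp_src [simp]: "l \<odot> src l = l"
    and deg_Nk [simp]: "deg l \<in> Nk k"
  using is_kgraph assms unfolding is_kgraph_def by blast+

lemma
  assumes "l \<in> P" "m \<in> P" "src l = rng m"
  shows comp_closed [simp, intro]: "l \<odot> m \<in> P" and rng_of_comp [simp]: "rng (l \<odot> m) = rng l"
    and src_of_comp [simp]: "src (l \<odot> m) = src m" and deg_comp: "deg (l \<odot> m) = (\<lambda>i. deg l i + deg m i)"
  using is_kgraph assms unfolding is_kgraph_def by blast+

lemma comp_assoc:
  "\<lbrakk>l \<in> P; m \<in> P; n \<in> P; src l = rng m; src m = rng n\<rbrakk> \<Longrightarrow> l \<odot> m \<odot> n = l \<odot> (m \<odot> n)"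
  using is_kgraph unfolding is_kgraph_def by blast

lemma unique_factorization:
  assumes "l \<in> P" "m \<in> Nk k" "n \<in> Nk k" "deg l = (\<lambda>i. m i + n i)"
  shows "\<exists>!(a, b). a \<in> P \<and> b \<in> P \<and> src a = rng b \<and> deg a = m \<and> deg b = n \<and> a \<odot> b = l"
proof -
  have "\<forall>l\<in>P. \<forall>m\<in>Nk k. \<forall>n\<in>Nk k. deg l = (\<lambda>i. m i + n i) \<longrightarrow>
      (\<exists>!(a, b). a \<in> P \<and> b \<in> P \<and> src a = rng b \<and> deg a = m \<and> deg b = n \<and> a \<odot> b = l)"
    using is_kgraph unfolding is_kgraph_def by (elim conjE)
  from this[rule_format, OF assms] show ?thesis .
qed

lemma deg_outside: "l \<in> P \<Longrightarrow> k \<le> i \<Longrightarrow> deg l i = 0"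
  using deg_Nk[of l] by (auto simp: Nk_def)

lemma factorization:
  assumes "l \<in> P" "\<And>i. m i \<le> deg l i"
  obtains a b where "a \<in> P" "b \<in> P" "src a = rng b" "deg a = m" "deg b = (\<lambda>i. deg l i - m i)" "a \<odot> b = l"
proof -
  have "m i = 0" if "k \<le> i" for i using assms(2)[of i] deg_outside[OF assms(1) that] by simp
  then have "m \<in> Nk k" "(\<lambda>i. deg l i - m i) \<in> Nk k" using assms(1) by (auto simp: Nk_def deg_outside)
  moreover have "deg l = (\<lambda>i. m i + (deg l i - m i))" using assms(2) by auto
  ultimately show ?thesis
    using unique_factorization[OF assms(1), of m "\<lambda>i. deg l i - m i"] that by (auto elim!: ex1E)
qed

lemma factorization_cong:
  assumes "a \<in> P" "b \<in> P" "src a = rng b" "a' \<in> P" "b' \<in> P" "src a' = rng b'"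
    and eq: "a \<odot> b = a' \<odot> b'" and "deg a = deg a'"
  shows "a = a'" "b = b'"
proof -
  have "deg b i = deg b' i" for i
    using deg_comp[OF assms(1-3)] deg_comp[OF assms(4-6)] eq assms(8) by (metis add_left_cancel)
  then have "deg b = deg b'" by auto
  then have "(a, b) = (a', b')"
    using unique_factorization[of "a \<odot> b" "deg a" "deg b"] assms deg_comp[OF assms(1-3)]
    by (auto elim!: ex1E)
  then show "a = a'" "b = b'" by auto
qed

lemma deg_rng [simp]: "l \<in> P \<Longrightarrow> deg (rng l) = (\<lambda>_. 0)"
proof -
  assume l: "l \<in> P"
  have "rng l \<odot> rng l = rng l" using rng_comp[of "rng l"] l by simp
  then have "deg (rng l) = (\<lambda>i. deg (rng l) i + deg (rng l) i)"
    using deg_comp[of "rng l" "rng l"] l by simp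
  then have "deg (rng l) i = deg (rng l) i + deg (rng l) i" for i by (rule fun_cong)
  then show ?thesis by auto
qed

lemma rng_vertex [simp, intro]: "l \<in> P \<Longrightarrow> rng l \<in> vertices L"
  by (simp add: vertices_def)

lemma src_vertex [simp, intro]: "l \<in> P \<Longrightarrow> src l \<in> vertices L"
  using rng_vertex[of "src l"] by simp

lemma
  assumes "v \<in> vertices L"
  shows vertex_path [simp]: "v \<in> P" and rng_of_vertex [simp]: "rng v = v" and src_of_vertex [simp]: "src v = v"
    and deg_vertex [simp]: "deg v = (\<lambda>_. 0)"
proof -
  show v: "v \<in> P" and d: "deg v = (\<lambda>_. 0)" using assms by (auto simp: vertices_def)
  have "deg (src v) = (\<lambda>_. 0)" using deg_rng[of "src v"] v by simp
  \<comment> \<open>Both sides are factorizations of v into two factors of degree 0, so uniqueness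
    identifies them.\<close>
  moreover have "rng v \<odot> v = v \<odot> src v" using v by simp
  ultimately have "rng v = v \<and> v = src v"
    using factorization_cong[of "rng v" v v "src v"] v d deg_rng[OF v]
      rng_closed[OF v] src_closed[OF v] src_rng[OF v] rng_src[OF v] by simp
  then show "rng v = v" "src v = v" by simp_all
qed

section \<open>Initial segments of paths\<close>

definition initial (infix \<open>\<preceq>\<close> 50) where "a \<preceq> l \<longleftrightarrow> a \<in> P \<and> (\<exists>b\<in>P. src a = rng b \<and> l = a \<odot> b)"

lemma initial_path: "a \<preceq> l \<Longrightarrow> a \<in> P \<and> l \<in> P \<and> rng a = rng l"
  by (auto simp: initial_def)

lemma initial_refl [simp]: "l \<in> P \<Longrightarrow> l \<preceq> l"
  unfolding initial_def by (auto intro!: bexI[of _ "src l"])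

lemma initial_rng: "l \<in> P \<Longrightarrow> rng l \<preceq> l"
  unfolding initial_def by (auto intro!: bexI[of _ l])

lemma initial_comp: "\<lbrakk>a \<in> P; b \<in> P; src a = rng b\<rbrakk> \<Longrightarrow> a \<preceq> a \<odot> b"
  by (auto simp: initial_def)

lemma initial_trans: "a \<preceq> b \<Longrightarrow> b \<preceq> c \<Longrightarrow> a \<preceq> c"
  unfolding initial_def by (metis comp_assoc comp_closed rng_of_comp src_of_comp)

lemma initial_deg: "a \<preceq> l \<Longrightarrow> deg a i \<le> deg l i"
  by (auto simp: initial_def deg_comp)

text \<open>Cut b at the degree of a; uniqueness of the factorization of l forces the piece cut off
  to be a.\<close>

lemma initial_comparable:
  assumes "a \<preceq> l" "b \<preceq> l" "\<And>i. deg a i \<le> deg b i"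
  shows "a \<preceq> b"
proof -
  obtain c where c: "a \<in> P" "c \<in> P" "src a = rng c" "l = a \<odot> c" using assms(1) by (auto simp: initial_def)
  obtain d where d: "b \<in> P" "d \<in> P" "src b = rng d" "l = b \<odot> d" using assms(2) by (auto simp: initial_def)
  obtain a' e where e: "a' \<in> P" "e \<in> P" "src a' = rng e" "deg a' = deg a" "a' \<odot> e = b"
    using factorization[OF d(1) assms(3)] by metis
  have "src e = rng d" using d(3) e by auto
  then have "l = a' \<odot> (e \<odot> d)" using d e by (auto simp: comp_assoc)
  then have "a = a'" using factorization_cong(1)[of a c a' "e \<odot> d"] c d e \<open>src e = rng d\<close> by auto
  then show ?thesis using e by (auto simp: initial_def)
qed

lemma initial_antisym: "a \<preceq> b \<Longrightarrow> b \<preceq> a \<Longrightarrow> a = b"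
proof -
  assume ab: "a \<preceq> b" "b \<preceq> a"
  then have "deg a = deg b" using initial_deg by (metis antisym ext)
  from ab(1) obtain c where c: "a \<in> P" "c \<in> P" "src a = rng c" "b = a \<odot> c" by (auto simp: initial_def)
  have b: "b \<in> P" using initial_path[OF ab(2)] by simp
  have "src b = rng (src b)" "a \<odot> c = b \<odot> src b" using b c(4) by simp_all
  then show ?thesis
    by (rule factorization_cong(1)[OF c(1-3) b src_closed[OF b] _ _ \<open>deg a = deg b\<close>])
qed

lemma initial_cancel:
  assumes "l \<in> P" "m \<in> P" "n \<in> P" "src l = rng m" "src l = rng n" "l \<odot> m \<preceq> l \<odot> n"
  shows "m \<preceq> n"
proof -
  obtain c where c: "c \<in> P" "src m = rng c" "l \<odot> n = (l \<odot> m) \<odot> c" using assms by (auto simp: initial_def)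
  then have "l \<odot> n = l \<odot> (m \<odot> c)" using assms by (auto simp: comp_assoc)
  moreover have "m \<odot> c \<in> P" "src l = rng (m \<odot> c)" using assms c by simp_all
  ultimately have "n = m \<odot> c"
    by (intro factorization_cong(2)[OF assms(1,3,5) assms(1) _ _ _ refl])
  then show ?thesis using c assms by (auto simp: initial_def)
qed

lemma initial_comp_mono:
  assumes "l \<in> P" "src l = rng m" "m \<preceq> n"
  shows "l \<odot> m \<preceq> l \<odot> n"
  using assms unfolding initial_def by (auto simp: comp_assoc intro!: bexI)

section \<open>Edges and the levels Lambda^{<=n}\<close>

definition has_edge :: "'p \<Rightarrow> nat \<Rightarrow> bool" where
  "has_edge v i \<longleftrightarrow> (\<exists>a\<in>P. rng a = v \<and> deg a = unitvec i)"

lemma has_edgeI: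
  assumes "b \<in> P" "deg b i > 0"
  shows "has_edge (rng b) i"
proof -
  have "unitvec i j \<le> deg b j" for j using assms(2) by (auto simp: unitvec_def)
  then obtain a c where "a \<in> P" "deg a = unitvec i" "c \<in> P" "src a = rng c" "a \<odot> c = b"
    using factorization[OF assms(1)] by metis
  then show ?thesis by (auto simp: has_edge_def intro!: bexI[of _ a])
qed

text \<open>Lambda^{<=n} with the range left free; \<open>paths_le\<close> is its fibre over a
  vertex.\<close>

definition LE :: "(nat \<Rightarrow> nat) \<Rightarrow> 'p set" where
  "LE n = {l \<in> P. (\<forall>i. deg l i \<le> n i) \<and> (\<forall>i<k. deg l i < n i \<longrightarrow> \<not> has_edge (src l) i)}"

lemma paths_le_eq: "paths_le L k v n = {l \<in> LE n. rng l = v}"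
  by (auto simp: paths_le_def LE_def has_edge_def)

lemma LE_path: "l \<in> LE n \<Longrightarrow> l \<in> P" by (simp add: LE_def)

lemma LE_comp:
  assumes "m \<in> P" "b \<in> LE (\<lambda>i. n i - deg m i)" "src m = rng b" "\<And>i. deg m i \<le> n i"
  shows "m \<odot> b \<in> LE n"
proof -
  have "b \<in> P" using assms(2) by (rule LE_path)
  moreover have "deg m i + deg b i \<le> n i" for i
  proof -
    have "deg b i \<le> n i - deg m i" using assms(2) by (auto simp: LE_def)
    then show ?thesis using assms(4)[of i] by arith
  qed
  ultimately show ?thesis
    using assms by (auto simp: LE_def deg_comp less_diff_conv add.commute)
qed

text \<open>If m were longer than l in direction i, then x would continue beyond l in that
  direction, giving an edge of colour i at the source of l, although l falls short of n
  there.\<close>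

lemma LE_deg_le:
  assumes "l \<in> LE n" "l \<preceq> x" "m \<preceq> x" "\<And>i. deg m i \<le> n i"
  shows "deg m i \<le> deg l i"
proof (rule ccontr)
  assume "\<not> deg m i \<le> deg l i"
  then have lt: "deg l i < deg m i" by simp
  obtain b where b: "b \<in> P" "src l = rng b" "x = l \<odot> b" using assms(2) by (auto simp: initial_def)
  have "deg x i = deg l i + deg b i" using b assms(2) by (simp add: deg_comp initial_def)
  then have "deg b i > 0" using lt initial_deg[OF assms(3), of i] by simp
  then have "has_edge (src l) i" using has_edgeI[OF b(1)] b(2) by simp
  moreover have "i < k"
    using \<open>deg b i > 0\<close> deg_outside[OF b(1), of i] by (cases "i < k") auto
  moreover have "deg l i < n i" using lt assms(4)[of i] by simp
  ultimately show False using assms(1) by (auto simp: LE_def)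
qed

text \<open>By \<open>LE_deg_le\<close> in both directions the degrees agree. For boundary paths
  this means that only one term of a Cuntz-Krieger sum acts on a given basis vector.\<close>

lemma LE_initial_unique:
  assumes "l \<in> LE n" "m \<in> LE n" "l \<preceq> x" "m \<preceq> x"
  shows "l = m"
proof -
  have "\<And>i. deg l i \<le> n i" "\<And>i. deg m i \<le> n i" using assms by (auto simp: LE_def)
  then have "deg m i \<le> deg l i" "deg l i \<le> deg m i" for i
    using LE_deg_le[OF assms(1,3,4)] LE_deg_le[OF assms(2,4,3)] by auto
  then show ?thesis
    using initial_comparable[OF assms(3,4)] initial_comparable[OF assms(4,3)] initial_antisym by blast
qed

text \<open>A path below n of maximal total degree works: an edge in an unsaturated direction would
  extend it.\<close>

lemma exists_LE:
  assumes "v \<in> vertices L"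
  obtains l where "l \<in> LE n" "rng l = v"
proof -
  define S where "S = {l \<in> P. rng l = v \<and> (\<forall>i. deg l i \<le> n i)}"
  define f where "f l = (\<Sum>i<k. deg l i)" for l
  have "v \<in> S" using assms by (simp add: S_def)
  moreover have "\<forall>l. l \<in> S \<longrightarrow> f l < Suc (\<Sum>i<k. n i)"
    by (auto simp: S_def f_def less_Suc_eq_le intro!: sum_mono)
  ultimately obtain l where l: "l \<in> S" "\<And>m. m \<in> S \<Longrightarrow> f m \<le> f l"
    using ex_has_greatest_nat[of "\<lambda>l. l \<in> S" v f "Suc (\<Sum>i<k. n i)"] by blast
  have "\<not> has_edge (src l) i" if i: "i < k" "deg l i < n i" for i
  proof
    assume "has_edge (src l) i"
    then obtain e where e: "e \<in> P" "rng e = src l" "deg e = unitvec i" by (auto simp: has_edge_def)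
    have d: "deg (l \<odot> e) j = deg l j + unitvec i j" for j using l(1) e by (simp add: S_def deg_comp)
    have "deg (l \<odot> e) j \<le> n j" for j using l(1) i d[of j] by (auto simp: S_def unitvec_def)
    then have "l \<odot> e \<in> S" using l(1) e by (auto simp: S_def)
    moreover have "f (l \<odot> e) = f l + 1"
      using i(1) by (simp add: f_def d sum.distrib unitvec_def)
    ultimately show False using l(2) by fastforce
  qed
  then show ?thesis using that[of l] l(1) by (auto simp: LE_def S_def)
qed

text \<open>Local convexity moves an edge of colour i past one edge of another colour; this is
  iterated along b, which contains no edge of colour i.\<close>

lemma edge_propagates:
  assumes lc: "locally_convex L k" and "b \<in> P" "has_edge (rng b) i" "deg b i = 0"
  shows "has_edge (src b) i"
  using assms(2-)
proof (induction "\<Sum>j<k. deg b j" arbitrary: b)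
  case 0
  have "deg b j = 0" for j
    using 0(1) deg_outside[OF 0(2), of j] by (cases "j < k") simp_all
  then have "deg b = (\<lambda>_. 0)" by (rule ext)
  then have "b \<in> vertices L" unfolding vertices_def using 0(2) by blast
  then show ?case using 0(3) by simp
next
  case (Suc x)
  then obtain j where j: "j < k" "deg b j > 0" by (metis finite_lessThan gr0I lessThan_iff sum.neutral nat.simps(3))
  have u: "unitvec j j' \<le> deg b j'" for j' using j by (auto simp: unitvec_def)
  obtain f b' where f: "f \<in> P" "b' \<in> P" "src f = rng b'" "deg f = unitvec j"
      "deg b' = (\<lambda>j'. deg b j' - unitvec j j')" "f \<odot> b' = b"
    by (rule factorization[OF Suc.prems(1) u])
  obtain e where e: "e \<in> P" "rng e = rng b" "deg e = unitvec i" using Suc.prems by (auto simp: has_edge_def)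
  have ij: "i \<noteq> j" using j Suc.prems by auto
  have ik: "i < k"
  proof (rule ccontr)
    assume "\<not> i < k"
    then show False using deg_outside[OF e(1), of i] e(3) by (simp add: unitvec_def)
  qed
  have "rng e = rng f" using f e by auto
  then have "has_edge (rng b') i"
    using lc ij ik j(1) f e unfolding locally_convex_def has_edge_def by metis
  moreover have "x = (\<Sum>j<k. deg b' j)"
  proof -
    have "(\<Sum>j'<k. deg b j') = (\<Sum>j'<k. deg b' j' + unitvec j j')"
      using u by (intro sum.cong) (auto simp: f)
    then show ?thesis using Suc.hyps(2) j(1) by (simp add: sum.distrib unitvec_def)
  qed
  moreover have "deg b' i = 0" using f Suc.prems by simp
  ultimately have "has_edge (src b') i" using Suc.hyps(1) f by blast
  then show ?case using f by auto
qed

text \<open>Cut l at the minimum of m and d(l). If the cut could be continued in a direction i where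
  it falls short of m, then the rest of l has no edge of colour i, and
  \<open>edge_propagates\<close> would carry that edge to the source of l.\<close>

lemma LE_initial:
  assumes lc: "locally_convex L k" and "l \<in> LE n" "\<And>i. m i \<le> n i"
  obtains a where "a \<preceq> l" "a \<in> LE m"
proof -
  have lP: "l \<in> P" using assms(2) by (rule LE_path)
  obtain a b where ab: "a \<in> P" "b \<in> P" "src a = rng b" "deg a = (\<lambda>i. min (m i) (deg l i))"
      "deg b = (\<lambda>i. deg l i - min (m i) (deg l i))" "a \<odot> b = l"
    using factorization[OF lP, of "\<lambda>i. min (m i) (deg l i)"] by auto
  have "\<not> has_edge (src a) i" if "i < k" "deg a i < m i" for i
  proof
    assume *: "has_edge (src a) i"
    have "deg l i < m i" using that(2) ab(4) by auto
    then have "deg b i = 0" "deg l i < n i" using ab(5) assms(3)[of i] by auto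
    then have "has_edge (src b) i" using edge_propagates[OF lc ab(2)] * ab(3) by simp
    moreover have "src b = src l" using ab by auto
    ultimately show False using assms(2) that(1) \<open>deg l i < n i\<close> by (auto simp: LE_def)
  qed
  then have "a \<in> LE m" using ab by (auto simp: LE_def)
  moreover have "a \<preceq> l" using ab initial_comp by metis
  ultimately show ?thesis using that by blast
qed

lemma finite_paths_le:
  assumes rf: "row_finite L k" and "v \<in> vertices L"
  shows "finite (paths_le L k v n)"
proof -
  \<comment> \<open>One common bound for all coordinates, the sum of the n j, fits the finiteness
    lemma for functions with a fixed default.\<close>
  define D where "D = {d. \<forall>i. (i \<in> {..<k} \<longrightarrow> d i \<in> {..\<Sum>j<k. n j}) \<and> (i \<notin> {..<k} \<longrightarrow> d i = (0::nat))}"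
  have "finite D" unfolding D_def by (rule finite_set_of_finite_funs) auto
  have "n i \<le> (\<Sum>j<k. n j)" if "i < k" for i
    using that by (intro member_le_sum) auto
  then have le: "d i \<le> (\<Sum>j<k. n j)" if "i < k" "d i \<le> n i" for d i using that le_trans by blast
  have "paths_le L k v n \<subseteq> (\<Union>d\<in>D. {l \<in> P. rng l = v \<and> deg l = d})"
  proof
    fix l assume "l \<in> paths_le L k v n"
    then have l: "l \<in> P" "rng l = v" "\<And>i. deg l i \<le> n i" by (simp_all add: paths_le_def)
    have "deg l i \<le> (\<Sum>j<k. n j)" if "i < k" for i using le[OF that, of "deg l"] l(3) by blast
    then have "deg l \<in> D" unfolding D_def using deg_outside[OF l(1)] by simp
    with l(1,2) show "l \<in> (\<Union>d\<in>D. {l \<in> P. rng l = v \<and> deg l = d})" by blast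
  qed
  moreover have "finite (\<Union>d\<in>D. {l \<in> P. rng l = v \<and> deg l = d})"
  proof (rule finite_UN_I[OF \<open>finite D\<close>])
    fix d assume "d \<in> D"
    then have "d \<in> Nk k" by (auto simp: D_def Nk_def)
    then show "finite {l \<in> P. rng l = v \<and> deg l = d}" using rf assms(2) by (auto simp: row_finite_def)
  qed
  ultimately show ?thesis by (rule finite_subset)
qed

subsection \<open>Boundary paths\<close>

text \<open>A boundary path is encoded by the set of its finite initial segments.\<close>

definition boundary_path :: "'p \<Rightarrow> 'p set \<Rightarrow> bool" where
  "boundary_path v x \<longleftrightarrow> x \<subseteq> P \<and> (\<forall>l\<in>x. rng l = v) \<and> (\<forall>l\<in>x. \<forall>a. a \<preceq> l \<longrightarrow> a \<in> x) \<and>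
     (\<forall>l\<in>x. \<forall>m\<in>x. \<exists>n\<in>x. l \<preceq> n \<and> m \<preceq> n) \<and> (\<forall>n\<in>Nk k. \<exists>l\<in>x. l \<in> LE n)"

lemma
  assumes "boundary_path v x"
  shows bp_path: "l \<in> x \<Longrightarrow> l \<in> P" and bp_rng: "l \<in> x \<Longrightarrow> rng l = v"
    and bp_initial: "l \<in> x \<Longrightarrow> a \<preceq> l \<Longrightarrow> a \<in> x"
    and bp_directed: "l \<in> x \<Longrightarrow> m \<in> x \<Longrightarrow> \<exists>n\<in>x. l \<preceq> n \<and> m \<preceq> n"
    and bp_LE: "n \<in> Nk k \<Longrightarrow> \<exists>l\<in>x. l \<in> LE n"
  using assms unfolding boundary_path_def by blast+

lemma bp_vertex:
  assumes "boundary_path v x"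
  shows "v \<in> x" "v \<in> vertices L"
proof -
  obtain l where l: "l \<in> x" using bp_LE[OF assms, of "\<lambda>_. 0"] by (auto simp: Nk_def)
  then have "l \<in> P" "rng l = v" using bp_path bp_rng assms by auto
  then show "v \<in> x" "v \<in> vertices L"
    using bp_initial[OF assms l] initial_rng[of l] by auto
qed

lemma bp_LE_unique:
  assumes "boundary_path v x" "n \<in> Nk k"
  shows "\<exists>!l. l \<in> x \<and> l \<in> LE n"
proof (rule ex_ex1I)
  show "\<exists>l. l \<in> x \<and> l \<in> LE n" using bp_LE[OF assms] by blast
  fix l m assume "l \<in> x \<and> l \<in> LE n" "m \<in> x \<and> m \<in> LE n"
  then show "l = m" using bp_directed[OF assms(1), of l m] LE_initial_unique by blast
qed

definition shift :: "'p \<Rightarrow> 'p set \<Rightarrow> 'p set" where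
  "shift l y = {m \<in> P. src l = rng m \<and> l \<odot> m \<in> y}"

text \<open>Taking all initial segments of the composites restores downward closure and brings in
  the proper initial segments of l.\<close>

definition prepend :: "'p \<Rightarrow> 'p set \<Rightarrow> 'p set" where
  "prepend l x = {n. \<exists>m\<in>x. n \<preceq> l \<odot> m}"

lemma bp_extend:
  assumes y: "boundary_path v y" and l: "l \<in> y" and m: "m \<in> y"
  obtains n where "n \<in> shift l y" "m \<preceq> l \<odot> n"
proof -
  obtain \<rho> where "\<rho> \<in> y" "l \<preceq> \<rho>" "m \<preceq> \<rho>" using bp_directed[OF y l m] by blast
  then show ?thesis using that by (auto simp: initial_def shift_def)
qed

lemma bp_shift:
  assumes y: "boundary_path v y" and l: "l \<in> y"
  shows "boundary_path (src l) (shift l y)"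
proof -
  have lP: "l \<in> P" using bp_path[OF y l] .
  have "\<exists>\<mu>\<in>shift l y. \<mu> \<in> LE m" if m: "m \<in> Nk k" for m
  proof -
    \<comment> \<open>Level m of the shift comes from level m + d(l) of y: the element found there
      extends l by \<open>LE_deg_le\<close>.\<close>
    have "(\<lambda>i. m i + deg l i) \<in> Nk k" using m lP by (auto simp: Nk_def deg_outside)
    then obtain \<nu> where \<nu>: "\<nu> \<in> y" "\<nu> \<in> LE (\<lambda>i. m i + deg l i)" using bp_LE[OF y] by blast
    obtain \<rho> where \<rho>: "\<rho> \<in> y" "l \<preceq> \<rho>" "\<nu> \<preceq> \<rho>" using bp_directed[OF y l \<nu>(1)] by blast
    have "deg l i \<le> deg \<nu> i" for i by (rule LE_deg_le[OF \<nu>(2) \<rho>(3,2)]) simp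
    then have "l \<preceq> \<nu>" by (rule initial_comparable[OF \<rho>(2,3)])
    then obtain \<mu> where \<mu>: "\<mu> \<in> P" "src l = rng \<mu>" "\<nu> = l \<odot> \<mu>" by (auto simp: initial_def)
    then have "\<mu> \<in> LE m" using \<nu>(2) lP by (auto simp: LE_def deg_comp add.commute[of "deg l _"])
    then show ?thesis using \<mu> \<nu> by (auto simp: shift_def)
  qed
  moreover have "\<exists>n\<in>shift l y. a \<preceq> n \<and> b \<preceq> n" if ab: "a \<in> shift l y" "b \<in> shift l y" for a b
  proof -
    obtain \<rho> where \<rho>: "\<rho> \<in> y" "l \<odot> a \<preceq> \<rho>" "l \<odot> b \<preceq> \<rho>"
      using bp_directed[OF y, of "l \<odot> a" "l \<odot> b"] ab by (auto simp: shift_def)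
    then have "l \<preceq> \<rho>" using initial_trans[of l "l \<odot> a" \<rho>] ab lP initial_comp by (auto simp: shift_def)
    then obtain \<eta> where \<eta>: "\<eta> \<in> P" "src l = rng \<eta>" "\<rho> = l \<odot> \<eta>" by (auto simp: initial_def)
    have a: "a \<in> P" "src l = rng a" and b: "b \<in> P" "src l = rng b" using ab by (simp_all add: shift_def)
    have "a \<preceq> \<eta>" "b \<preceq> \<eta>"
      using initial_cancel[OF lP a(1) \<eta>(1) a(2) \<eta>(2)] initial_cancel[OF lP b(1) \<eta>(1) b(2) \<eta>(2)] \<rho> \<eta>(3)
      by simp_all
    moreover have "\<eta> \<in> shift l y" using \<eta> \<rho>(1) unfolding shift_def by blast
    ultimately show ?thesis by blast
  qed
  moreover have "a \<in> shift l y" if "b \<in> shift l y" "a \<preceq> b" for a b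
    using that initial_comp_mono[OF lP, of a b] initial_path[OF that(2)] bp_initial[OF y, of "l \<odot> b" "l \<odot> a"]
    by (auto simp: shift_def)
  moreover have "shift l y \<subseteq> P" "\<forall>m\<in>shift l y. rng m = src l" by (auto simp: shift_def)
  ultimately show ?thesis unfolding boundary_path_def by blast
qed

lemma bp_prepend:
  assumes lc: "locally_convex L k" and l: "l \<in> P" and x: "boundary_path (src l) x"
  shows "boundary_path (rng l) (prepend l x)" "l \<in> prepend l x"
proof -
  have m: "m \<in> P \<and> rng m = src l" if "m \<in> x" for m using that bp_path[OF x] bp_rng[OF x] by auto
  show lx: "l \<in> prepend l x"
    unfolding prepend_def using bp_vertex[OF x] l by (auto intro!: bexI[of _ "src l"])
  have "\<exists>a\<in>prepend l x. a \<in> LE n" if "n \<in> Nk k" for n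
  proof -
    obtain \<mu> where \<mu>: "\<mu> \<in> x" "\<mu> \<in> LE n" using bp_LE[OF x \<open>n \<in> Nk k\<close>] by blast
    \<comment> \<open>Overshoot to level n + d(l), then cut back to level n; the cut is where local
      convexity enters.\<close>
    then have "l \<odot> \<mu> \<in> LE (\<lambda>i. n i + deg l i)" using m[of \<mu>] l by (intro LE_comp) auto
    then obtain a where "a \<preceq> l \<odot> \<mu>" "a \<in> LE n" by (rule LE_initial[OF lc, of _ _ n]) auto
    then show ?thesis using \<mu> by (auto simp: prepend_def)
  qed
  moreover have "\<exists>n\<in>prepend l x. a \<preceq> n \<and> b \<preceq> n" if ab: "a \<in> prepend l x" "b \<in> prepend l x" for a b
  proof -
    obtain c d where cd: "c \<in> x" "a \<preceq> l \<odot> c" "d \<in> x" "b \<preceq> l \<odot> d" using ab by (auto simp: prepend_def)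
    then obtain e where e: "e \<in> x" "c \<preceq> e" "d \<preceq> e" using bp_directed[OF x] by blast
    have "l \<odot> c \<preceq> l \<odot> e" "l \<odot> d \<preceq> l \<odot> e" using e cd m l by (auto intro!: initial_comp_mono)
    moreover have "l \<odot> e \<in> prepend l x" using e m l by (auto simp: prepend_def intro!: bexI[of _ e])
    ultimately show ?thesis using cd initial_trans by blast
  qed
  moreover have "a \<in> P" "rng a = rng l" if a: "a \<in> prepend l x" for a
  proof -
    obtain c where "c \<in> x" "a \<preceq> l \<odot> c" using a by (auto simp: prepend_def)
    then show "a \<in> P" "rng a = rng l" using m l initial_path[of a "l \<odot> c"] by auto
  qed
  moreover have "b \<in> prepend l x" if "a \<in> prepend l x" "b \<preceq> a" for a b
    using that initial_trans by (auto simp: prepend_def)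
  ultimately show "boundary_path (rng l) (prepend l x)"
    unfolding boundary_path_def by blast
qed

lemma shift_prepend:
  assumes l: "l \<in> P" and x: "boundary_path (src l) x"
  shows "shift l (prepend l x) = x"
proof -
  have m: "m \<in> P \<and> rng m = src l" if "m \<in> x" for m using that bp_path[OF x] bp_rng[OF x] by auto
  show ?thesis
  proof (intro set_eqI iffI)
    fix a assume "a \<in> shift l (prepend l x)"
    then obtain b where b: "a \<in> P" "src l = rng a" "b \<in> x" "l \<odot> a \<preceq> l \<odot> b"
      by (auto simp: shift_def prepend_def)
    have "b \<in> P" "src l = rng b" using m[OF b(3)] by simp_all
    then have "a \<preceq> b" using initial_cancel[OF l b(1) _ b(2) _ b(4)] by simp
    then show "a \<in> x" using bp_initial[OF x b(3)] by simp
  next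
    fix a assume "a \<in> x"
    then show "a \<in> shift l (prepend l x)" using m[of a] l by (auto simp: shift_def prepend_def intro!: bexI[of _ a])
  qed
qed

lemma prepend_shift:
  assumes y: "boundary_path v y" and l: "l \<in> y"
  shows "prepend l (shift l y) = y"
proof (intro set_eqI iffI)
  fix a assume "a \<in> prepend l (shift l y)"
  then show "a \<in> y" using bp_initial[OF y] by (auto simp: prepend_def shift_def)
next
  fix a assume "a \<in> y"
  then obtain n where "n \<in> shift l y" "a \<preceq> l \<odot> n" by (rule bp_extend[OF y l])
  then show "a \<in> prepend l (shift l y)" by (auto simp: prepend_def)
qed

lemma shift_comp:
  assumes "l \<in> P" "m \<in> P" "src l = rng m"
  shows "shift (l \<odot> m) y = shift m (shift l y)"
proof -
  have "n \<in> shift (l \<odot> m) y \<longleftrightarrow> n \<in> shift m (shift l y)" for n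
  proof (cases "n \<in> P \<and> src m = rng n")
    case True
    then have n: "n \<in> P" "src m = rng n" by simp_all
    then show ?thesis
      using comp_assoc[OF assms(1,2) n(1) assms(3) n(2)] src_of_comp[OF assms] rng_of_comp[OF assms(2) n]
        comp_closed[OF assms(2) n] assms(3) by (simp add: shift_def)
  next
    case False
    then show ?thesis using src_of_comp[OF assms] unfolding shift_def by auto
  qed
  then show ?thesis by blast
qed

lemma shift_vertex:
  assumes "boundary_path v x"
  shows "shift v x = x"
proof -
  have "n \<in> shift v x \<longleftrightarrow> n \<in> x" for n
  proof (cases "n \<in> P \<and> rng n = v")
    case True
    then have "v \<odot> n = n" "src v = v" using rng_comp[of n] src_of_vertex[OF bp_vertex(2)[OF assms]] by auto
    then show ?thesis using True by (simp add: shift_def)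
  next
    case False
    then show ?thesis
      using bp_path[OF assms, of n] bp_rng[OF assms, of n] src_of_vertex[OF bp_vertex(2)[OF assms]]
      unfolding shift_def by auto
  qed
  then show ?thesis by blast
qed

text \<open>An increasing chain is built through the diagonal levels (j, ..., j), each step
  appending a path of level (1, ..., 1). Every n lies below some diagonal level, from which
  \<open>LE_initial\<close> cuts back to n.\<close>

lemma exists_boundary_path:
  assumes lc: "locally_convex L k" and v: "v \<in> vertices L"
  shows "\<exists>x. boundary_path v x"
proof -
  define one :: "nat \<Rightarrow> nat" where "one = (\<lambda>i. 1)"
  define N :: "nat \<Rightarrow> nat \<Rightarrow> nat" where "N j = (\<lambda>i. j)" for j
  have "\<exists>b. a \<preceq> b \<and> b \<in> LE (N (Suc j))" if a: "a \<in> LE (N j)" for a j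
  proof -
    have aP: "a \<in> P" using a by (rule LE_path)
    obtain c where c: "c \<in> LE one" "rng c = src a" using exists_LE[of "src a" one] aP by auto
    have cP: "c \<in> P" using c by (auto intro: LE_path)
    have d: "deg (a \<odot> c) i = deg a i + deg c i" for i using aP cP c by (simp add: deg_comp)
    have "deg (a \<odot> c) i \<le> N (Suc j) i" for i
    proof -
      have "deg a i \<le> j" "deg c i \<le> 1" using a c by (auto simp: LE_def N_def one_def)
      then show ?thesis by (simp add: d N_def)
    qed
    \<comment> \<open>Either c itself is stuck in direction i, or it has an edge of that colour and
      a falls short of j there; the latter is impossible, since c starts at the source of a.\<close>
    moreover have "\<not> has_edge (src c) i" if "i < k" "deg (a \<odot> c) i < N (Suc j) i" for i
    proof (cases "deg c i < 1")
      case True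
      then show ?thesis using c that(1) by (auto simp: LE_def one_def)
    next
      case False
      then have "deg a i < j" "has_edge (rng c) i" using that d[of i] has_edgeI[OF cP] by (auto simp: N_def)
      then show ?thesis using a c that(1) by (auto simp: LE_def N_def)
    qed
    ultimately have "a \<odot> c \<in> LE (N (Suc j))" using aP cP c by (auto simp: LE_def)
    then show ?thesis using aP cP c initial_comp by metis
  qed
  then obtain nx where nx: "\<And>a j. a \<in> LE (N j) \<Longrightarrow> a \<preceq> nx a j \<and> nx a j \<in> LE (N (Suc j))" by metis
  define l where "l = rec_nat v (\<lambda>j a. nx a j)"
  have l0: "l 0 = v" and lS: "l (Suc j) = nx (l j) j" for j by (auto simp: l_def)
  have lN: "l j \<in> LE (N j)" for j
  proof (induction j)
    case 0 then show ?case using v by (auto simp: l0 LE_def N_def)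
  next
    case (Suc j) then show ?case using nx by (simp add: lS)
  qed
  have lP: "l j \<in> P" for j using lN by (rule LE_path)
  have mono: "l i \<preceq> l j" if "i \<le> j" for i j
    using that
  proof (induction j rule: dec_induct)
    case base show ?case using lP by simp
  next
    case (step j)
    have "l j \<preceq> l (Suc j)" using nx[OF lN] by (simp add: lS)
    with step.IH show ?case by (rule initial_trans)
  qed
  define x where "x = {a. \<exists>j. a \<preceq> l j}"
  have "rng (l j) = v" for j using mono[of 0 j] initial_path[of v "l j"] v by (simp add: l0)
  then have "a \<in> P \<and> rng a = v" if "a \<in> x" for a using that initial_path by (auto simp: x_def)
  moreover have "\<exists>n\<in>x. a \<preceq> n \<and> b \<preceq> n" if ab: "a \<in> x" "b \<in> x" for a b
  proof -
    obtain i j where ij: "a \<preceq> l i" "b \<preceq> l j" using ab by (auto simp: x_def)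
    then have "a \<preceq> l (max i j)" "b \<preceq> l (max i j)"
      using initial_trans mono by (meson max.cobounded1 max.cobounded2)+
    moreover have "l (max i j) \<in> x" unfolding x_def using initial_refl[OF lP] by blast
    ultimately show ?thesis by blast
  qed
  moreover have "\<exists>a\<in>x. a \<in> LE n" if "n \<in> Nk k" for n
  proof -
    have "n i \<le> N (\<Sum>j<k. n j) i" for i
      using that by (cases "i < k") (auto simp: N_def Nk_def intro!: member_le_sum)
    then obtain a where "a \<preceq> l (\<Sum>j<k. n j)" "a \<in> LE n" using LE_initial[OF lc lN] by blast
    then show ?thesis by (auto simp: x_def)
  qed
  moreover have "b \<in> x" if "a \<in> x" "b \<preceq> a" for a b
    using that initial_trans by (auto simp: x_def)
  ultimately have "boundary_path v x"
    unfolding boundary_path_def by blast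
  then show ?thesis by blast
qed

end

section \<open>Operators on square-summable functions\<close>

definition square_summable :: "('x \<Rightarrow> complex) \<Rightarrow> bool" where
  "square_summable f \<longleftrightarrow> (\<lambda>x. (cmod (f x))\<^sup>2) summable_on UNIV"

lemma square_summableI:
  assumes "\<And>F. finite F \<Longrightarrow> (\<Sum>x\<in>F. (cmod (f x))\<^sup>2) \<le> B"
  shows "square_summable f" "(\<Sum>\<^sub>\<infinity>x. (cmod (f x))\<^sup>2) \<le> B"
proof -
  show "square_summable f"
    unfolding square_summable_def
    by (rule nonneg_bdd_above_summable_on) (auto intro!: bdd_aboveI2 assms)
  then show "(\<Sum>\<^sub>\<infinity>x. (cmod (f x))\<^sup>2) \<le> B"
    unfolding square_summable_def by (rule infsum_le_finite_sums) (rule assms)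
qed

lemma square_summable_add:
  assumes "square_summable f" "square_summable g"
  shows "square_summable (\<lambda>x. f x + g x)"
  unfolding square_summable_def
proof (rule summable_on_comparison_test)
  show "(\<lambda>x. 2 * (cmod (f x))\<^sup>2 + 2 * (cmod (g x))\<^sup>2) summable_on UNIV"
    using assms unfolding square_summable_def by (intro summable_on_add summable_on_cmult_right)
  fix x
  have "(cmod (f x + g x))\<^sup>2 \<le> (cmod (f x) + cmod (g x))\<^sup>2" by (intro power_mono norm_triangle_ineq) auto
  also have "\<dots> \<le> 2 * (cmod (f x))\<^sup>2 + 2 * (cmod (g x))\<^sup>2"
    using zero_le_power2[of "cmod (f x) - cmod (g x)"] by (simp add: power2_diff power2_sum)
  finally show "(cmod (f x + g x))\<^sup>2 \<le> 2 * (cmod (f x))\<^sup>2 + 2 * (cmod (g x))\<^sup>2" .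
qed simp

lemma square_summable_cmult:
  assumes "square_summable f"
  shows "square_summable (\<lambda>x. c * f x)"
  using assms unfolding square_summable_def
  by (simp add: norm_mult power_mult_distrib summable_on_cmult_right)

lemma summable_inner:
  assumes "square_summable f" "square_summable g"
  shows "(\<lambda>x. f x \<bullet> g x) summable_on UNIV"
proof -
  have "(\<lambda>x. (cmod (f x))\<^sup>2 + (cmod (g x))\<^sup>2) summable_on UNIV"
    using assms unfolding square_summable_def by (intro summable_on_add)
  moreover have "norm (f x \<bullet> g x) \<le> (cmod (f x))\<^sup>2 + (cmod (g x))\<^sup>2" for x
  proof -
    have "norm (f x \<bullet> g x) \<le> cmod (f x) * cmod (g x)" using Cauchy_Schwarz_ineq2[of "f x" "g x"] by simp
    also have "\<dots> \<le> (cmod (f x))\<^sup>2 + (cmod (g x))\<^sup>2"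
    proof -
      have "0 \<le> cmod (f x) * cmod (g x)" "2 * (cmod (f x) * cmod (g x)) \<le> (cmod (f x))\<^sup>2 + (cmod (g x))\<^sup>2"
        using zero_le_power2[of "cmod (f x) - cmod (g x)"] by (simp_all add: power2_diff)
      then show ?thesis by linarith
    qed
    finally show ?thesis .
  qed
  ultimately have "(\<lambda>x. norm (f x \<bullet> g x)) summable_on UNIV"
    by (intro Infinite_Sum.abs_summable_on_comparison_test'[where g="\<lambda>x. (cmod (f x))\<^sup>2 + (cmod (g x))\<^sup>2"])
  then show ?thesis by (rule abs_summable_summable)
qed

typedef 'x ell2 = "{f :: 'x \<Rightarrow> complex. square_summable f}"
  by (auto intro!: exI[of _ "\<lambda>_. 0"] simp: square_summable_def)

setup_lifting type_definition_ell2

lemma square_summable_Rep: "square_summable (Rep_ell2 f)"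
  using Rep_ell2[of f] by simp

instantiation ell2 :: (type) "{zero, plus, minus, uminus, scaleR}"
begin

lift_definition zero_ell2 :: "'a ell2" is "\<lambda>_. 0" by (simp add: square_summable_def)
lift_definition plus_ell2 :: "'a ell2 \<Rightarrow> 'a ell2 \<Rightarrow> 'a ell2" is "\<lambda>f g x. f x + g x"
  by (rule square_summable_add)
lift_definition uminus_ell2 :: "'a ell2 \<Rightarrow> 'a ell2" is "\<lambda>f x. - f x" by (simp add: square_summable_def)
lift_definition minus_ell2 :: "'a ell2 \<Rightarrow> 'a ell2 \<Rightarrow> 'a ell2" is "\<lambda>f g x. f x - g x"
  using square_summable_add square_summable_cmult[of _ "-1"] by fastforce
lift_definition scaleR_ell2 :: "real \<Rightarrow> 'a ell2 \<Rightarrow> 'a ell2" is "\<lambda>r f x. complex_of_real r * f x"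
  by (rule square_summable_cmult)

instance ..

end

instantiation ell2 :: (type) real_inner
begin

text \<open>The real part of the complex inner product: the space is treated as a real Hilbert
  space, and multiplication by i is recorded separately as \<open>iop\<close>.\<close>

definition inner_ell2 :: "'a ell2 \<Rightarrow> 'a ell2 \<Rightarrow> real" where
  "inner_ell2 f g = (\<Sum>\<^sub>\<infinity>x. Rep_ell2 f x \<bullet> Rep_ell2 g x)"
definition norm_ell2 :: "'a ell2 \<Rightarrow> real" where "norm_ell2 f = sqrt (inner f f)"
definition sgn_ell2 :: "'a ell2 \<Rightarrow> 'a ell2" where "sgn_ell2 x = x /\<^sub>R norm x"
definition dist_ell2 :: "'a ell2 \<Rightarrow> 'a ell2 \<Rightarrow> real" where "dist_ell2 x y = norm (x - y)"
definition uniformity_ell2 :: "('a ell2 \<times> 'a ell2) filter"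
  where "uniformity_ell2 = (INF e\<in>{0<..}. principal {(x, y). dist x y < e})"
definition open_ell2 :: "'a ell2 set \<Rightarrow> bool"
  where "open_ell2 U = (\<forall>x\<in>U. \<forall>\<^sub>F (x', y) in uniformity. x' = x \<longrightarrow> y \<in> U)"

instance
proof
  fix x y z :: "'a ell2" and r s :: real
  show "x + y + z = x + (y + z)" "x + y = y + x" "0 + x = x" "- x + x = 0" "x - y = x + - y"
    by (transfer, simp add: algebra_simps fun_eq_iff)+
  show "r *\<^sub>R (x + y) = r *\<^sub>R x + r *\<^sub>R y" "(r + s) *\<^sub>R x = r *\<^sub>R x + s *\<^sub>R x" "r *\<^sub>R s *\<^sub>R x = (r * s) *\<^sub>R x" "1 *\<^sub>R x = x"
    by (transfer, simp add: algebra_simps fun_eq_iff)+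
  show "dist x y = norm (x - y)" by (rule dist_ell2_def)
  show "sgn x = x /\<^sub>R norm x" by (rule sgn_ell2_def)
  show "uniformity = (INF e\<in>{0<..}. principal {(x :: 'a ell2, y). dist x y < e})"
    by (rule uniformity_ell2_def)
  show "open U \<longleftrightarrow> (\<forall>x\<in>U. \<forall>\<^sub>F (x', y) in uniformity. x' = x \<longrightarrow> y \<in> U)" for U :: "'a ell2 set"
    by (simp add: open_ell2_def)
  show "x \<bullet> y = y \<bullet> x" by (simp add: inner_ell2_def inner_commute)
  show "(x + y) \<bullet> z = x \<bullet> z + y \<bullet> z"
    by (simp add: inner_ell2_def plus_ell2.rep_eq inner_add_left infsum_add summable_inner square_summable_Rep)
  have "(complex_of_real r * a) \<bullet> b = r * (a \<bullet> b)" for a b by (simp flip: scaleR_conv_of_real)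
  then show "(r *\<^sub>R x) \<bullet> y = r * (x \<bullet> y)"
    by (simp add: inner_ell2_def scaleR_ell2.rep_eq infsum_cmult_right')
  show "0 \<le> x \<bullet> x" by (simp add: inner_ell2_def infsum_nonneg)
  show "(x \<bullet> x = 0) = (x = 0)"
  proof
    assume "x \<bullet> x = 0"
    then have "(\<Sum>\<^sub>\<infinity>a. Rep_ell2 x a \<bullet> Rep_ell2 x a) \<le> 0" by (simp add: inner_ell2_def)
    then have "Rep_ell2 x a \<bullet> Rep_ell2 x a = 0" for a
      by (rule nonneg_infsum_le_0D) (auto intro: summable_inner square_summable_Rep)
    then have "Rep_ell2 x a = Rep_ell2 0 a" for a by (simp add: zero_ell2.rep_eq)
    then have "Rep_ell2 x = Rep_ell2 0" by (rule ext)
    then show "x = 0" by (simp add: Rep_ell2_inject)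
  qed (simp add: inner_ell2_def zero_ell2.rep_eq)
  show "norm x = sqrt (x \<bullet> x)" by (rule norm_ell2_def)
qed

end

lemma norm_ell2_square: "(norm f)\<^sup>2 = (\<Sum>\<^sub>\<infinity>x. (cmod (Rep_ell2 f x))\<^sup>2)"
  by (simp add: norm_ell2_def inner_ell2_def infsum_nonneg dot_square_norm)

lemma sum_le_norm_ell2:
  assumes "finite F"
  shows "(\<Sum>x\<in>F. (cmod (Rep_ell2 f x))\<^sup>2) \<le> (norm f)\<^sup>2"
  using square_summable_Rep[of f] assms unfolding norm_ell2_square square_summable_def
  by (intro finite_sum_le_infsum) auto

lemma norm_ell2_le:
  assumes "0 \<le> B" "\<And>F. finite F \<Longrightarrow> (\<Sum>x\<in>F. (cmod (Rep_ell2 f x))\<^sup>2) \<le> B\<^sup>2"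
  shows "norm f \<le> B"
proof -
  have "(norm f)\<^sup>2 \<le> B\<^sup>2" unfolding norm_ell2_square by (rule square_summableI(2)) (rule assms)
  then show ?thesis using assms(1) by (rule power2_le_imp_le)
qed

lemma cmod_Rep_ell2_le: "cmod (Rep_ell2 f x) \<le> norm f"
  using sum_le_norm_ell2[of "{x}" f] by - (rule power2_le_imp_le, simp_all)

instance ell2 :: (type) banach
proof
  fix X :: "nat \<Rightarrow> 'a ell2" assume "Cauchy X"
  then have Xc: "\<exists>N. \<forall>m\<ge>N. \<forall>n\<ge>N. norm (X m - X n) < e" if "e > 0" for e
    using that unfolding Cauchy_def dist_norm by blast
  have le: "cmod (Rep_ell2 (X m) x - Rep_ell2 (X n) x) \<le> norm (X m - X n)" for m n x
    using cmod_Rep_ell2_le[of "X m - X n" x] by (simp add: minus_ell2.rep_eq)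
  have "Cauchy (\<lambda>n. Rep_ell2 (X n) x)" for x
    unfolding Cauchy_def dist_norm using Xc le by (meson le_less_trans)
  then have l: "(\<lambda>n. Rep_ell2 (X n) x) \<longlonglongrightarrow> lim (\<lambda>n. Rep_ell2 (X n) x)" for x
    by (simp add: Cauchy_convergent_iff convergent_LIMSEQ_iff)
  define l where "l x = lim (\<lambda>n. Rep_ell2 (X n) x)" for x
  note l = l[folded l_def]
  \<comment> \<open>On finite partial sums the limit in n is taken termwise; the resulting bound
    yields both the summability of l and convergence in norm.\<close>
  have sums: "(\<Sum>x\<in>F. (cmod (Rep_ell2 (X m) x - l x))\<^sup>2) \<le> e\<^sup>2"
    if "finite F" "\<And>n. n \<ge> N \<Longrightarrow> norm (X m - X n) < e" for F m N e
  proof (rule LIMSEQ_le_const2)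
    show "(\<lambda>n. \<Sum>x\<in>F. (cmod (Rep_ell2 (X m) x - Rep_ell2 (X n) x))\<^sup>2)
        \<longlonglongrightarrow> (\<Sum>x\<in>F. (cmod (Rep_ell2 (X m) x - l x))\<^sup>2)"
      by (intro tendsto_intros l)
    have "(\<Sum>x\<in>F. (cmod (Rep_ell2 (X m) x - Rep_ell2 (X n) x))\<^sup>2) \<le> e\<^sup>2" if "n \<ge> N" for n
    proof -
      have "(norm (X m - X n))\<^sup>2 \<le> e\<^sup>2" using \<open>\<And>n. n \<ge> N \<Longrightarrow> norm (X m - X n) < e\<close>[OF that] by (intro power_mono) auto
      then show ?thesis
        using sum_le_norm_ell2[OF \<open>finite F\<close>, of "X m - X n"] by (simp add: minus_ell2.rep_eq)
    qed
    then show "\<exists>N. \<forall>n\<ge>N. (\<Sum>x\<in>F. (cmod (Rep_ell2 (X m) x - Rep_ell2 (X n) x))\<^sup>2) \<le> e\<^sup>2" by blast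
  qed
  obtain N1 where N1: "\<forall>m\<ge>N1. \<forall>n\<ge>N1. norm (X m - X n) < 1" using Xc[of 1] by auto
  have "square_summable (\<lambda>x. Rep_ell2 (X N1) x - l x)"
    by (rule square_summableI(1), rule sums[of _ N1 N1 1]) (use N1 in auto)
  then have "square_summable (\<lambda>x. Rep_ell2 (X N1) x + (-1) * (Rep_ell2 (X N1) x - l x))"
    by (intro square_summable_add square_summable_Rep square_summable_cmult)
  then have "square_summable l" by simp
  then have RL: "Rep_ell2 (Abs_ell2 l) = l" by (simp add: Abs_ell2_inverse)
  have "X \<longlonglongrightarrow> Abs_ell2 l"
  proof (rule LIMSEQ_I)
    fix e :: real assume "e > 0"
    then obtain N where N: "\<forall>m\<ge>N. \<forall>n\<ge>N. norm (X m - X n) < e/2" using Xc[of "e/2"] by auto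
    have "norm (X n - Abs_ell2 l) < e" if "n \<ge> N" for n
    proof -
      have "norm (X n - Abs_ell2 l) \<le> e/2"
        using sums[of _ N n "e/2"] N that \<open>e > 0\<close> by (intro norm_ell2_le) (auto simp: minus_ell2.rep_eq RL)
      then show ?thesis using \<open>e > 0\<close> by simp
    qed
    then show "\<exists>N. \<forall>n\<ge>N. norm (X n - Abs_ell2 l) < e" by blast
  qed
  then show "convergent X" by (auto simp: convergent_def)
qed

lift_definition ell2_ii :: "'x ell2 \<Rightarrow> 'x ell2" is "\<lambda>f x. \<i> * f x"
  by (rule square_summable_cmult)

lemma norm_ell2_ii [simp]: "norm (ell2_ii f) = norm f"
proof -
  have "(norm (ell2_ii f))\<^sup>2 = (norm f)\<^sup>2" by (simp add: norm_ell2_square ell2_ii.rep_eq norm_mult)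
  then show ?thesis by simp
qed

lemma bounded_linear_ell2_ii: "bounded_linear ell2_ii"
  by (rule bounded_linear_intro[where K=1]; (simp; fail)?)
    (transfer, simp add: algebra_simps fun_eq_iff)+

lift_definition iop :: "'x ell2 \<Rightarrow>\<^sub>L 'x ell2" is ell2_ii by (rule bounded_linear_ell2_ii)

lemma iop_iop: "iop (iop f) = - f"
  by (simp add: iop.rep_eq) (transfer, simp add: fun_eq_iff flip: mult.assoc)

lemma inner_iop_left: "inner (iop f) g = - inner f (iop g)"
proof -
  have "(\<i> * a) \<bullet> b = - (a \<bullet> (\<i> * b))" for a b :: complex by (simp add: inner_complex_def)
  then show ?thesis by (simp add: iop.rep_eq inner_ell2_def ell2_ii.rep_eq infsum_uminus)
qed

section \<open>Adjoints and the C*-algebra of operators\<close>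

definition is_adjoint :: "('h::real_inner \<Rightarrow>\<^sub>L 'h) \<Rightarrow> ('h \<Rightarrow>\<^sub>L 'h) \<Rightarrow> bool" where
  "is_adjoint T S \<longleftrightarrow> (\<forall>f g. inner (T f) g = inner f (S g))"

lemma is_adjoint_unique: "is_adjoint T S \<Longrightarrow> is_adjoint T S' \<Longrightarrow> S = S'"
  unfolding is_adjoint_def by (intro blinfun_eqI) (metis vector_eq_ldot)

lemma is_adjoint_sym: "is_adjoint T S \<Longrightarrow> is_adjoint S T"
  unfolding is_adjoint_def by (metis inner_commute)

lemma norm_adjoint_le: assumes "is_adjoint T S" shows "norm S \<le> norm T"
proof (rule norm_blinfun_bound)
  fix g
  have "norm (S g) * norm (S g) = inner (T (S g)) g"
    using assms unfolding is_adjoint_def by (simp add: dot_square_norm power2_eq_square)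
  also have "\<dots> \<le> norm (T (S g)) * norm g" by (rule norm_cauchy_schwarz)
  also have "\<dots> \<le> norm T * norm (S g) * norm g" by (intro mult_right_mono norm_blinfun) auto
  finally have "norm (S g) * norm (S g) \<le> norm (S g) * (norm T * norm g)" by (simp add: mult.assoc mult.left_commute)
  then show "norm (S g) \<le> norm T * norm g" by (cases "norm (S g) = 0") auto
qed simp

lemma norm_adjoint_compose: assumes "is_adjoint T S" shows "norm (S o\<^sub>L T) = (norm T)\<^sup>2"
proof (rule antisym)
  have "norm (S o\<^sub>L T) \<le> norm S * norm T" by (rule norm_blinfun_compose)
  also have "\<dots> \<le> norm T * norm T" by (intro mult_right_mono norm_adjoint_le assms) auto
  finally show "norm (S o\<^sub>L T) \<le> (norm T)\<^sup>2" by (simp add: power2_eq_square)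
  have "norm T \<le> sqrt (norm (S o\<^sub>L T))"
  proof (rule norm_blinfun_bound)
    fix f
    have "(norm (T f))\<^sup>2 = inner f ((S o\<^sub>L T) f)"
      using assms unfolding is_adjoint_def by (simp add: power2_norm_eq_inner)
    also have "\<dots> \<le> norm f * norm ((S o\<^sub>L T) f)" by (rule norm_cauchy_schwarz)
    also have "\<dots> \<le> norm f * (norm (S o\<^sub>L T) * norm f)" by (intro mult_left_mono norm_blinfun) auto
    also have "\<dots> = (sqrt (norm (S o\<^sub>L T)) * norm f)\<^sup>2" by (simp add: power_mult_distrib power2_eq_square)
    finally show "norm (T f) \<le> sqrt (norm (S o\<^sub>L T)) * norm f" by (rule power2_le_imp_le) simp
  qed simp
  then have "(norm T)\<^sup>2 \<le> (sqrt (norm (S o\<^sub>L T)))\<^sup>2" by (intro power_mono) auto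
  then show "(norm T)\<^sup>2 \<le> norm (S o\<^sub>L T)" by simp
qed

text \<open>Complex-linear operators are the real-linear ones commuting with \<open>iop\<close>; for these the real adjoint is the complex one.\<close>

definition ell2_ops :: "('x ell2 \<Rightarrow>\<^sub>L 'x ell2) set" where
  "ell2_ops = {T. (\<exists>S. is_adjoint T S) \<and> T o\<^sub>L iop = iop o\<^sub>L T}"

definition ell2_adj :: "('x ell2 \<Rightarrow>\<^sub>L 'x ell2) \<Rightarrow> 'x ell2 \<Rightarrow>\<^sub>L 'x ell2" where
  "ell2_adj T = (THE S. is_adjoint T S)"

definition ell2_smul :: "complex \<Rightarrow> ('x ell2 \<Rightarrow>\<^sub>L 'x ell2) \<Rightarrow> 'x ell2 \<Rightarrow>\<^sub>L 'x ell2" where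
  "ell2_smul a T = Re a *\<^sub>R T + Im a *\<^sub>R (iop o\<^sub>L T)"

definition ell2_cstar :: "('x ell2 \<Rightarrow>\<^sub>L 'x ell2) cstar" where
  "ell2_cstar = \<lparr>c_carrier = ell2_ops, c_zero = 0, c_add = (+), c_smul = ell2_smul,
     c_mult = (o\<^sub>L), c_star = ell2_adj, c_norm = norm\<rparr>"

lemma ell2_adj_eq: "is_adjoint T S \<Longrightarrow> ell2_adj T = S"
  unfolding ell2_adj_def by (rule the_equality) (auto intro: is_adjoint_unique)

lemma is_adjoint_ell2_adj: "T \<in> ell2_ops \<Longrightarrow> is_adjoint T (ell2_adj T)"
  using ell2_adj_eq by (auto simp: ell2_ops_def)

lemma iop_commute: "T \<in> ell2_ops \<Longrightarrow> T (iop f) = iop (T f)"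
  by (simp add: ell2_ops_def) (metis blinfun_apply_blinfun_compose)

lemma ell2_opsI: "is_adjoint T S \<Longrightarrow> (\<And>f. T (iop f) = iop (T f)) \<Longrightarrow> T \<in> ell2_ops"
  by (auto simp: ell2_ops_def intro!: blinfun_eqI)

lemma is_adjoint_add: "is_adjoint T S \<Longrightarrow> is_adjoint T' S' \<Longrightarrow> is_adjoint (T + T') (S + S')"
  by (simp add: is_adjoint_def blinfun.bilinear_simps inner_simps)

lemma is_adjoint_diff: "is_adjoint T S \<Longrightarrow> is_adjoint T' S' \<Longrightarrow> is_adjoint (T - T') (S - S')"
  by (simp add: is_adjoint_def blinfun.bilinear_simps inner_simps)

lemma is_adjoint_compose: "is_adjoint T S \<Longrightarrow> is_adjoint T' S' \<Longrightarrow> is_adjoint (T o\<^sub>L T') (S' o\<^sub>L S)"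
  by (simp add: is_adjoint_def)

lemma is_adjoint_smul:
  assumes "T \<in> ell2_ops" "is_adjoint T S"
  shows "is_adjoint (ell2_smul a T) (ell2_smul (cnj a) S)"
  unfolding is_adjoint_def
proof safe
  fix f g
  have "iop (T f) = T (iop f)" using assms by (simp add: iop_commute)
  then have "inner (iop (T f)) g = - inner f (iop (S g))"
    using assms(2) unfolding is_adjoint_def by (metis inner_iop_left)
  then show "inner (ell2_smul a T f) g = inner f (ell2_smul (cnj a) S g)"
    using assms(2) unfolding is_adjoint_def
    by (simp add: ell2_smul_def blinfun.bilinear_simps inner_simps)
qed

lemma ell2_smul_apply: "ell2_smul a T f = Re a *\<^sub>R T f + Im a *\<^sub>R iop (T f)"
  by (simp add: ell2_smul_def blinfun.bilinear_simps)

text \<open>Pythagoras: f and \<open>iop f\<close> are orthogonal for the real inner product and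
  have equal norm.\<close>

lemma norm_complex_combination: "norm (r *\<^sub>R f + s *\<^sub>R iop f) = sqrt (r\<^sup>2 + s\<^sup>2) * norm f"
proof -
  have o: "inner f (iop f) = 0" using inner_iop_left[of f f] inner_commute[of f "iop f"] by simp
  have "norm (iop f) = norm f" by (simp add: iop.rep_eq)
  then have "inner (iop f) (iop f) = inner f f" by (simp flip: power2_norm_eq_inner)
  then have "(norm (r *\<^sub>R f + s *\<^sub>R iop f))\<^sup>2 = (r\<^sup>2 + s\<^sup>2) * inner f f"
    using o inner_commute[of f "iop f"]
    unfolding power2_norm_eq_inner by (simp add: inner_simps power2_eq_square algebra_simps)
  also have "\<dots> = (sqrt (r\<^sup>2 + s\<^sup>2) * norm f)\<^sup>2" by (simp add: power_mult_distrib power2_norm_eq_inner)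
  finally show ?thesis by (simp add: power2_eq_iff_nonneg)
qed

lemma norm_ell2_smul: "norm (ell2_smul a T) = cmod a * norm T"
proof -
  have n: "norm (ell2_smul a T f) = cmod a * norm (T f)" for f
    by (simp add: ell2_smul_apply norm_complex_combination cmod_def)
  show ?thesis
  proof (rule antisym)
    show "norm (ell2_smul a T) \<le> cmod a * norm T"
      by (rule norm_blinfun_bound) (auto simp: n mult.assoc intro!: mult_left_mono norm_blinfun)
    show "cmod a * norm T \<le> norm (ell2_smul a T)"
    proof (cases "a = 0")
      case False
      have "norm T \<le> norm (ell2_smul a T) / cmod a"
      proof (rule norm_blinfun_bound)
        fix f
        have "cmod a * norm (T f) \<le> norm (ell2_smul a T) * norm f" unfolding n[symmetric] by (rule norm_blinfun)
        then show "norm (T f) \<le> norm (ell2_smul a T) / cmod a * norm f" using False by (simp add: field_simps)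
      qed simp
      then show ?thesis using False by (simp add: field_simps)
    qed simp
  qed
qed

text \<open>Passing to adjoints does not increase norms, so the adjoints of a convergent sequence
  are Cauchy and their limit is an adjoint of the limit.\<close>

lemma closed_ell2_ops: "closed (ell2_ops :: ('x ell2 \<Rightarrow>\<^sub>L 'x ell2) set)"
  unfolding closed_sequential_limits
proof safe
  fix X and T :: "'x ell2 \<Rightarrow>\<^sub>L 'x ell2"
  assume X: "\<forall>n. X n \<in> ell2_ops" and T: "X \<longlonglongrightarrow> T"
  let ?Y = "\<lambda>n. ell2_adj (X n)"
  have adj: "is_adjoint (X n) (?Y n)" for n using X by (simp add: is_adjoint_ell2_adj)
  have "norm (?Y m - ?Y n) \<le> norm (X m - X n)" for m n
    by (rule norm_adjoint_le[OF is_adjoint_diff[OF adj adj]])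
  moreover have "Cauchy X" using T by (rule LIMSEQ_imp_Cauchy)
  ultimately have "Cauchy ?Y" unfolding Cauchy_def dist_norm by (meson le_less_trans)
  then obtain S where S: "?Y \<longlonglongrightarrow> S" by (metis Cauchy_convergent_iff convergent_def)
  have "is_adjoint T S"
    unfolding is_adjoint_def
  proof safe
    fix f g
    have "(\<lambda>n. inner (X n f) g) = (\<lambda>n. inner f (?Y n g))" using adj by (simp add: is_adjoint_def fun_eq_iff)
    moreover have "(\<lambda>n. inner (X n f) g) \<longlonglongrightarrow> inner (T f) g" "(\<lambda>n. inner f (?Y n g)) \<longlonglongrightarrow> inner f (S g)"
      by (intro tendsto_intros T S)+
    ultimately show "inner (T f) g = inner f (S g)" using LIMSEQ_unique by simp
  qed
  moreover have "T (iop f) = iop (T f)" for f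
  proof -
    have "(\<lambda>n. X n (iop f)) = (\<lambda>n. iop (X n f))" using X by (simp add: iop_commute fun_eq_iff)
    moreover have "(\<lambda>n. X n (iop f)) \<longlonglongrightarrow> T (iop f)" "(\<lambda>n. iop (X n f)) \<longlonglongrightarrow> iop (T f)"
      by (intro tendsto_intros T)+
    ultimately show ?thesis using LIMSEQ_unique by simp
  qed
  ultimately show "T \<in> ell2_ops" by (rule ell2_opsI)
qed

lemma ell2_ops_add: "T \<in> ell2_ops \<Longrightarrow> T' \<in> ell2_ops \<Longrightarrow> T + T' \<in> ell2_ops"
  by (rule ell2_opsI[OF is_adjoint_add[OF is_adjoint_ell2_adj is_adjoint_ell2_adj]])
     (auto simp: iop_commute blinfun.bilinear_simps)

lemma ell2_ops_compose: "T \<in> ell2_ops \<Longrightarrow> T' \<in> ell2_ops \<Longrightarrow> T o\<^sub>L T' \<in> ell2_ops"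
  by (rule ell2_opsI[OF is_adjoint_compose[OF is_adjoint_ell2_adj is_adjoint_ell2_adj]])
     (auto simp: iop_commute)

lemma ell2_ops_smul: "T \<in> ell2_ops \<Longrightarrow> ell2_smul a T \<in> ell2_ops"
  by (rule ell2_opsI[OF is_adjoint_smul[OF _ is_adjoint_ell2_adj]])
     (auto simp: iop_commute ell2_smul_apply blinfun.bilinear_simps)

lemma ell2_ops_adj:
  assumes "T \<in> ell2_ops"
  shows "ell2_adj T \<in> ell2_ops"
proof (rule ell2_opsI[OF is_adjoint_sym[OF is_adjoint_ell2_adj[OF assms]]])
  have a: "inner (T f) g = inner f (ell2_adj T g)" for f g
    using is_adjoint_ell2_adj[OF assms] unfolding is_adjoint_def by blast
  fix g
  have "inner f (ell2_adj T (iop g)) = inner f (iop (ell2_adj T g))" for f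
    using a[of f "iop g"] a[of "iop f" g] inner_iop_left[of "T f" g] inner_iop_left[of f "ell2_adj T g"]
      iop_commute[OF assms, of f] by simp
  then show "ell2_adj T (iop g) = iop (ell2_adj T g)" by (metis vector_eq_ldot)
qed

lemma ell2_ops_zero: "0 \<in> ell2_ops"
  by (rule ell2_opsI[of _ 0]) (auto simp: is_adjoint_def blinfun.bilinear_simps)

lemma c_diff_ell2: "c_diff ell2_cstar S T = S - T"
  by (simp add: c_diff_def ell2_cstar_def ell2_smul_def)

lemma is_cstar_ell2: "is_cstar (ell2_cstar :: ('x ell2 \<Rightarrow>\<^sub>L 'x ell2) cstar)"
proof -
  have cl: "\<exists>a\<in>ell2_ops. c_converges ell2_cstar X a"
    if "\<forall>n. X n \<in> ell2_ops" "c_cauchy ell2_cstar X" for X :: "nat \<Rightarrow> 'x ell2 \<Rightarrow>\<^sub>L 'x ell2"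
  proof -
    have "Cauchy X" using that(2) unfolding c_cauchy_def Cauchy_def dist_norm
      by (simp add: c_diff_ell2) (simp add: ell2_cstar_def)
    then obtain T where T: "X \<longlonglongrightarrow> T" by (metis Cauchy_convergent_iff convergent_def)
    then have "T \<in> ell2_ops" using closed_ell2_ops that(1) closed_sequentially by blast
    moreover have "c_converges ell2_cstar X T"
      using T unfolding c_converges_def LIMSEQ_iff c_diff_ell2 by (simp add: ell2_cstar_def)
    ultimately show ?thesis by blast
  qed
  have star1: "ell2_adj (ell2_adj S) = S" "ell2_adj (ell2_smul a S) = ell2_smul (cnj a) (ell2_adj S)"
      "norm (ell2_adj S o\<^sub>L S) = (norm S)\<^sup>2"
    if "S \<in> ell2_ops" for S :: "'x ell2 \<Rightarrow>\<^sub>L 'x ell2" and a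
    using that by (auto intro!: ell2_adj_eq is_adjoint_ell2_adj is_adjoint_smul norm_adjoint_compose
      is_adjoint_sym[OF is_adjoint_ell2_adj])
  have star2: "ell2_adj (S + T) = ell2_adj S + ell2_adj T"
      "ell2_adj (S o\<^sub>L T) = ell2_adj T o\<^sub>L ell2_adj S"
    if "S \<in> ell2_ops" "T \<in> ell2_ops" for S T :: "'x ell2 \<Rightarrow>\<^sub>L 'x ell2"
    using that by (auto intro!: ell2_adj_eq is_adjoint_ell2_adj is_adjoint_add is_adjoint_compose)
  have smul: "ell2_smul (a + b) S = ell2_smul a S + ell2_smul b S" "ell2_smul a (ell2_smul b S) = ell2_smul (a * b) S"
      "ell2_smul a (S + T) = ell2_smul a S + ell2_smul a T" "ell2_smul a S o\<^sub>L T = ell2_smul a (S o\<^sub>L T)"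
      "S \<in> ell2_ops \<Longrightarrow> S o\<^sub>L ell2_smul a T = ell2_smul a (S o\<^sub>L T)"
    for S T :: "'x ell2 \<Rightarrow>\<^sub>L 'x ell2" and a b
    by (auto intro!: blinfun_eqI simp: ell2_smul_apply blinfun.bilinear_simps iop_commute iop_iop algebra_simps)
  have comp: "(S o\<^sub>L T) o\<^sub>L U = S o\<^sub>L (T o\<^sub>L U)" "S o\<^sub>L (T + U) = (S o\<^sub>L T) + (S o\<^sub>L U)"
      "(S + T) o\<^sub>L U = (S o\<^sub>L U) + (T o\<^sub>L U)" for S T U :: "'x ell2 \<Rightarrow>\<^sub>L 'x ell2"
    by (auto intro!: blinfun_eqI simp: blinfun.bilinear_simps)
  have minus: "S + ell2_smul (-1) S = 0" "ell2_smul 1 S = S" for S :: "'x ell2 \<Rightarrow>\<^sub>L 'x ell2"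
    by (simp_all add: ell2_smul_def)
  have sel: "c_carrier ell2_cstar = ell2_ops" "c_zero ell2_cstar = 0" "c_add ell2_cstar = (+)"
      "c_smul ell2_cstar = ell2_smul" "c_mult ell2_cstar = (o\<^sub>L)" "c_star ell2_cstar = ell2_adj" "c_norm ell2_cstar = norm"
    by (simp_all add: ell2_cstar_def)
  show ?thesis
    unfolding is_cstar_def Let_def sel
    by (intro conjI ballI allI impI)
      (simp_all add: cl ell2_ops_zero ell2_ops_add ell2_ops_compose ell2_ops_smul ell2_ops_adj star1 star2 smul comp
        minus norm_ell2_smul norm_triangle_ineq norm_blinfun_compose add.assoc add.commute)
qed

subsection \<open>Operators induced by partial injections\<close>

definition partial_comp :: "('x \<Rightarrow> 'x option) \<Rightarrow> ('x \<Rightarrow> complex) \<Rightarrow> 'x \<Rightarrow> complex" where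
  "partial_comp \<phi> f x = (case \<phi> x of None \<Rightarrow> 0 | Some y \<Rightarrow> f y)"

definition partial_inj :: "('x \<Rightarrow> 'x option) \<Rightarrow> bool" where
  "partial_inj \<phi> \<longleftrightarrow> (\<forall>x y z. \<phi> x = Some z \<longrightarrow> \<phi> y = Some z \<longrightarrow> x = y)"

lemma sum_partial_comp_le:
  assumes "partial_inj \<phi>" "finite F"
  shows "(\<Sum>x\<in>F. (cmod (partial_comp \<phi> (Rep_ell2 f) x))\<^sup>2) \<le> (norm f)\<^sup>2"
proof -
  let ?F = "{x \<in> F. \<phi> x \<noteq> None}" and ?g = "\<lambda>x. the (\<phi> x)"
  have "(\<Sum>x\<in>F. (cmod (partial_comp \<phi> (Rep_ell2 f) x))\<^sup>2) = (\<Sum>x\<in>?F. (cmod (Rep_ell2 f (?g x)))\<^sup>2)"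
    using assms(2) by (intro sum.mono_neutral_cong_right) (auto simp: partial_comp_def)
  also have "\<dots> = (\<Sum>y\<in>?g ` ?F. (cmod (Rep_ell2 f y))\<^sup>2)"
    using assms(1) by (subst sum.reindex) (auto simp: inj_on_def partial_inj_def)
  also have "\<dots> \<le> (norm f)\<^sup>2" using assms(2) by (intro sum_le_norm_ell2) auto
  finally show ?thesis .
qed

text \<open>The value 0 for maps that are not injective makes the operator total and always
  bounded.\<close>

lift_definition partial_op :: "('x \<Rightarrow> 'x option) \<Rightarrow> 'x ell2 \<Rightarrow> 'x ell2" is
  "\<lambda>\<phi> f. if partial_inj \<phi> then partial_comp \<phi> f else (\<lambda>_. 0)"
proof -
  fix \<phi> :: "'x \<Rightarrow> 'x option" and f :: "'x \<Rightarrow> complex" assume "square_summable f"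
  then have "Rep_ell2 (Abs_ell2 f) = f" by (simp add: Abs_ell2_inverse)
  then show "square_summable (if partial_inj \<phi> then partial_comp \<phi> f else (\<lambda>_. 0))"
    using sum_partial_comp_le[of \<phi> _ "Abs_ell2 f"]
    by (auto intro!: square_summableI(1)[of "partial_comp \<phi> f"]) (simp add: square_summable_def)
qed

lemma norm_partial_op_le: "partial_inj \<phi> \<Longrightarrow> norm (partial_op \<phi> f) \<le> norm f"
  by (rule norm_ell2_le) (auto simp: partial_op.rep_eq sum_partial_comp_le)

lemma bounded_linear_partial_op: "bounded_linear (partial_op \<phi>)"
proof (cases "partial_inj \<phi>")
  case True
  show ?thesis
  proof (rule bounded_linear_intro[where K=1])
    show "partial_op \<phi> (f + g) = partial_op \<phi> f + partial_op \<phi> g" for f g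
      by transfer (auto simp: partial_comp_def fun_eq_iff split: option.splits)
    show "partial_op \<phi> (r *\<^sub>R f) = r *\<^sub>R partial_op \<phi> f" for r f
      by transfer (auto simp: partial_comp_def fun_eq_iff split: option.splits)
  qed (use norm_partial_op_le[OF True] in simp)
next
  case False
  then have "partial_op \<phi> f = 0" for f by transfer simp
  then have "partial_op \<phi> = (\<lambda>_. 0)" by (rule ext)
  then show ?thesis by simp
qed

lift_definition pop :: "('x \<Rightarrow> 'x option) \<Rightarrow> 'x ell2 \<Rightarrow>\<^sub>L 'x ell2" is partial_op
  by (rule bounded_linear_partial_op)

lemma Rep_pop: "partial_inj \<phi> \<Longrightarrow> Rep_ell2 (pop \<phi> f) x = partial_comp \<phi> (Rep_ell2 f) x"
  by (simp add: pop.rep_eq partial_op.rep_eq)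

lemma ell2_op_eqI:
  fixes S T :: "'x ell2 \<Rightarrow>\<^sub>L 'x ell2"
  assumes "\<And>f x. Rep_ell2 (S f) x = Rep_ell2 (T f) x"
  shows "S = T"
  using assms by (intro blinfun_eqI) (metis Rep_ell2_inject ext)

text \<open>The inner product is reindexed along the bijection between the domains of the two maps;
  off these domains the summands vanish.\<close>

lemma is_adjoint_pop:
  assumes inv: "\<And>x y. \<phi> x = Some y \<longleftrightarrow> \<psi> y = Some x"
  shows "is_adjoint (pop \<phi>) (pop \<psi>)"
  unfolding is_adjoint_def
proof safe
  fix f g :: "'a ell2"
  have \<phi>: "partial_inj \<phi>" using inv unfolding partial_inj_def by (metis option.inject)
  have \<psi>: "partial_inj \<psi>" using inv unfolding partial_inj_def by (metis option.inject)
  let ?u = "Rep_ell2 f" and ?v = "Rep_ell2 g" and ?D = "{x. \<phi> x \<noteq> None}" and ?E = "{y. \<psi> y \<noteq> None}"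
  have \<phi>\<psi>: "\<psi> (the (\<phi> x)) = Some x" if "\<phi> x \<noteq> None" for x using inv[of x "the (\<phi> x)"] that by simp
  have \<psi>\<phi>: "\<phi> (the (\<psi> y)) = Some y" if "\<psi> y \<noteq> None" for y using inv[of "the (\<psi> y)" y] that by simp
  have bij: "bij_betw (\<lambda>x. the (\<phi> x)) ?D ?E"
    by (rule bij_betwI[where g="\<lambda>y. the (\<psi> y)"]) (simp_all add: \<phi>\<psi> \<psi>\<phi>)
  have "inner (pop \<phi> f) g = (\<Sum>\<^sub>\<infinity>x\<in>?D. ?u (the (\<phi> x)) \<bullet> ?v (the (\<psi> (the (\<phi> x)))))"
    unfolding inner_ell2_def Rep_pop[OF \<phi>]
    by (rule infsum_cong_neutral) (auto simp: partial_comp_def \<phi>\<psi>)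
  also have "\<dots> = (\<Sum>\<^sub>\<infinity>y\<in>?E. ?u y \<bullet> ?v (the (\<psi> y)))"
    by (rule infsum_reindex_bij_betw[OF bij, of "\<lambda>y. ?u y \<bullet> ?v (the (\<psi> y))"])
  also have "\<dots> = inner f (pop \<psi> g)"
    unfolding inner_ell2_def Rep_pop[OF \<psi>]
    by (rule infsum_cong_neutral) (auto simp: partial_comp_def split: option.splits)
  finally show "inner (pop \<phi> f) g = inner f (pop \<psi> g)" .
qed

lemma pop_in_ell2_ops:
  assumes inv: "\<And>x y. \<phi> x = Some y \<longleftrightarrow> \<psi> y = Some x"
  shows "pop \<phi> \<in> ell2_ops" "ell2_adj (pop \<phi>) = pop \<psi>"
proof -
  have \<phi>: "partial_inj \<phi>" using inv unfolding partial_inj_def by (metis option.inject)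
  have "pop \<phi> (iop f) = iop (pop \<phi> f)" for f
  proof -
    have "Rep_ell2 (pop \<phi> (iop f)) x = Rep_ell2 (iop (pop \<phi> f)) x" for x
      by (simp add: Rep_pop[OF \<phi>] iop.rep_eq ell2_ii.rep_eq partial_comp_def split: option.splits)
    then show ?thesis by (metis Rep_ell2_inject ext)
  qed
  then show "pop \<phi> \<in> ell2_ops" by (rule ell2_opsI[OF is_adjoint_pop[OF inv]])
  show "ell2_adj (pop \<phi>) = pop \<psi>" by (rule ell2_adj_eq[OF is_adjoint_pop[OF inv]])
qed

lift_definition ell2_delta :: "'x \<Rightarrow> 'x ell2" is "\<lambda>x y. if y = x then 1 else 0"
proof -
  fix x :: 'x
  have "(\<Sum>y\<in>F. (cmod (if y = x then 1 else 0))\<^sup>2) \<le> 1" if "finite F" for F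
  proof -
    have "(\<Sum>y\<in>F. (cmod (if y = x then 1 else 0))\<^sup>2) = (\<Sum>y\<in>F. if y = x then 1 else 0)"
      by (intro sum.cong) auto
    then show ?thesis using that by simp
  qed
  then show "square_summable (\<lambda>y. if y = x then 1 else 0)" by (rule square_summableI(1))
qed

section \<open>The universal property on arbitrary types\<close>

lemma bounded_bilinear_cscale: "bounded_bilinear (cscale :: complex \<Rightarrow> 'a::cstar_alg \<Rightarrow> 'a)"
proof
  show "\<exists>K. \<forall>a (b :: 'a). norm (cscale a b) \<le> norm a * norm b * K" by (intro exI[of _ 1]) simp
qed (auto simp: cscale_add_left cscale_add_right scaleR_cscale scaleR_conv_of_real mult.commute)

lemmas tendsto_cscale [tendsto_intros] = bounded_bilinear.tendsto[OF bounded_bilinear_cscale]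
  and tendsto_star [tendsto_intros] = bounded_linear.tendsto[OF bounded_linear_star]

definition star_subalgebra :: "'a::cstar_alg set \<Rightarrow> bool" where
  "star_subalgebra S \<longleftrightarrow> 0 \<in> S \<and> (\<forall>x\<in>S. \<forall>y\<in>S. x + y \<in> S \<and> x * y \<in> S) \<and>
     (\<forall>a. \<forall>x\<in>S. cscale a x \<in> S) \<and> (\<forall>x\<in>S. star x \<in> S) \<and> closed S"

lemma closure_limit:
  fixes D :: "'a::metric_space set"
  shows "(\<And>n. X n \<in> D) \<Longrightarrow> X \<longlonglongrightarrow> x \<Longrightarrow> x \<in> closure D"
  unfolding closure_sequential by (intro exI[of _ X]) simp

text \<open>Scalars from a dense set Q suffice: a countable Q keeps a dense subset countable, and Q
  = \<open>UNIV\<close> serves for the span of the generators.\<close>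

lemma star_subalgebra_closure:
  assumes "0 \<in> D" "\<And>x y. x \<in> D \<Longrightarrow> y \<in> D \<Longrightarrow> x + y \<in> D" "\<And>x y. x \<in> D \<Longrightarrow> y \<in> D \<Longrightarrow> x * y \<in> D"
    and "\<And>x. x \<in> D \<Longrightarrow> star x \<in> D" and Q: "\<And>a x. a \<in> Q \<Longrightarrow> x \<in> D \<Longrightarrow> cscale a x \<in> D" "closure Q = UNIV"
  shows "star_subalgebra (closure D)"
  unfolding star_subalgebra_def
proof (intro conjI ballI allI)
  show "0 \<in> closure D" using assms(1) closure_subset by blast
  fix x y assume "x \<in> closure D" "y \<in> closure D"
  then obtain X Y where X: "\<And>n. X n \<in> D" "X \<longlonglongrightarrow> x" and Y: "\<And>n. Y n \<in> D" "Y \<longlonglongrightarrow> y"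
    unfolding closure_sequential by blast
  have "(\<lambda>n. X n + Y n) \<longlonglongrightarrow> x + y" "(\<lambda>n. X n * Y n) \<longlonglongrightarrow> x * y" by (intro tendsto_intros X Y)+
  with X(1) Y(1) show "x + y \<in> closure D" "x * y \<in> closure D"
    by (auto intro: closure_limit[rotated] assms(2,3))
next
  fix x assume "x \<in> closure D"
  then obtain X where X: "\<And>n. X n \<in> D" "X \<longlonglongrightarrow> x" unfolding closure_sequential by blast
  have "(\<lambda>n. star (X n)) \<longlonglongrightarrow> star x" by (intro tendsto_intros X)
  with X(1) show "star x \<in> closure D" by (auto intro: closure_limit[rotated] assms(4))
  fix a
  have "a \<in> closure Q" using Q(2) by simp
  then obtain b where b: "\<And>n. b n \<in> Q" "b \<longlonglongrightarrow> a" unfolding closure_sequential by blast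
  have "(\<lambda>n. cscale (b n) (X n)) \<longlonglongrightarrow> cscale a x" by (intro tendsto_intros X b)
  with X(1) b(1) show "cscale a x \<in> closure D" by (auto intro: closure_limit[rotated] Q(1))
qed simp

text \<open>T is closed countably often under the operations, with scalars from a countable dense
  set, so every stage stays countable.\<close>

lemma separable_star_subalgebra:
  fixes T :: "'a::cstar_alg set"
  assumes "countable T"
  obtains D where "countable D" "T \<subseteq> D" "D \<noteq> {}" "star_subalgebra (closure D)"
proof -
  obtain Q :: "complex set" where Q: "countable Q" "\<And>X. open X \<Longrightarrow> X \<noteq> {} \<Longrightarrow> \<exists>d\<in>Q. d \<in> X"
    using countable_dense_setE by blast
  define step :: "'a set \<Rightarrow> 'a set" where "step X = X \<union> (\<lambda>(x, y). x + y) ` (X \<times> X) \<union>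
      (\<lambda>(x, y). x * y) ` (X \<times> X) \<union> star ` X \<union> (\<lambda>(a, x). cscale a x) ` (Q \<times> X)" for X
  define D where "D = (\<Union>n. (step ^^ n) (insert 0 T))"
  have "countable ((step ^^ n) (insert 0 T))" for n
    by (induction n) (use assms Q(1) in \<open>auto simp: step_def\<close>)
  then have "countable D" by (simp add: D_def)
  moreover have "insert 0 T \<subseteq> D" unfolding D_def by (rule order.trans[OF _ UN_upper[of 0]]) simp_all
  moreover have mono: "(step ^^ m) X \<subseteq> (step ^^ n) X" if "m \<le> n" for m n X
    using that by (induction n rule: dec_induct) (auto simp: step_def)
  have step_D: "z \<in> D" if z: "z \<in> step ((step ^^ n) (insert 0 T))" for z n
    using z unfolding D_def by (intro UN_I[of "Suc n"]) auto
  have two: "\<exists>n. x \<in> (step ^^ n) (insert 0 T) \<and> y \<in> (step ^^ n) (insert 0 T)" if xy: "x \<in> D" "y \<in> D" for x y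
  proof -
    obtain m n where "x \<in> (step ^^ m) (insert 0 T)" "y \<in> (step ^^ n) (insert 0 T)"
      using xy unfolding D_def by blast
    then show ?thesis using mono[of m "max m n"] mono[of n "max m n"] by (intro exI[of _ "max m n"]) auto
  qed
  have "star_subalgebra (closure D)"
  proof (rule star_subalgebra_closure)
    show "closure Q = UNIV" using Q(2) by (auto simp: closure_iff_nhds_not_empty) (metis disjoint_iff inf_commute interiorE empty_iff subsetD)
    show "0 \<in> D" using \<open>insert 0 T \<subseteq> D\<close> by auto
    fix x y assume xy: "x \<in> D" "y \<in> D"
    then obtain n where "x \<in> (step ^^ n) (insert 0 T)" "y \<in> (step ^^ n) (insert 0 T)" using two by blast
    then have "x + y \<in> step ((step ^^ n) (insert 0 T))" "x * y \<in> step ((step ^^ n) (insert 0 T))"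
      unfolding step_def by blast+
    then show "x + y \<in> D" "x * y \<in> D" using step_D by blast+
  next
    fix x assume "x \<in> D"
    then obtain n where "x \<in> (step ^^ n) (insert 0 T)" using two by blast
    then have "star x \<in> step ((step ^^ n) (insert 0 T))" "\<And>a. a \<in> Q \<Longrightarrow> cscale a x \<in> step ((step ^^ n) (insert 0 T))"
      unfolding step_def by blast+
    then show "star x \<in> D" "\<And>a. a \<in> Q \<Longrightarrow> cscale a x \<in> D" using step_D by blast+
  qed
  ultimately show ?thesis using that[of D] by blast
qed

lemma (in cstar_record) c_sum_insert:
  assumes "finite F" "x \<notin> F" "\<And>y. y \<in> insert x F \<Longrightarrow> f y \<in> c_carrier A"
  shows "c_sum A f (insert x F) = c_add A (f x) (c_sum A f F)"
proof -
  have "emb A (c_sum A f (insert x F)) = emb A (c_add A (f x) (c_sum A f F))"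
    using assms emb_c_sum[of "insert x F" f] emb_c_sum[of F f] c_sum_closed[of F f] by simp
  then show ?thesis using assms by (subst (asm) emb_inject) (auto intro!: c_sum_closed)
qed

lemma c_sum_infinite: "infinite F \<Longrightarrow> c_sum A f F = c_zero A"
  by (simp add: c_sum_def)

lemma c_sum_empty: "c_sum A f {} = c_zero A"
  by (simp add: c_sum_def)

text \<open>Here f is a mere injection of sets on S; the whole structure is carried over by
  definition, so the target type needs none of its own.\<close>

definition transport :: "'a cstar \<Rightarrow> 'a set \<Rightarrow> ('a \<Rightarrow> 'b) \<Rightarrow> 'b cstar" where
  "transport B S f = \<lparr>c_carrier = f ` S, c_zero = f (c_zero B),
     c_add = (\<lambda>x y. f (c_add B (inv_into S f x) (inv_into S f y))),
     c_smul = (\<lambda>a x. f (c_smul B a (inv_into S f x))),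
     c_mult = (\<lambda>x y. f (c_mult B (inv_into S f x) (inv_into S f y))),
     c_star = (\<lambda>x. f (c_star B (inv_into S f x))),
     c_norm = (\<lambda>x. c_norm B (inv_into S f x))\<rparr>"

locale transported = cstar_record A for A :: "'a cstar" +
  fixes S :: "'a set" and f :: "'a \<Rightarrow> 'b"
  assumes sub: "closed_star_subalg A S" and inj: "inj_on f S"
begin

abbreviation "T \<equiv> transport A S f"
abbreviation "g \<equiv> inv_into S f"

lemma g_f [simp]: "x \<in> S \<Longrightarrow> g (f x) = x" using inj by simp

lemma S_carrier: "x \<in> S \<Longrightarrow> x \<in> c_carrier A" using sub by (auto simp: closed_star_subalg_def)

lemma S_closed [simp]:
  "c_zero A \<in> S" "x \<in> S \<Longrightarrow> y \<in> S \<Longrightarrow> c_add A x y \<in> S" "x \<in> S \<Longrightarrow> y \<in> S \<Longrightarrow> c_mult A x y \<in> S"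
  "x \<in> S \<Longrightarrow> c_smul A a x \<in> S" "x \<in> S \<Longrightarrow> c_star A x \<in> S"
  using sub by (auto simp: closed_star_subalg_def)

lemma T_simps:
  "c_carrier T = f ` S" "c_zero T = f (c_zero A)" "x \<in> S \<Longrightarrow> y \<in> S \<Longrightarrow> c_add T (f x) (f y) = f (c_add A x y)"
  "x \<in> S \<Longrightarrow> y \<in> S \<Longrightarrow> c_mult T (f x) (f y) = f (c_mult A x y)" "x \<in> S \<Longrightarrow> c_smul T a (f x) = f (c_smul A a x)"
  "x \<in> S \<Longrightarrow> c_star T (f x) = f (c_star A x)" "x \<in> S \<Longrightarrow> c_norm T (f x) = c_norm A x"
  by (simp_all add: transport_def)

lemma T_eq_iff: "x \<in> S \<Longrightarrow> y \<in> S \<Longrightarrow> f x = f y \<longleftrightarrow> x = y"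
  using inj by (auto dest: inj_onD)

lemma is_cstar_transport: "is_cstar T"
proof -
  have complete: "\<exists>a\<in>f ` S. c_converges T X a" if X: "\<forall>n. X n \<in> f ` S" "c_cauchy T X" for X
  proof -
    define Y where "Y n = g (X n)" for n
    have Y: "Y n \<in> S" "X n = f (Y n)" for n
    proof -
      obtain y where "y \<in> S" "X n = f y" using X(1) by blast
      then show "Y n \<in> S" "X n = f (Y n)" by (simp_all add: Y_def)
    qed
    have "c_cauchy A Y"
      using X(2) unfolding c_cauchy_def by (simp add: c_diff_def Y T_simps)
    then obtain a where a: "a \<in> c_carrier A" "c_converges A Y a"
      using complete[of Y] Y(1) S_carrier by blast
    then have "a \<in> S" using sub Y(1) unfolding closed_star_subalg_def c_closed_set_def by blast
    moreover have "c_converges T X (f a)"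
      using a(2) \<open>a \<in> S\<close> unfolding c_converges_def by (simp add: c_diff_def Y T_simps)
    ultimately show ?thesis by blast
  qed
  have left_comm: "c_add A x (c_add A y z) = c_add A y (c_add A x z)"
    if "x \<in> c_carrier A" "y \<in> c_carrier A" "z \<in> c_carrier A" for x y z
    using that add_assoc[of x y z] add_assoc[of y x z] add_commute[of x y] by simp
  note ops = left_comm add_assoc mult_assoc distrib_left distrib_right smul_add_right smul_mult_left smul_mult_right
    star_add star_mult add_zero add_minus smul_one smul_add_left smul_smul star_star star_smul norm_nonneg
    norm_eq_zero norm_smul norm_triangle norm_mult_le norm_star_mult
  show ?thesis
    unfolding is_cstar_def Let_def T_simps(1)
    by (intro conjI; (intro allI impI; elim conjE; rule complete; assumption)?)
      (simp_all add: T_simps S_carrier T_eq_iff ops add_commute)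
qed

lemma c_sum_transport:
  assumes "\<And>i. i \<in> F \<Longrightarrow> h i \<in> S"
  shows "c_sum T (\<lambda>i. f (h i)) F = f (c_sum A h F) \<and> c_sum A h F \<in> S"
  using assms
proof (induction F rule: infinite_finite_induct)
  case (insert x F)
  interpret T: cstar_record T by (rule cstar_record.intro, rule is_cstar_transport)
  have "c_sum T (\<lambda>i. f (h i)) (insert x F) = c_add T (f (h x)) (c_sum T (\<lambda>i. f (h i)) F)"
    using insert.hyps insert.prems by (intro T.c_sum_insert) (auto simp: T_simps)
  moreover have "c_sum A h (insert x F) = c_add A (h x) (c_sum A h F)"
    using insert.hyps insert.prems S_carrier by (intro c_sum_insert) auto
  ultimately show ?case using insert by (simp add: T_simps)
qed (auto simp: c_sum_infinite c_sum_empty T_simps)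

lemma star_hom_inverse: "star_hom B T \<pi> \<Longrightarrow> star_hom B A (\<lambda>x. g (\<pi> x))"
  unfolding star_hom_def T_simps(1)
proof (intro ballI conjI allI)
  fix x y a
  assume h: "\<forall>x\<in>c_carrier B. \<pi> x \<in> f ` S \<and> \<pi> (c_star B x) = c_star T (\<pi> x) \<and>
     (\<forall>a. \<pi> (c_smul B a x) = c_smul T a (\<pi> x)) \<and>
     (\<forall>y\<in>c_carrier B. \<pi> (c_add B x y) = c_add T (\<pi> x) (\<pi> y) \<and> \<pi> (c_mult B x y) = c_mult T (\<pi> x) (\<pi> y))"
    and x: "x \<in> c_carrier B"
  obtain u where u: "u \<in> S" "\<pi> x = f u" using h x by blast
  show "g (\<pi> x) \<in> c_carrier A" using u S_carrier by simp
  show "g (\<pi> (c_star B x)) = c_star A (g (\<pi> x))" using h x u by (simp add: T_simps)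
  show "g (\<pi> (c_smul B a x)) = c_smul A a (g (\<pi> x))" using h x u by (simp add: T_simps)
  assume y: "y \<in> c_carrier B"
  obtain w where w: "w \<in> S" "\<pi> y = f w" using h y by blast
  show "g (\<pi> (c_add B x y)) = c_add A (g (\<pi> x)) (g (\<pi> y))"
    "g (\<pi> (c_mult B x y)) = c_mult A (g (\<pi> x)) (g (\<pi> y))" using h x y u w by (simp_all add: T_simps)
qed

lemma CK_family_transport:
  assumes t: "CK_family L k A t" and tS: "\<And>l. l \<in> kg_paths L \<Longrightarrow> t l \<in> S" and "is_kgraph L k"
  shows "CK_family L k T (\<lambda>l. f (t l))"
proof -
  interpret kgraph L k by unfold_locales fact
  have "f (t v) = c_sum T (\<lambda>l. c_mult T (f (t l)) (c_star T (f (t l)))) (paths_le L k v m)"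
    if "v \<in> vertices L" "m \<in> Nk k" for v m
  proof -
    let ?h = "\<lambda>l. c_mult A (t l) (c_star A (t l))"
    have eq: "c_mult T (f (t l)) (c_star T (f (t l))) = f (?h l)" if "l \<in> paths_le L k v m" for l
      using tS that by (simp add: T_simps paths_le_def)
    interpret T: cstar_record T by (rule cstar_record.intro, rule is_cstar_transport)
    have "c_sum T (\<lambda>l. c_mult T (f (t l)) (c_star T (f (t l)))) F = c_sum T (\<lambda>l. f (?h l)) F"
      if "F \<subseteq> paths_le L k v m" for F
      using that
    proof (induction F rule: infinite_finite_induct)
      case (insert l F)
      have P: "\<And>l'. l' \<in> insert l F \<Longrightarrow> t l' \<in> S" using insert.prems tS by (auto simp: paths_le_def)
      show ?case
        using insert P by (subst (1 2) T.c_sum_insert) (auto simp: T_simps eq)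
    qed (auto simp: c_sum_infinite c_sum_empty)
    moreover have "c_sum T (\<lambda>l. f (?h l)) (paths_le L k v m) = f (c_sum A ?h (paths_le L k v m))"
      using tS by (intro conjunct1[OF c_sum_transport]) (auto simp: paths_le_def)
    moreover have "t v = c_sum A ?h (paths_le L k v m)" using t that unfolding CK_family_def by blast
    ultimately show ?thesis by simp
  qed
  then show ?thesis
    using t tS unfolding CK_family_def by (simp add: T_simps)
qed

end

text \<open>The universal property quantifies over algebras on one fixed type only. It extends to all types because
  the algebra generated by a family indexed by the countable set of paths is separable, hence embeds into that type.\<close>

lemma universal_property:
  fixes B :: "'b cstar"
  assumes univ: "universal_CK L k A s" and L: "is_kgraph L k" and B: "is_cstar B" and t: "CK_family L k B t"
  shows "\<exists>\<pi>. star_hom A B \<pi> \<and> (\<forall>l\<in>kg_paths L. \<pi> (s l) = t l)"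
proof -
  interpret cstar_record B using B by unfold_locales
  have tC: "t l \<in> c_carrier B" if "l \<in> kg_paths L" for l using t that by (auto simp: CK_family_def)
  have "countable (emb B ` t ` kg_paths L)" using L by (auto simp: is_kgraph_def)
  then obtain D where D: "countable D" "emb B ` t ` kg_paths L \<subseteq> D" "D \<noteq> {}" "star_subalgebra (closure D)"
    by (rule separable_star_subalgebra)
  define S where "S = {b \<in> c_carrier B. emb B b \<in> closure D}"
  define d where "d = from_nat_into D"
  have d: "range d = D" unfolding d_def using D(1,3) by (rule range_from_nat_into[rotated])
  \<comment> \<open>A point of the closure of D is determined by its distances to a dense sequence.
    This list of distances is the injection into the type over which the universal property
    quantifies.\<close>
  define f :: "'b \<Rightarrow> nat \<Rightarrow> complex" where "f b = (\<lambda>n. complex_of_real (norm (emb B b - d n)))" for b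
  have "closed_star_subalg B S"
  proof -
    have "emb B ` S = emb B ` c_carrier B \<inter> closure D" by (auto simp: S_def)
    then have "c_closed_set B S" using closed_emb_carrier by (subst c_closed_set_iff) (auto simp: S_def)
    then show ?thesis using D(4) unfolding closed_star_subalg_def star_subalgebra_def S_def by auto
  qed
  moreover have "inj_on f S"
  proof (rule inj_onI)
    fix a b assume a: "a \<in> S" and b: "b \<in> S" and "f a = f b"
    then have eq: "norm (emb B a - d n) = norm (emb B b - d n)" for n
    proof -
      have "f a n = f b n" using \<open>f a = f b\<close> by simp
      then show ?thesis unfolding f_def of_real_eq_iff .
    qed
    have "norm (emb B a - emb B b) \<le> 0 + e" if "e > 0" for e
    proof -
      have "emb B a \<in> closure D" using a by (simp add: S_def)
      then obtain n where "dist (d n) (emb B a) < e / 2"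
        using d \<open>e > 0\<close> unfolding closure_approachable by (metis half_gt_zero rangeE)
      then have "norm (emb B a - d n) < e / 2" by (simp add: dist_norm norm_minus_commute)
      then show ?thesis
        using eq[of n] norm_triangle_ineq4[of "emb B a - d n" "emb B b - d n"] by simp
    qed
    then have "norm (emb B a - emb B b) \<le> 0" by (rule field_le_epsilon)
    then show "a = b" using a b by (simp add: S_def)
  qed
  ultimately interpret transported B S f by unfold_locales
  have "t l \<in> S" if "l \<in> kg_paths L" for l
    using that tC D(2) closure_subset by (auto simp: S_def)
  then have "CK_family L k T (\<lambda>l. f (t l))" and tS: "\<And>l. l \<in> kg_paths L \<Longrightarrow> t l \<in> S"
    using CK_family_transport[OF t _ L] by blast+
  then obtain \<pi> where \<pi>: "star_hom A T \<pi>" "\<forall>l\<in>kg_paths L. \<pi> (s l) = f (t l)"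
    using univ is_cstar_transport unfolding universal_CK_def by blast
  show ?thesis
    using star_hom_inverse[OF \<pi>(1)] \<pi>(2) tS by (intro exI[of _ "\<lambda>x. g (\<pi> x)"]) simp
qed

section \<open>Gauge automorphisms and non-vanishing of the vertex projections\<close>

text \<open>Counterpart of \<open>CK_family\<close> in the type class; \<open>CK_family_iff\<close>
  translates between the two through \<open>emb\<close>.\<close>

definition ck_relations :: "'p kgraph \<Rightarrow> nat \<Rightarrow> ('p \<Rightarrow> 'u::cstar_alg) \<Rightarrow> bool" where
  "ck_relations L k t \<longleftrightarrow>
     (\<forall>v\<in>vertices L. star (t v) = t v \<and> t v * t v = t v) \<and>
     (\<forall>v\<in>vertices L. \<forall>w\<in>vertices L. v \<noteq> w \<longrightarrow> t v * t w = 0) \<and>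
     (\<forall>l\<in>kg_paths L. \<forall>m\<in>kg_paths L. kg_s L l = kg_r L m \<longrightarrow> t (kg_comp L l m) = t l * t m) \<and>
     (\<forall>l\<in>kg_paths L. star (t l) * t l = t (kg_s L l)) \<and>
     (\<forall>v\<in>vertices L. \<forall>m\<in>Nk k. t v = (\<Sum>l\<in>paths_le L k v m. t l * star (t l)))"

lemma (in cstar_record) CK_family_iff:
  assumes L: "is_kgraph L k" "row_finite L k" and tC: "\<And>l. l \<in> kg_paths L \<Longrightarrow> t l \<in> c_carrier A"
  shows "CK_family L k A t \<longleftrightarrow> ck_relations L k (\<lambda>l. emb A (t l))"
proof -
  interpret kgraph L k by unfold_locales fact
  have star_eq: "c_star A x = y \<longleftrightarrow> star (emb A x) = emb A y" if "x \<in> c_carrier A" "y \<in> c_carrier A" for x y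
    using emb_inject[of "c_star A x" y] that by simp
  have mult_eq: "c_mult A x y = z \<longleftrightarrow> emb A x * emb A y = emb A z"
    if "x \<in> c_carrier A" "y \<in> c_carrier A" "z \<in> c_carrier A" for x y z
    using emb_inject[of "c_mult A x y" z] that by simp
  have vC: "t v \<in> c_carrier A" if "v \<in> vertices L" for v using tC that by simp
  have 1: "(\<forall>v\<in>vertices L. c_star A (t v) = t v \<and> c_mult A (t v) (t v) = t v) \<longleftrightarrow>
      (\<forall>v\<in>vertices L. star (emb A (t v)) = emb A (t v) \<and> emb A (t v) * emb A (t v) = emb A (t v))"
    by (simp add: star_eq mult_eq vC)
  have 2: "(\<forall>v\<in>vertices L. \<forall>w\<in>vertices L. v \<noteq> w \<longrightarrow> c_mult A (t v) (t w) = c_zero A) \<longleftrightarrow>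
      (\<forall>v\<in>vertices L. \<forall>w\<in>vertices L. v \<noteq> w \<longrightarrow> emb A (t v) * emb A (t w) = 0)"
    by (simp add: mult_eq vC)
  have 3: "(\<forall>l\<in>P. \<forall>m\<in>P. src l = rng m \<longrightarrow> t (l \<odot> m) = c_mult A (t l) (t m)) \<longleftrightarrow>
      (\<forall>l\<in>P. \<forall>m\<in>P. src l = rng m \<longrightarrow> emb A (t (l \<odot> m)) = emb A (t l) * emb A (t m))"
    by (intro ball_cong refl imp_cong) (use mult_eq tC in \<open>auto simp: eq_commute[of "t _"]\<close>)
  have 4: "(\<forall>l\<in>P. c_mult A (c_star A (t l)) (t l) = t (src l)) \<longleftrightarrow>
      (\<forall>l\<in>P. star (emb A (t l)) * emb A (t l) = emb A (t (src l)))"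
    by (simp add: mult_eq tC)
  have 5: "(t v = c_sum A (\<lambda>l. c_mult A (t l) (c_star A (t l))) (paths_le L k v m)) \<longleftrightarrow>
      (emb A (t v) = (\<Sum>l\<in>paths_le L k v m. emb A (t l) * star (emb A (t l))))" if "v \<in> vertices L" for v m
  proof -
    let ?c = "c_sum A (\<lambda>l. c_mult A (t l) (c_star A (t l))) (paths_le L k v m)"
    have P: "\<And>l. l \<in> paths_le L k v m \<Longrightarrow> c_mult A (t l) (c_star A (t l)) \<in> c_carrier A"
      using tC by (simp add: paths_le_def)
    have "emb A ?c = (\<Sum>l\<in>paths_le L k v m. emb A (c_mult A (t l) (c_star A (t l))))"
      by (rule emb_c_sum[OF finite_paths_le[OF L(2) that] P])
    also have "\<dots> = (\<Sum>l\<in>paths_le L k v m. emb A (t l) * star (emb A (t l)))"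
      using tC by (intro sum.cong refl) (simp add: paths_le_def)
    finally show ?thesis
      using emb_inject[of "t v" ?c] c_sum_closed[OF finite_paths_le[OF L(2) that] P] vC[OF that] by simp
  qed
  show ?thesis
    unfolding CK_family_def ck_relations_def 1 2 3 4 using tC 5 by simp
qed

text \<open>\<open>gauge_invariant\<close> speaks about all endomorphisms of a certain form and says
  something only if one exists. The family rescaled by scalars of modulus 1 is again Cuntz-Krieger,
  so the universal property supplies it.\<close>

lemma gauge_automorphism_exists:
  assumes univ: "universal_CK L k A s" and L: "is_kgraph L k" "row_finite L k" and z: "\<And>i. i < k \<Longrightarrow> cmod (z i) = 1"
  shows "\<exists>\<phi>. star_hom A A \<phi> \<and> (\<forall>l\<in>kg_paths L. \<phi> (s l) = c_smul A (zpow k z (kg_deg L l)) (s l))"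
proof -
  interpret kgraph L k by unfold_locales fact
  have A: "is_cstar A" "CK_family L k A s" using univ by (auto simp: universal_CK_def)
  interpret cstar_record A using A by unfold_locales
  have sC: "s l \<in> c_carrier A" if "l \<in> P" for l using A(2) that by (auto simp: CK_family_def)
  let ?w = "\<lambda>l. zpow k z (deg l)" and ?e = "\<lambda>l. emb A (s l)"
  have w1: "cnj (?w l) * ?w l = 1" for l
  proof -
    have "cmod (?w l) = 1" using z by (simp add: zpow_def norm_power flip: prod_norm)
    then show ?thesis using complex_norm_square[of "?w l"] by (simp add: mult.commute)
  qed
  then have w1': "?w l * cnj (?w l) = 1" for l by (simp add: mult.commute)
  have w0: "zpow k z (\<lambda>_. 0) = 1" by (simp add: zpow_def)
  have w2: "?w (l \<odot> m) = ?w m * ?w l" if "l \<in> P" "m \<in> P" "src l = rng m" for l m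
    using that by (simp add: zpow_def deg_comp power_add prod.distrib)
  have e: "ck_relations L k ?e" using A(2) CK_family_iff[OF L sC] by simp
  have "CK_family L k A (\<lambda>l. c_smul A (?w l) (s l))"
  proof (subst CK_family_iff[OF L])
    have eq: "emb A (c_smul A (?w l) (s l)) = cscale (?w l) (?e l)" if "l \<in> P" for l using sC that by simp
    have q: "(\<Sum>l\<in>paths_le L k v m. emb A (c_smul A (?w l) (s l)) * star (emb A (c_smul A (?w l) (s l))))
        = (\<Sum>l\<in>paths_le L k v m. ?e l * star (?e l))" for v m
      by (intro sum.cong refl) (use w1 in \<open>auto simp: paths_le_def eq mult.commute\<close>)
    show "ck_relations L k (\<lambda>l. emb A (c_smul A (?w l) (s l)))"
      using e unfolding ck_relations_def q by (simp add: sC w0 w1 w1' w2)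
  qed (use sC in auto)
  from universal_property[OF univ L(1) A(1) this] show ?thesis .
qed

section \<open>The boundary path representation\<close>

lemma c_sum_ell2: "c_sum ell2_cstar f F = sum f F"
  by (simp add: c_sum_def ell2_cstar_def sum.eq_fold comp_def)

lemma Rep_ell2_sum: "Rep_ell2 (\<Sum>i\<in>F. f i) x = (\<Sum>i\<in>F. Rep_ell2 (f i) x)"
  by (induction F rule: infinite_finite_induct) (auto simp: zero_ell2.rep_eq plus_ell2.rep_eq)

context kgraph
begin

text \<open>The path \<open>l\<close> acts on the basis vector of \<open>x\<close> by prepending \<open>l\<close> to \<open>x\<close>.\<close>

definition shift_map :: "'p \<Rightarrow> 'p set \<Rightarrow> 'p set option" where
  "shift_map l y = (if boundary_path (rng l) y \<and> l \<in> y then Some (shift l y) else None)"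

definition prepend_map :: "'p \<Rightarrow> 'p set \<Rightarrow> 'p set option" where
  "prepend_map l x = (if boundary_path (src l) x then Some (prepend l x) else None)"

text \<open>The two are inverse partial bijections, which by \<open>pop_in_ell2_ops\<close> makes
  their operators adjoint to each other.\<close>

lemma shift_prepend_map:
  assumes "locally_convex L k" "l \<in> P"
  shows "shift_map l y = Some x \<longleftrightarrow> prepend_map l x = Some y"
  using bp_prepend[OF assms] bp_shift[of "rng l" y l] shift_prepend[OF assms(2)] prepend_shift[of "rng l" y l]
  by (auto simp: shift_map_def prepend_map_def)

lemma shift_map_vertex:
  "v \<in> vertices L \<Longrightarrow> shift_map v y = (if boundary_path v y then Some y else None)"
  using shift_vertex[of v y] bp_vertex[of v y] by (auto simp: shift_map_def)

lemma prepend_map_vertex: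
  assumes "v \<in> vertices L"
  shows "prepend_map v = shift_map v"
proof
  fix x
  show "prepend_map v x = shift_map v x"
    using assms shift_vertex[of v x] bp_vertex[of v x] prepend_shift[of v x v]
    by (auto simp: shift_map_vertex prepend_map_def)
qed

lemma shift_map_comp:
  assumes "l \<in> P" "m \<in> P" "src l = rng m"
  shows "shift_map (l \<odot> m) y = (case shift_map l y of None \<Rightarrow> None | Some x \<Rightarrow> shift_map m x)"
proof (cases "boundary_path (rng l) y")
  case True
  have "l \<odot> m \<in> y \<longleftrightarrow> l \<in> y \<and> m \<in> shift l y"
    using assms bp_initial[OF True, of "l \<odot> m" l] initial_comp[OF assms] by (auto simp: shift_def)
  moreover have "boundary_path (rng m) (shift l y)" if "l \<in> y"
    using bp_shift[OF True that] assms(3) by simp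
  ultimately show ?thesis
    using True rng_of_comp[OF assms] shift_comp[OF assms] by (auto simp: shift_map_def)
qed (use rng_of_comp[OF assms] in \<open>simp add: shift_map_def\<close>)

lemma boundary_path_representation:
  assumes lc: "locally_convex L k" and rf: "row_finite L k"
  shows "CK_family L k ell2_cstar (\<lambda>l. pop (shift_map l))"
proof -
  let ?t = "\<lambda>l. pop (shift_map l)"
  note inv = shift_prepend_map[OF lc]
  have pS: "partial_inj (shift_map l)" if "l \<in> P" for l
    using inv[OF that] unfolding partial_inj_def by (metis option.inject)
  have pP: "partial_inj (prepend_map l)" if "l \<in> P" for l
    using inv[OF that] unfolding partial_inj_def by (metis option.inject)
  have mem: "?t l \<in> ell2_ops" and adj: "ell2_adj (?t l) = pop (prepend_map l)" if "l \<in> P" for l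
    by (rule pop_in_ell2_ops[OF inv[OF that]])+
  \<comment> \<open>That is, \<open>?t l\<close> times its adjoint is multiplication by the
    indicator of the boundary paths through l.\<close>
  have q: "Rep_ell2 ((?t l o\<^sub>L ell2_adj (?t l)) f) y = (if boundary_path (rng l) y \<and> l \<in> y then Rep_ell2 f y else 0)"
    if "l \<in> P" for l f y
    using that bp_shift[of "rng l" y l] prepend_shift[of "rng l" y l]
    by (simp add: adj Rep_pop pS pP partial_comp_def shift_map_def prepend_map_def)
  have vert: "Rep_ell2 (?t v f) y = (if boundary_path v y then Rep_ell2 f y else 0)" if "v \<in> vertices L" for v f y
    using that by (simp add: Rep_pop pS partial_comp_def shift_map_vertex)
  have "ell2_adj (?t v) = ?t v \<and> ?t v o\<^sub>L ?t v = ?t v" if "v \<in> vertices L" for v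
    using that by (auto simp: adj prepend_map_vertex vert intro!: ell2_op_eqI)
  moreover have "?t v o\<^sub>L ?t w = 0" if vw: "v \<in> vertices L" "w \<in> vertices L" "v \<noteq> w" for v w
  proof (rule ell2_op_eqI)
    fix f y
    have "\<not> (boundary_path v y \<and> boundary_path w y)"
      using bp_vertex(1)[of v y] bp_rng[of w y v] vw by auto
    then show "Rep_ell2 ((?t v o\<^sub>L ?t w) f) y = Rep_ell2 (blinfun_apply 0 f) y"
      using vw by (auto simp: vert zero_ell2.rep_eq)
  qed
  moreover have "?t (l \<odot> m) = ?t l o\<^sub>L ?t m" if "l \<in> P" "m \<in> P" "src l = rng m" for l m
    using that by (intro ell2_op_eqI) (simp add: Rep_pop pS partial_comp_def shift_map_comp split: option.splits)
  moreover have "ell2_adj (?t l) o\<^sub>L ?t l = ?t (src l)" if l: "l \<in> P" for l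
  proof (rule ell2_op_eqI)
    fix f x
    have "Rep_ell2 ((ell2_adj (?t l) o\<^sub>L ?t l) f) x = (if boundary_path (src l) x then Rep_ell2 f x else 0)"
      using l bp_prepend[OF lc l] shift_prepend[OF l]
      by (simp add: adj Rep_pop pS pP partial_comp_def prepend_map_def shift_map_def)
    then show "Rep_ell2 ((ell2_adj (?t l) o\<^sub>L ?t l) f) x = Rep_ell2 (?t (src l) f) x"
      using vert[OF src_vertex[OF l]] by simp
  qed
  moreover have "?t v = (\<Sum>l\<in>paths_le L k v m. ?t l o\<^sub>L ell2_adj (?t l))" if v: "v \<in> vertices L" and m: "m \<in> Nk k" for v m
  proof (rule ell2_op_eqI)
    fix f y
    let ?E = "paths_le L k v m"
    have E: "l \<in> P" "rng l = v" if "l \<in> ?E" for l using that by (auto simp: paths_le_def)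
    have "Rep_ell2 ((\<Sum>l\<in>?E. ?t l o\<^sub>L ell2_adj (?t l)) f) y
        = (\<Sum>l\<in>?E. if boundary_path v y \<and> l \<in> y then Rep_ell2 f y else 0)"
      unfolding blinfun.sum_left Rep_ell2_sum using E by (intro sum.cong refl) (subst q, auto)
    also have "\<dots> = (if boundary_path v y then Rep_ell2 f y else 0)"
    proof (cases "boundary_path v y")
      case True
      \<comment> \<open>A boundary path passes through exactly one element of \<open>LE m\<close>,
        so exactly one indicator in the sum is 1 at y.\<close>
      obtain l where l: "l \<in> y" "l \<in> LE m" "\<And>l'. l' \<in> y \<Longrightarrow> l' \<in> LE m \<Longrightarrow> l' = l"
        using bp_LE_unique[OF True m] by blast
      have "{l' \<in> ?E. l' \<in> y} = {l}" using l bp_rng[OF True] unfolding paths_le_eq by blast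
      have "(\<Sum>l\<in>?E. if boundary_path v y \<and> l \<in> y then Rep_ell2 f y else 0) = (\<Sum>l'\<in>{l}. Rep_ell2 f y)"
        using True \<open>{l' \<in> ?E. l' \<in> y} = {l}\<close> finite_paths_le[OF rf v, of m]
        by (intro sum.mono_neutral_cong_right) auto
      then show ?thesis using True by simp
    qed simp
    finally show "Rep_ell2 (?t v f) y = Rep_ell2 ((\<Sum>l\<in>?E. ?t l o\<^sub>L ell2_adj (?t l)) f) y"
      using v by (simp add: vert)
  qed
  ultimately show ?thesis
    unfolding CK_family_def c_sum_ell2 by (simp add: ell2_cstar_def mem)
qed

lemma boundary_path_representation_nonzero:
  assumes "locally_convex L k" "v \<in> vertices L"
  shows "pop (shift_map v) \<noteq> 0"
proof -
  obtain x where x: "boundary_path v x" using exists_boundary_path[OF assms] by blast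
  have "partial_inj (shift_map v)"
    using assms unfolding partial_inj_def by (auto simp: shift_map_vertex split: if_splits)
  then have "Rep_ell2 (pop (shift_map v) (ell2_delta x)) x = 1"
    using assms x by (simp add: Rep_pop partial_comp_def shift_map_vertex ell2_delta.rep_eq)
  then show ?thesis by (auto simp: zero_ell2.rep_eq)
qed

end

text \<open>The boundary path representation sends s v to the projection onto the boundary paths
  with range v, and such paths exist.\<close>

lemma universal_vertex_nonzero:
  fixes L :: "'p kgraph"
  assumes univ: "universal_CK L k A s" and L: "is_kgraph L k" "row_finite L k" "locally_convex L k"
    and v: "v \<in> vertices L"
  shows "s v \<noteq> c_zero A"
proof
  assume sv: "s v = c_zero A"
  interpret kgraph L k by unfold_locales fact
  have A: "is_cstar A" "CK_family L k A s" using univ by (auto simp: universal_CK_def)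
  interpret cstar_record A using A by unfold_locales
  let ?B = "ell2_cstar :: ('p set ell2 \<Rightarrow>\<^sub>L 'p set ell2) cstar"
  obtain \<pi> where \<pi>: "star_hom A ?B \<pi>" "\<forall>l\<in>P. \<pi> (s l) = pop (shift_map l)"
    using universal_property[OF univ L(1) is_cstar_ell2 boundary_path_representation[OF L(3,2)]] by blast
  have "\<pi> (c_smul A 0 (c_zero A)) = c_smul ?B 0 (\<pi> (c_zero A))" using \<pi>(1) by (auto simp: star_hom_def)
  then have "\<pi> (c_zero A) = 0" by (simp add: smul_zero_left ell2_cstar_def ell2_smul_def)
  moreover have "\<pi> (s v) = pop (shift_map v)" using \<pi>(2) vertex_path[OF v] by blast
  ultimately show False using sv boundary_path_representation_nonzero[OF L(3) v] by simp
qed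

section \<open>The span of the generators and its matrix units\<close>

definition closed_ideal :: "'u::cstar_alg set \<Rightarrow> bool" where
  "closed_ideal I \<longleftrightarrow> 0 \<in> I \<and> (\<forall>x\<in>I. \<forall>y\<in>I. x + y \<in> I) \<and> (\<forall>a. \<forall>x\<in>I. cscale a x \<in> I) \<and>
     (\<forall>x\<in>I. \<forall>b. b * x \<in> I \<and> x * b \<in> I) \<and> closed I"

lemma
  assumes "closed_ideal I"
  shows ideal_zero: "0 \<in> I" and ideal_add: "x \<in> I \<Longrightarrow> y \<in> I \<Longrightarrow> x + y \<in> I"
    and ideal_cscale: "x \<in> I \<Longrightarrow> cscale a x \<in> I"
    and ideal_mult_left: "x \<in> I \<Longrightarrow> b * x \<in> I" and ideal_mult_right: "x \<in> I \<Longrightarrow> x * b \<in> I"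
    and ideal_closed: "closed I"
  using assms by (auto simp: closed_ideal_def)

lemma ideal_minus: "closed_ideal I \<Longrightarrow> x \<in> I \<Longrightarrow> - x \<in> I"
  using ideal_cscale[of I x "-1"] by (simp add: cscale_minus_left)

lemma ideal_diff: "closed_ideal I \<Longrightarrow> x \<in> I \<Longrightarrow> y \<in> I \<Longrightarrow> x - y \<in> I"
  using ideal_add[of I x "- y"] ideal_minus[of I y] by simp

lemma ideal_sum: "closed_ideal I \<Longrightarrow> (\<And>i. i \<in> F \<Longrightarrow> f i \<in> I) \<Longrightarrow> sum f F \<in> I"
  by (induction F rule: infinite_finite_induct) (auto simp: ideal_zero ideal_add)

text \<open>In the quotient by J the image of p is a nonzero idempotent and so has norm at least 1.
  Without the quotient: if r = norm (p + x) < 1, the powers of p + x tend to 0 while differing from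
  p by elements of J, and J is closed.\<close>

lemma one_le_norm_idempotent_plus_ideal:
  fixes p :: "'u::cstar_alg"
  assumes J: "closed_ideal J" and p: "p * p = p" "p \<notin> J" and x: "x \<in> J"
  shows "1 \<le> norm (p + x)"
proof (rule ccontr)
  assume "\<not> 1 \<le> norm (p + x)"
  define r where "r = norm (p + x)"
  have r: "0 \<le> r" "r < 1" using \<open>\<not> 1 \<le> norm (p + x)\<close> by (auto simp: r_def)
  have "\<exists>y\<in>J. norm (p - y) \<le> r ^ Suc n" for n
  proof (induction n)
    case 0
    show ?case using ideal_minus[OF J x] by (intro bexI[of _ "- x"]) (auto simp: r_def)
  next
    case (Suc n)
    then obtain y where y: "y \<in> J" "norm (p - y) \<le> r ^ Suc n" by blast
    \<comment> \<open>Forced by p - y' = (p + x) * (p - y), which gains one more factor r.\<close>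
    define y' where "y' = p * y - x * p + x * y"
    have "y' \<in> J"
      unfolding y'_def by (intro ideal_add[OF J] ideal_diff[OF J] ideal_mult_left[OF J] ideal_mult_right[OF J] x y)
    have "p - y' = (p + x) * (p - y)" by (simp add: y'_def algebra_simps p)
    then have "norm (p - y') \<le> r * r ^ Suc n"
      using norm_mult_ineq[of "p + x" "p - y"] mult_left_mono[OF y(2) r(1)] by (simp add: r_def)
    then show ?case using \<open>y' \<in> J\<close> by auto
  qed
  then obtain Y where Y: "\<And>n. Y n \<in> J" "\<And>n. norm (p - Y n) \<le> r ^ Suc n" by metis
  have "(\<lambda>n. r ^ Suc n) \<longlonglongrightarrow> 0" using r by (intro LIMSEQ_Suc LIMSEQ_realpow_zero)
  then have "(\<lambda>n. p - Y n) \<longlonglongrightarrow> 0"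
    by (rule Lim_null_comparison[rotated]) (intro always_eventually allI Y(2))
  then have "(\<lambda>n. p - (p - Y n)) \<longlonglongrightarrow> p - 0" by (intro tendsto_intros)
  then have "Y \<longlonglongrightarrow> p" by simp
  then have "p \<in> J" using closed_sequentially[OF ideal_closed[OF J], of Y p] Y(1) by blast
  then show False using p by simp
qed

section \<open>Calculus with a Cuntz-Krieger family\<close>

locale ck_family = kgraph L k for L :: "'p kgraph" and k :: nat +
  fixes s :: "'p \<Rightarrow> 'u::cstar_alg"
  assumes row_finite: "row_finite L k" and ck: "ck_relations L k s"
begin

lemma ck_rules:
  "\<forall>v\<in>vertices L. star (s v) = s v \<and> s v * s v = s v"
  "\<forall>v\<in>vertices L. \<forall>w\<in>vertices L. v \<noteq> w \<longrightarrow> s v * s w = 0"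
  "\<forall>l\<in>P. \<forall>m\<in>P. src l = rng m \<longrightarrow> s (l \<odot> m) = s l * s m"
  "\<forall>l\<in>P. star (s l) * s l = s (src l)"
  "\<forall>v\<in>vertices L. \<forall>m\<in>Nk k. s v = (\<Sum>l\<in>paths_le L k v m. s l * star (s l))"
  using ck unfolding ck_relations_def by - ((elim conjE, assumption)+)

lemma star_s_vertex [simp]: "v \<in> vertices L \<Longrightarrow> star (s v) = s v"
  and s_vertex_idem [simp]: "v \<in> vertices L \<Longrightarrow> s v * s v = s v"
  and s_vertex_orth: "v \<in> vertices L \<Longrightarrow> w \<in> vertices L \<Longrightarrow> v \<noteq> w \<Longrightarrow> s v * s w = 0"
  and s_comp: "l \<in> P \<Longrightarrow> m \<in> P \<Longrightarrow> src l = rng m \<Longrightarrow> s (l \<odot> m) = s l * s m"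
  and star_s_s: "l \<in> P \<Longrightarrow> star (s l) * s l = s (src l)"
  and s_vertex_sum: "v \<in> vertices L \<Longrightarrow> n \<in> Nk k \<Longrightarrow> s v = (\<Sum>l\<in>paths_le L k v n. s l * star (s l))"
  by (rule ck_rules(1)[rule_format, THEN conjunct1] ck_rules(1)[rule_format, THEN conjunct2]
      ck_rules(2-)[rule_format]; assumption)+

lemma s_src [simp]: "l \<in> P \<Longrightarrow> s l * s (src l) = s l"
  using s_comp[of l "src l"] by simp

lemma s_rng [simp]: "l \<in> P \<Longrightarrow> s (rng l) * s l = s l"
  using s_comp[of "rng l" l] by simp

lemma s_src_star [simp]: "l \<in> P \<Longrightarrow> s (src l) * star (s l) = star (s l)"
proof -
  assume l: "l \<in> P"
  then have "star (s l * s (src l)) = star (s l)" by simp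
  then show ?thesis using l by (subst (asm) star_mult) simp
qed

lemma s_rng_star [simp]: "l \<in> P \<Longrightarrow> star (s l) * s (rng l) = star (s l)"
proof -
  assume l: "l \<in> P"
  then have "star (s (rng l) * s l) = star (s l)" by simp
  then show ?thesis using l by (subst (asm) star_mult) simp
qed

lemma norm_s_le: "l \<in> P \<Longrightarrow> norm (s l) \<le> 1"
proof -
  assume l: "l \<in> P"
  have "(norm (s l))\<^sup>2 = norm (s (src l))" using norm_star_mult[of "s l"] star_s_s[OF l] by simp
  also have "\<dots> \<le> 1" using l by (intro norm_projection_le_one) auto
  finally show ?thesis by (simp add: power_le_one_iff)
qed

text \<open>For a common range, the range projections of a level sum to the vertex projection and
  are thus orthogonal by \<open>projections_sum_orthogonal\<close>; for different ranges the vertex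
  projections already are.\<close>

lemma star_s_s_LE:
  assumes n: "n \<in> Nk k" and l: "l \<in> LE n" and m: "m \<in> LE n"
  shows "star (s l) * s m = (if l = m then s (src l) else 0)"
proof (cases "l = m")
  case False
  have P: "l \<in> P" "m \<in> P" using l m by (auto intro: LE_path)
  show ?thesis
  proof (cases "rng l = rng m")
    case True
    let ?q = "\<lambda>l. s l * star (s l)" and ?S = "paths_le L k (rng l) n"
    have "?q l * ?q m = 0"
    proof (rule projections_sum_orthogonal[where S = ?S and P = "s (rng l)"])
      show "finite ?S" using finite_paths_le[OF row_finite] P by simp
      show "s (rng l) = (\<Sum>l\<in>?S. ?q l)" using s_vertex_sum n P by simp
      show "m \<in> ?S" "l \<in> ?S" using l m True by (simp_all add: paths_le_eq)
      show "m \<noteq> l" using False by simp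
      fix i assume "i \<in> ?S"
      then have i: "i \<in> P" "rng l = rng i" by (auto simp: paths_le_def)
      have "?q i * ?q i = s i * (star (s i) * s i) * star (s i)" by (simp add: mult.assoc)
      then have "?q i * ?q i = ?q i" using i by (simp add: star_s_s)
      moreover have "s (rng l) * ?q i = ?q i" using s_rng[OF i(1)] i(2) by (simp flip: mult.assoc)
      ultimately show "star (?q i) = ?q i \<and> ?q i * ?q i = ?q i \<and> s (rng l) * ?q i = ?q i"
        by (simp add: star_mult)
    qed
    then have "star (s l) * (?q l * ?q m) * s m = 0" by simp
    \<comment> \<open>Regrouping shows that multiplying the vanishing product by star (s l) and s m
      from outside recovers star (s l) * s m.\<close>
    moreover have "star (s l) * (?q l * ?q m) * s m = (star (s l) * s l) * (star (s l) * s m) * (star (s m) * s m)"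
      by (simp add: mult.assoc)
    moreover have "\<dots> = star (s l) * s m"
      using P by (simp add: star_s_s mult.assoc) (simp flip: mult.assoc)
    ultimately show ?thesis using False by simp
  next
    case rng: False
    have "star (s l) * s m = (star (s l) * s (rng l)) * (s (rng m) * s m)" using P by simp
    also have "\<dots> = star (s l) * (s (rng l) * s (rng m)) * s m" by (simp only: mult.assoc)
    also have "\<dots> = 0" using s_vertex_orth[of "rng l" "rng m"] rng P by simp
    finally show ?thesis using False by simp
  qed
qed (use l LE_path star_s_s in auto)

lemma s_refine:
  assumes "l \<in> P" "n \<in> Nk k"
  shows "s l = (\<Sum>b\<in>paths_le L k (src l) n. s (l \<odot> b) * star (s b))"
proof -
  have "s l = s l * s (src l)" using assms by simp
  also have "\<dots> = (\<Sum>b\<in>paths_le L k (src l) n. s l * (s b * star (s b)))"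
    using s_vertex_sum[of "src l" n] assms by (simp add: sum_distrib_left)
  also have "\<dots> = (\<Sum>b\<in>paths_le L k (src l) n. s (l \<odot> b) * star (s b))"
    using assms by (intro sum.cong refl) (simp add: paths_le_def s_comp mult.assoc)
  finally show ?thesis .
qed

lemma s_star_refine:
  assumes "l \<in> P" "m \<in> P" "src l = src m" "n \<in> Nk k"
  shows "s l * star (s m) = (\<Sum>b\<in>paths_le L k (src m) n. s (l \<odot> b) * star (s (m \<odot> b)))"
proof -
  have "s l * star (s m) = (\<Sum>b\<in>paths_le L k (src m) n. s (l \<odot> b) * star (s b) * star (s m))"
    using s_refine[OF assms(1,4)] assms(3) by (simp add: sum_distrib_right)
  also have "\<dots> = (\<Sum>b\<in>paths_le L k (src m) n. s (l \<odot> b) * star (s (m \<odot> b)))"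
    using assms by (intro sum.cong refl) (simp add: paths_le_def s_comp star_mult mult.assoc)
  finally show ?thesis .
qed

abbreviation e :: "'p \<times> 'p \<Rightarrow> 'u" where "e t \<equiv> s (fst t) * star (s (snd t))"

definition pairs :: "('p \<times> 'p) set" where
  "pairs = {(l, m). l \<in> P \<and> m \<in> P \<and> src l = src m}"

text \<open>The complex linear span, encoded as the real span of all complex multiples of the
  generators.\<close>

definition Sp :: "('p \<times> 'p) set \<Rightarrow> 'u set" where
  "Sp X = span {cscale z (e t) | z t. t \<in> X}"

lemma Sp_zero [simp]: "0 \<in> Sp X" by (simp add: Sp_def span_zero)
lemma Sp_add: "x \<in> Sp X \<Longrightarrow> y \<in> Sp X \<Longrightarrow> x + y \<in> Sp X" by (simp add: Sp_def span_add)
lemma Sp_gen: "t \<in> X \<Longrightarrow> cscale z (e t) \<in> Sp X" unfolding Sp_def by (rule span_base) blast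
lemma Sp_sum: "(\<And>i. i \<in> F \<Longrightarrow> f i \<in> Sp X) \<Longrightarrow> sum f F \<in> Sp X" by (simp add: Sp_def span_sum)

lemma Sp_induct [consumes 1, case_names zero add]:
  assumes "x \<in> Sp X" "Q 0" "\<And>z t x. t \<in> X \<Longrightarrow> Q x \<Longrightarrow> Q (cscale z (e t) + x)"
  shows "Q x"
  using assms(1) unfolding Sp_def
proof (induction rule: span_induct_alt)
  case (step c x y)
  then obtain z t where "x = cscale z (e t)" "t \<in> X" by blast
  then show ?case using assms(3)[OF \<open>t \<in> X\<close> step(2), of "complex_of_real c * z"] by (simp add: scaleR_cscale)
qed (rule assms(2))

lemma Sp_cscale: "x \<in> Sp X \<Longrightarrow> cscale a x \<in> Sp X"
  by (induction rule: Sp_induct) (auto simp: cscale_add_right Sp_add Sp_gen)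

lemma Sp_explicit:
  assumes "x \<in> Sp X"
  obtains F c where "finite F" "F \<subseteq> X" "x = (\<Sum>t\<in>F. cscale (c t) (e t))"
proof -
  have "\<exists>F c. finite F \<and> F \<subseteq> X \<and> x = (\<Sum>t\<in>F. cscale (c t) (e t))"
    using assms
  proof (induction rule: Sp_induct)
    case zero
    show ?case by (intro exI[of _ "{}"]) simp
  next
    case (add z t x)
    then obtain F c where F: "finite F" "F \<subseteq> X" "x = (\<Sum>t\<in>F. cscale (c t) (e t))" by blast
    \<comment> \<open>The pair t may already occur in F, in which case the two coefficients add
      up.\<close>
    define c' where "c' t' = (if t' = t then z else 0) + (if t' \<in> F then c t' else 0)" for t'
    have "(\<Sum>t'\<in>insert t F. cscale (c' t') (e t')) =
        (\<Sum>t'\<in>insert t F. if t' = t then cscale z (e t) else 0) + (\<Sum>t'\<in>insert t F. if t' \<in> F then cscale (c t') (e t') else 0)"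
      by (simp add: c'_def cscale_add_left flip: sum.distrib) (intro sum.cong refl, auto)
    also have "(\<Sum>t'\<in>insert t F. if t' = t then cscale z (e t) else 0) = cscale z (e t)"
      using F(1) by (simp add: sum.delta)
    also have "(\<Sum>t'\<in>insert t F. if t' \<in> F then cscale (c t') (e t') else 0) = x"
      unfolding F(3) using F(1) by (intro sum.mono_neutral_cong_right) auto
    finally show ?case using F add.hyps by (intro exI[of _ "insert t F"] exI[of _ c']) auto
  qed
  then show ?thesis using that by blast
qed

lemma Sp_sum_gen: "F \<subseteq> X \<Longrightarrow> (\<Sum>t\<in>F. cscale (c t) (e t)) \<in> Sp X"
  by (intro Sp_sum Sp_gen) auto

lemma pairs_sym: "(l, m) \<in> pairs \<Longrightarrow> (m, l) \<in> pairs" by (simp add: pairs_def)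

lemma Sp_pairs_star: "x \<in> Sp pairs \<Longrightarrow> star x \<in> Sp pairs"
proof (induction rule: Sp_induct)
  case (add z t x)
  have "cscale (cnj z) (e (snd t, fst t)) \<in> Sp pairs"
    using add.hyps pairs_sym[of "fst t" "snd t"] by (intro Sp_gen) simp
  then show ?case using add by (simp add: star_add star_mult Sp_add)
qed simp

lemma s_mult_e:
  assumes "l \<in> P" "t \<in> pairs"
  shows "s l * e t \<in> Sp pairs"
proof -
  obtain a b where t: "t = (a, b)" "a \<in> P" "b \<in> P" "src a = src b" using assms(2) by (auto simp: pairs_def)
  show ?thesis
  proof (cases "src l = rng a")
    case True
    then have "s l * e t = cscale 1 (e (l \<odot> a, b))" using t assms by (simp add: s_comp mult.assoc)
    moreover have "(l \<odot> a, b) \<in> pairs" using t assms True by (simp add: pairs_def)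
    ultimately show ?thesis using Sp_gen by metis
  next
    case False
    have "s l * s a = (s l * s (src l)) * (s (rng a) * s a)" using t assms by simp
    also have "\<dots> = s l * (s (src l) * s (rng a)) * s a" by (simp only: mult.assoc)
    also have "\<dots> = 0" using s_vertex_orth[of "src l" "rng a"] False t assms by simp
    finally have "s l * e t = 0" using t by (simp flip: mult.assoc)
    then show ?thesis by simp
  qed
qed

lemma Sp_pairs_s_mult:
  assumes "l \<in> P" "x \<in> Sp pairs"
  shows "s l * x \<in> Sp pairs"
  using assms(2)
  by (induction rule: Sp_induct) (auto simp: distrib_left Sp_add Sp_cscale s_mult_e[OF assms(1)])

lemma Sp_pairs_mult_star:
  assumes "l \<in> P" "x \<in> Sp pairs"
  shows "x * star (s l) \<in> Sp pairs"
  using Sp_pairs_star[OF Sp_pairs_s_mult[OF assms(1) Sp_pairs_star[OF assms(2)]]] by (simp add: star_mult)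

text \<open>Refine s m and s a to the common level max (d(m), d(a)); there
  \<open>star_s_s_LE\<close> leaves only the terms with m b = a c, and each of them is some e (b,
  c).\<close>

lemma star_s_s_Sp:
  assumes m: "m \<in> P" and a: "a \<in> P"
  shows "star (s m) * s a \<in> Sp pairs"
proof -
  define N where "N i = max (deg m i) (deg a i)" for i
  have Nk: "N \<in> Nk k" "(\<lambda>i. N i - deg m i) \<in> Nk k" "(\<lambda>i. N i - deg a i) \<in> Nk k"
    using m a by (auto simp: N_def Nk_def deg_outside)
  let ?B = "paths_le L k (src m) (\<lambda>i. N i - deg m i)" and ?C = "paths_le L k (src a) (\<lambda>i. N i - deg a i)"
  have "star (s m) * s a = star (\<Sum>b\<in>?B. s (m \<odot> b) * star (s b)) * (\<Sum>c\<in>?C. s (a \<odot> c) * star (s c))"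
    using s_refine[OF m Nk(2)] s_refine[OF a Nk(3)] by simp
  also have "\<dots> = (\<Sum>b\<in>?B. \<Sum>c\<in>?C. s b * (star (s (m \<odot> b)) * s (a \<odot> c)) * star (s c))"
    by (simp add: star_sum star_mult sum_product mult.assoc)
  also have "\<dots> \<in> Sp pairs"
  proof (intro Sp_sum)
    fix b c assume b: "b \<in> ?B" and c: "c \<in> ?C"
    then have bc: "b \<in> P" "c \<in> P" "src m = rng b" "src a = rng c" by (auto simp: paths_le_def)
    have "m \<odot> b \<in> LE N" using b m by (intro LE_comp) (auto simp: paths_le_eq N_def)
    moreover have "a \<odot> c \<in> LE N" using c a by (intro LE_comp) (auto simp: paths_le_eq N_def)
    ultimately have "star (s (m \<odot> b)) * s (a \<odot> c) = (if m \<odot> b = a \<odot> c then s (src (m \<odot> b)) else 0)"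
      by (rule star_s_s_LE[OF Nk(1)])
    moreover have "src (m \<odot> b) = src b" using bc m by simp
    moreover have "src b = src c" if "m \<odot> b = a \<odot> c"
      using that src_of_comp[OF m bc(1,3)] src_of_comp[OF a bc(2,4)] by simp
    moreover have "cscale 1 (e (b, c)) \<in> Sp pairs" if "src b = src c"
      using that bc by (intro Sp_gen) (simp add: pairs_def)
    moreover have "s b * s (src c) = s b" if "src b = src c" using s_src[OF bc(1)] that by simp
    ultimately show "s b * (star (s (m \<odot> b)) * s (a \<odot> c)) * star (s c) \<in> Sp pairs"
      using bc by (cases "m \<odot> b = a \<odot> c") simp_all
  qed
  finally show ?thesis .
qed

lemma Sp_pairs_mult:
  assumes "y \<in> Sp pairs" "x \<in> Sp pairs"
  shows "y * x \<in> Sp pairs"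
  using assms(1)
proof (induction rule: Sp_induct)
  case (add z t y)
  obtain l m where t: "t = (l, m)" "l \<in> P" "m \<in> P" using add.hyps by (auto simp: pairs_def)
  have "star (s m) * x \<in> Sp pairs"
    using assms(2)
  proof (induction rule: Sp_induct)
    case (add z' t' x)
    obtain a b where t': "t' = (a, b)" "a \<in> P" "b \<in> P" using add.hyps by (auto simp: pairs_def)
    have "(star (s m) * s a) * star (s b) \<in> Sp pairs" by (intro Sp_pairs_mult_star star_s_s_Sp t t')
    then show ?case using add t' by (simp add: distrib_left Sp_add Sp_cscale mult.assoc)
  qed simp
  then have "s l * (star (s m) * x) \<in> Sp pairs" by (rule Sp_pairs_s_mult[OF t(2)])
  then show ?case using add t by (simp add: distrib_right Sp_add Sp_cscale mult.assoc)
qed simp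

lemma star_subalgebra_closure_Sp: "star_subalgebra (closure (Sp pairs))"
  by (rule star_subalgebra_closure[where Q = UNIV])
    (auto simp: Sp_add Sp_pairs_mult Sp_pairs_star Sp_cscale)

lemma s_in_Sp: "l \<in> P \<Longrightarrow> s l \<in> Sp pairs"
  using Sp_gen[of "(l, src l)" pairs 1] by (simp add: pairs_def)

lemma e_in_ideal:
  assumes "closed_ideal I" "l \<in> P" "s (src l) \<in> I"
  shows "e (l, m) \<in> I"
proof -
  have "e (l, m) = s l * s (src l) * star (s m)" using assms(2) by simp
  then show ?thesis using assms by (metis ideal_mult_left ideal_mult_right)
qed

end

text \<open>For m, m' in G with a common source the e (m, m') multiply like matrix units, so they
  span a finite-dimensional algebra; the condition on sources keeps the diagonal units out of
  J.\<close>

locale ck_matrix_units = ck_family L k s for L :: "'p kgraph" and k :: nat and s :: "'p \<Rightarrow> 'u::cstar_alg" +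
  fixes n :: "nat \<Rightarrow> nat" and G :: "'p set" and J :: "'u set"
  assumes n: "n \<in> Nk k" and G: "finite G" "G \<subseteq> LE n" and J: "closed_ideal J" and GJ: "\<And>m. m \<in> G \<Longrightarrow> s (src m) \<notin> J"
begin

definition Y :: "('p \<times> 'p) set" where "Y = {(m, m'). m \<in> G \<and> m' \<in> G \<and> src m = src m'}"

lemma finite_Y: "finite Y"
  by (rule finite_subset[of _ "G \<times> G"]) (use G in \<open>auto simp: Y_def\<close>)

lemma G_path: "m \<in> G \<Longrightarrow> m \<in> P" using G LE_path by blast

lemma G_orth: "m \<in> G \<Longrightarrow> m' \<in> G \<Longrightarrow> star (s m) * s m' = (if m = m' then s (src m) else 0)"
  using star_s_s_LE[OF n] G by blast

lemma Sp_Y_mult: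
  assumes "y \<in> Sp Y" "x \<in> Sp Y"
  shows "y * x \<in> Sp Y"
  using assms(1)
proof (induction rule: Sp_induct)
  case (add z t y)
  obtain l m where t: "t = (l, m)" "l \<in> G" "m \<in> G" "src l = src m" using add.hyps by (auto simp: Y_def)
  have "e t * x \<in> Sp Y"
    using assms(2)
  proof (induction rule: Sp_induct)
    case (add z' t' x)
    obtain a b where t': "t' = (a, b)" "a \<in> G" "b \<in> G" "src a = src b" using add.hyps by (auto simp: Y_def)
    have "e t * e t' = s l * (star (s m) * s a) * star (s b)" using t t' by (simp add: mult.assoc)
    also have "\<dots> = (if m = a then s l * s (src l) * star (s b) else 0)" using t t' by (simp add: G_orth)
    also have "\<dots> = (if m = a then cscale 1 (e (l, b)) else 0)"
      using t s_src[OF G_path[of l]] by (cases "m = a") auto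
    also have "\<dots> \<in> Sp Y"
    proof (cases "m = a")
      case True
      then have "(l, b) \<in> Y" using t t' by (simp add: Y_def)
      then show ?thesis using True Sp_gen[of "(l, b)" Y 1] by simp
    qed simp
    finally show ?case using add by (simp add: distrib_left Sp_add Sp_cscale)
  qed simp
  then show ?case using add by (simp add: distrib_right Sp_add Sp_cscale)
qed simp

text \<open>Multiplying by star (s m) and s m' isolates the coefficient of (m, m') as a multiple of
  a vertex projection outside J, whose distance to J is at least 1. So every coefficient is at most
  norm (d + x), and there are at most card Y of them.\<close>

lemma norm_Sp_Y_le:
  assumes "d \<in> Sp Y" "x \<in> J"
  shows "norm d \<le> real (card Y) * norm (d + x)"
proof -
  obtain F c where F: "finite F" "F \<subseteq> Y" and d: "d = (\<Sum>t\<in>F. cscale (c t) (e t))"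
    using Sp_explicit[OF assms(1)] .
  have coeff: "cmod (c t) \<le> norm (d + x)" if t: "t \<in> F" for t
  proof (cases "c t = 0")
    case False
    obtain m m' where mm: "t = (m, m')" "m \<in> G" "m' \<in> G" "src m = src m'" using t F by (auto simp: Y_def)
    have mP: "m \<in> P" "m' \<in> P" using mm G_path by auto
    have "star (s m) * d * s m' = (\<Sum>t'\<in>F. cscale (c t') (star (s m) * e t' * s m'))"
      by (simp add: d sum_distrib_left sum_distrib_right)
    also have "\<dots> = (\<Sum>t'\<in>F. if t' = t then cscale (c t) (s (src m)) else 0)"
    proof (intro sum.cong refl)
      fix t' assume "t' \<in> F"
      then obtain a b where t': "t' = (a, b)" "a \<in> G" "b \<in> G" "src a = src b" using F by (auto simp: Y_def)
      have "star (s m) * e t' * s m' = (star (s m) * s a) * (star (s b) * s m')" using t' by (simp add: mult.assoc)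
      also have "\<dots> = (if t' = t then s (src m) else 0)" using t' mm mP by (auto simp: G_orth)
      finally show "cscale (c t') (star (s m) * e t' * s m') = (if t' = t then cscale (c t) (s (src m)) else 0)" by simp
    qed
    also have "\<dots> = cscale (c t) (s (src m))" using F(1) t by simp
    finally have 1: "star (s m) * d * s m' = cscale (c t) (s (src m))" .
    define x' where "x' = cscale (1 / c t) (star (s m) * x * s m')"
    have x': "x' \<in> J"
      unfolding x'_def by (intro ideal_cscale[OF J] ideal_mult_left[OF J] ideal_mult_right[OF J] assms)
    have "1 \<le> norm (s (src m) + x')"
      by (rule one_le_norm_idempotent_plus_ideal[OF J _ _ x']) (use mm mP GJ in auto)
    then have "cmod (c t) \<le> cmod (c t) * norm (s (src m) + x')" by (simp add: mult_le_cancel_left1)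
    also have "\<dots> = norm (star (s m) * d * s m' + star (s m) * x * s m')"
      unfolding 1 norm_cscale[symmetric] using False by (simp add: x'_def cscale_add_right)
    also have "\<dots> = norm (star (s m) * ((d + x) * s m'))" by (simp add: algebra_simps)
    also have "\<dots> \<le> norm (star (s m)) * (norm (d + x) * norm (s m'))"
      by (intro order.trans[OF norm_mult_ineq] mult_left_mono norm_mult_ineq) simp
    also have "\<dots> \<le> 1 * (norm (d + x) * 1)" using mP by (intro mult_mono norm_s_le) (auto simp: norm_s_le)
    finally show ?thesis by simp
  qed simp
  have ne: "norm (e t) \<le> 1" if "t \<in> F" for t
  proof -
    have "fst t \<in> P" "snd t \<in> P" using that F G_path by (auto simp: Y_def)
    then have "norm (s (fst t)) * norm (star (s (snd t))) \<le> 1 * 1" by (intro mult_mono) (auto simp: norm_s_le)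
    then show ?thesis using norm_mult_ineq[of "s (fst t)" "star (s (snd t))"] by simp
  qed
  have "norm d \<le> (\<Sum>t\<in>F. norm (cscale (c t) (e t)))" unfolding d by (rule norm_sum)
  also have "\<dots> \<le> (\<Sum>t\<in>F. norm (d + x) * 1)"
    unfolding norm_cscale by (intro sum_mono mult_mono coeff ne) auto
  also have "\<dots> = real (card F) * norm (d + x)" by simp
  also have "\<dots> \<le> real (card Y) * norm (d + x)"
    using card_mono[OF finite_Y F(2)] by (intro mult_right_mono) auto
  finally show ?thesis .
qed

text \<open>The finite-dimensional estimate, applied to high powers of \<open>star c * c\<close>, gives the constant 1 by the C*-identity.\<close>

lemma norm_le_norm_plus_ideal:
  assumes c: "star c * c \<in> Sp Y" and x: "x \<in> J"
  shows "norm c \<le> norm (c + x)"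
proof (rule ccontr)
  assume "\<not> norm c \<le> norm (c + x)"
  \<comment> \<open>\<open>\<rho>\<close> is the norm of star c * c and r bounds the norm of star c
    * (c + x); the assumption makes r smaller.\<close>
  define \<rho> r where "\<rho> = norm c * norm c" and "r = norm c * norm (c + x)"
  have "norm c > 0" using \<open>\<not> norm c \<le> norm (c + x)\<close> norm_ge_zero[of "c + x"] by linarith
  then have \<rho>r: "r < \<rho>" "0 \<le> r" using \<open>\<not> norm c \<le> norm (c + x)\<close> by (auto simp: \<rho>_def r_def)
  \<comment> \<open>Repeated squaring of star c * c. As b stays self-adjoint, its norm is squared
    exactly, while b + y is only bounded by the square.\<close>
  have "\<exists>b y. b \<in> Sp Y \<and> star b = b \<and> norm b = \<rho> ^ (2 ^ j) \<and> y \<in> J \<and> norm (b + y) \<le> r ^ (2 ^ j)" for j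
  proof (induction j)
    case 0
    have "norm (star c * c + star c * x) \<le> r"
      using norm_mult_ineq[of "star c" "c + x"] by (simp add: distrib_left r_def)
    then show ?case using c ideal_mult_left[OF J x, of "star c"]
      by (intro exI[of _ "star c * c"] exI[of _ "star c * x"])
        (auto simp: star_mult norm_star_mult \<rho>_def power2_eq_square)
  next
    case (Suc j)
    then obtain b y where b: "b \<in> Sp Y" "star b = b" "norm b = \<rho> ^ (2 ^ j)" and y: "y \<in> J" "norm (b + y) \<le> r ^ (2 ^ j)"
      by blast
    define y' where "y' = b * y + y * b + y * y"
    have "y' \<in> J" unfolding y'_def by (intro ideal_add[OF J] ideal_mult_left[OF J] ideal_mult_right[OF J] y)
    have "b * b + y' = (b + y) * (b + y)" by (simp add: y'_def algebra_simps)
    then have "norm (b * b + y') \<le> norm (b + y) * norm (b + y)" by (simp add: norm_mult_ineq)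
    also have "\<dots> \<le> r ^ (2 ^ j) * r ^ (2 ^ j)" using y \<rho>r by (intro mult_mono) auto
    also have "\<dots> = r ^ (2 ^ Suc j)" by (simp flip: power_add mult_2)
    finally have 1: "norm (b * b + y') \<le> r ^ (2 ^ Suc j)" .
    have "norm (b * b) = \<rho> ^ (2 ^ j * 2)"
      unfolding norm_square_self_adjoint[OF b(2)] b(3) by (simp only: power_mult)
    then have "norm (b * b) = \<rho> ^ (2 ^ Suc j)" by (simp add: mult.commute)
    then show ?case using 1 \<open>y' \<in> J\<close> Sp_Y_mult[OF b(1,1)] b(2)
      by (intro exI[of _ "b * b"] exI[of _ y']) (auto simp: star_mult)
  qed
  then have le: "\<rho> ^ (2 ^ j) \<le> real (card Y) * r ^ (2 ^ j)" for j
    using norm_Sp_Y_le by (metis (no_types, lifting) mult_left_mono of_nat_0_le_iff order_trans)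
  have r: "r > 0"
  proof (rule ccontr)
    assume "\<not> r > 0"
    then have "r = 0" using \<rho>r by simp
    then show False using le[of 0] \<rho>r by simp
  qed
  have bound: "(\<rho> / r) ^ (2 ^ j) \<le> real (card Y)" for j
    using le[of j] r by (simp add: power_divide divide_le_eq)
  obtain N where N: "real (card Y) < (\<rho> / r) ^ N"
    using real_arch_pow[of "\<rho> / r" "real (card Y)"] \<rho>r r by auto
  have "(\<rho> / r) ^ N \<le> (\<rho> / r) ^ (2 ^ N)"
    by (rule power_increasing) (use \<rho>r r less_exp[of N] in auto)
  then show False using bound[of N] N by linarith
qed

end

section \<open>Gauge-invariant ideals\<close>

context ck_family
begin

text \<open>The degree in Z^k: the gauge map at z multiplies \<open>e t\<close> by z^(dg t).\<close>

definition dg :: "'p \<times> 'p \<Rightarrow> nat \<Rightarrow> int" where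
  "dg t i = int (deg (fst t) i) - int (deg (snd t) i)"

lemma dg_outside: "t \<in> pairs \<Longrightarrow> k \<le> i \<Longrightarrow> dg t i = 0"
  by (auto simp: dg_def pairs_def deg_outside)

text \<open>A homogeneous element becomes a rectangular matrix after refining all its terms to a common level.\<close>

lemma homogeneous_to_matrix:
  assumes F: "finite F" "F \<subseteq> pairs" "\<And>t. t \<in> F \<Longrightarrow> dg t = \<delta>" and "F \<noteq> {}"
  obtains n n' where "n \<in> Nk k" "n' \<in> Nk k"
    "\<And>t. t \<in> F \<Longrightarrow> e t \<in> Sp {(l, m). l \<in> LE n' \<and> m \<in> LE n \<and> src l = src m}"
proof -
  define n where "n i = (\<Sum>t\<in>F. deg (snd t) i)" for i
  \<comment> \<open>For t in F the argument of \<open>nat\<close> equals n - d(snd t) + d(fst t),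
    and n bounds d(snd t), so nothing is cut off.\<close>
  define n' where "n' i = nat (int (n i) + \<delta> i)" for i
  have le: "deg (snd t) i \<le> n i" if "t \<in> F" for t i
    unfolding n_def using that F(1) by (intro member_le_sum) auto
  have n': "int (n' i) = int (n i) + dg t i" if "t \<in> F" for t i
  proof -
    have "0 \<le> int (n i) + dg t i" using le[OF that, of i] by (simp add: dg_def)
    then show ?thesis using F(3)[OF that] by (simp add: n'_def)
  qed
  have "snd t \<in> P" if "t \<in> F" for t using that F(2) by (auto simp: pairs_def)
  then have nNk: "n \<in> Nk k" by (auto simp: Nk_def n_def deg_outside intro!: sum.neutral)
  obtain t0 where t0: "t0 \<in> F" using \<open>F \<noteq> {}\<close> by blast
  have "n' i = 0" if "k \<le> i" for i
    using n'[OF t0, of i] dg_outside[of t0 i] t0 F(2) that nNk by (auto simp: Nk_def)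
  then have n'Nk: "n' \<in> Nk k" by (simp add: Nk_def)
  show ?thesis
  proof (rule that[OF nNk n'Nk])
    fix t assume t: "t \<in> F"
    then obtain l m where lm: "t = (l, m)" "l \<in> P" "m \<in> P" "src l = src m" using F(2) by (auto simp: pairs_def)
    \<comment> \<open>The same degree is missing on both sides, so a single family of paths b
      extends l and m together.\<close>
    have diff: "n' i - deg l i = n i - deg m i" for i
      using n'[OF t, of i] le[OF t, of i] by (simp add: dg_def lm)
    have le': "deg l i \<le> n' i" for i
      using n'[OF t, of i] le[OF t, of i] by (simp add: dg_def lm)
    have d: "(\<lambda>i. n i - deg m i) \<in> Nk k" using nNk by (auto simp: Nk_def)
    have "(\<Sum>b\<in>paths_le L k (src m) (\<lambda>i. n i - deg m i). cscale 1 (e (l \<odot> b, m \<odot> b)))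
        \<in> Sp {(l, m). l \<in> LE n' \<and> m \<in> LE n \<and> src l = src m}"
    proof (intro Sp_sum Sp_gen)
      fix b assume "b \<in> paths_le L k (src m) (\<lambda>i. n i - deg m i)"
      then have b: "b \<in> LE (\<lambda>i. n i - deg m i)" "src m = rng b" by (simp_all add: paths_le_eq)
      have "l \<odot> b \<in> LE n'" using b lm le' by (intro LE_comp) (simp_all add: diff)
      moreover have "m \<odot> b \<in> LE n" using b lm le[OF t] by (intro LE_comp) simp_all
      moreover have "src (l \<odot> b) = src (m \<odot> b)"
        using src_of_comp[OF lm(2) LE_path[OF b(1)]] src_of_comp[OF lm(3) LE_path[OF b(1)] b(2)] lm(4) b(2) by simp
      ultimately show "(l \<odot> b, m \<odot> b) \<in> {(l, m). l \<in> LE n' \<and> m \<in> LE n \<and> src l = src m}" by simp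
    qed
    then show "e t \<in> Sp {(l, m). l \<in> LE n' \<and> m \<in> LE n \<and> src l = src m}"
      using s_star_refine[OF lm(2-4) d] lm(1) by simp
  qed
qed

text \<open>The matrix units whose source projection is in J form the part y of c, which lies in I.
  The remaining part c - y keeps its norm modulo J, and c - x differs from it by an element of
  J.\<close>

lemma homogeneous_estimate:
  assumes J: "closed_ideal J" and I: "closed_ideal I" "I \<subseteq> J" "\<And>v. v \<in> vertices L \<Longrightarrow> s v \<in> J \<Longrightarrow> s v \<in> I"
    and F: "finite F" "F \<subseteq> pairs" "\<And>t. t \<in> F \<Longrightarrow> dg t = \<delta>" and c: "c = (\<Sum>t\<in>F. cscale (a t) (e t))"
    and x: "x \<in> J"
  shows "\<exists>y\<in>I. norm (c - y) \<le> norm (c - x)"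
proof (cases "F = {}")
  case True
  then show ?thesis using c ideal_zero[OF I(1)] by (intro bexI[of _ 0]) auto
next
  case False
  obtain n n' where nn: "n \<in> Nk k" "n' \<in> Nk k"
    and m: "\<And>t. t \<in> F \<Longrightarrow> e t \<in> Sp {(l, m). l \<in> LE n' \<and> m \<in> LE n \<and> src l = src m}"
    using homogeneous_to_matrix[OF F False] by blast
  let ?X = "{(l, m). l \<in> LE n' \<and> m \<in> LE n \<and> src l = src m}"
  have "c \<in> Sp ?X" unfolding c by (intro Sp_sum Sp_cscale m)
  then obtain F' a' where F': "finite F'" "F' \<subseteq> ?X" and c': "c = (\<Sum>t\<in>F'. cscale (a' t) (e t))"
    by (rule Sp_explicit)
  have F'P: "fst t \<in> P" "snd t \<in> P" "src (fst t) = src (snd t)" if "t \<in> F'" for t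
    using that F'(2) LE_path by auto
  define F2 where "F2 = {t \<in> F'. s (src (fst t)) \<notin> J}"
  define y where "y = (\<Sum>t\<in>F' - F2. cscale (a' t) (e t))"
  define d where "d = (\<Sum>t\<in>F2. cscale (a' t) (e t))"
  have cyd: "c = d + y"
    unfolding c' y_def d_def using sum.subset_diff[of F2 F' "\<lambda>t. cscale (a' t) (e t)"] F'(1)
    by (auto simp: F2_def add.commute)
  have y: "y \<in> I"
    unfolding y_def
  proof (intro ideal_sum[OF I(1)] ideal_cscale[OF I(1)])
    fix t assume t: "t \<in> F' - F2"
    then have "s (src (fst t)) \<in> I" using I(3) F'P(1) by (auto simp: F2_def)
    then show "e t \<in> I" using e_in_ideal[OF I(1), of "fst t" "snd t"] F'P(1) t by auto
  qed
  \<comment> \<open>The rectangular matrix d is treated through star d * d, a square matrix indexed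
    by the right-hand paths.\<close>
  interpret ck_matrix_units L k s n "snd ` F2" J
  proof unfold_locales
    show "finite (snd ` F2)" using F'(1) by (simp add: F2_def)
    show "snd ` F2 \<subseteq> LE n" using F'(2) by (auto simp: F2_def)
    show "s (src m) \<notin> J" if "m \<in> snd ` F2" for m using that F'P(3) by (auto simp: F2_def)
  qed (use nn J in auto)
  have dSp: "d \<in> Sp F2" unfolding d_def by (rule Sp_sum_gen) simp
  have "star u * w \<in> Sp Y" if "u \<in> Sp F2" "w \<in> Sp F2" for u w
    using that(1)
  proof (induction rule: Sp_induct)
    case (add z t u)
    have t: "fst t \<in> LE n'" "snd t \<in> LE n" "src (fst t) = src (snd t)" "t \<in> F2"
      using add.hyps F'(2) by (auto simp: F2_def)
    have "star (e t) * w \<in> Sp Y"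
      using that(2)
    proof (induction rule: Sp_induct)
      case (add z' t' w)
      have t': "fst t' \<in> LE n'" "snd t' \<in> LE n" "src (fst t') = src (snd t')" "t' \<in> F2"
        using add.hyps F'(2) by (auto simp: F2_def)
      have sP: "snd t \<in> P" using t(2) LE_path by blast
      have "star (e t) * e t' = s (snd t) * (star (s (fst t)) * s (fst t')) * star (s (snd t'))"
        by (simp add: star_mult mult.assoc)
      also have "\<dots> = (if fst t = fst t' then cscale 1 (e (snd t, snd t')) else 0)"
        using star_s_s_LE[OF nn(2) t(1) t'(1)] t(3) s_src[OF sP] by (cases "fst t = fst t'") auto
      also have "\<dots> \<in> Sp Y"
      proof (cases "fst t = fst t'")
        case True
        then have "(snd t, snd t') \<in> Y" using t t' by (simp add: Y_def)
        then show ?thesis using True Sp_gen[of "(snd t, snd t')" Y 1] by simp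
      qed simp
      finally show ?case using add by (simp add: distrib_left Sp_add Sp_cscale)
    qed simp
    then show ?case using add by (simp add: star_add distrib_right Sp_add Sp_cscale)
  qed simp
  then have "star d * d \<in> Sp Y" using dSp by blast
  moreover have "y - x \<in> J" using y I(2) x by (intro ideal_diff[OF J]) auto
  ultimately have "norm d \<le> norm (d + (y - x))" by (rule norm_le_norm_plus_ideal)
  then show ?thesis using y by (intro bexI[of _ y]) (simp_all add: cyd algebra_simps)
qed

end

section \<open>Discrete Fejer and Fourier kernels\<close>

definition unit_torus :: "nat \<Rightarrow> (nat \<Rightarrow> complex) \<Rightarrow> bool" where
  "unit_torus k z \<longleftrightarrow> (\<forall>i<k. cmod (z i) = 1)"

definition torus_point :: "nat \<Rightarrow> (nat \<Rightarrow> nat) \<Rightarrow> nat \<Rightarrow> complex" where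
  "torus_point N j i = cis (2 * pi * real (j i) / real N)"

lemma unit_torus_point [simp]: "unit_torus k (torus_point N j)"
  by (simp add: unit_torus_def torus_point_def)

abbreviation grid :: "nat \<Rightarrow> nat \<Rightarrow> (nat \<Rightarrow> nat) set" where
  "grid k N \<equiv> PiE {..<k} (\<lambda>_. {..<N})"

text \<open>The Cesaro weight, the positive part of 1 - |d|/M.\<close>

definition fejer_coeff :: "nat \<Rightarrow> int \<Rightarrow> real" where
  "fejer_coeff M d = (if \<bar>d\<bar> < int M then (real M - real_of_int \<bar>d\<bar>) / real M else 0)"

text \<open>The Fejer kernel of order M sampled at the q-th N-th root of unity, divided by N so that
  the samples sum to 1 when 0 < M \<le> N.\<close>

definition fejer :: "nat \<Rightarrow> nat \<Rightarrow> nat \<Rightarrow> complex" where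
  "fejer M N q = (\<Sum>p<M. \<Sum>p'<M. cis (2 * pi * real q * real_of_int (int p - int p') / real N)) / of_nat (M * N)"

lemma fejer_coeff_bounds: "0 \<le> fejer_coeff M d" "fejer_coeff M d \<le> 1"
  by (auto simp: fejer_coeff_def divide_simps)

text \<open>If |d| < M, exactly M - |d| of the pairs satisfy p' = p + d; otherwise none
  does.\<close>

lemma fejer_coeff_eq_count:
  assumes "M > 0"
  shows "(\<Sum>p<M. \<Sum>p'<M. if int p - int p' + d = 0 then 1 else 0) / real M = fejer_coeff M d"
proof -
  have inner: "(\<Sum>p'<M. if int p - int p' + d = 0 then 1 else 0) = (if 0 \<le> int p + d \<and> int p + d < int M then 1 else (0::real))" for p
  proof (cases "0 \<le> int p + d")
    case True
    have "(\<Sum>p'<M. if int p - int p' + d = 0 then 1 else (0::real)) = (\<Sum>p'<M. if p' = nat (int p + d) then 1 else 0)"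
      using True by (intro sum.cong refl) auto
    then show ?thesis using True by (simp add: nat_less_iff)
  qed (auto intro!: sum.neutral)
  have "(\<Sum>p<M. \<Sum>p'<M. if int p - int p' + d = 0 then 1 else 0) = real (card {p \<in> {..<M}. 0 \<le> int p + d \<and> int p + d < int M})"
    unfolding inner by (simp add: sum.inter_filter[symmetric])
  also have "{p \<in> {..<M}. 0 \<le> int p + d \<and> int p + d < int M} = {nat (- d)..<nat (min (int M) (int M - d))}"
    by auto
  also have "real (card \<dots>) / real M = fejer_coeff M d"
    using assms by (auto simp: fejer_coeff_def min_def nat_diff_distrib of_nat_diff)
  finally show ?thesis by simp
qed

text \<open>The bound on N rules out aliasing: |p - p' + d| < N, so sampling at N-th roots of unity
  gives the value of the integral.\<close>

lemma fejer_transform: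
  assumes "M > 0" "int M + \<bar>d\<bar> \<le> int N"
  shows "(\<Sum>q<N. fejer M N q * cis (2 * pi * real q * real_of_int d / real N)) = complex_of_real (fejer_coeff M d)"
proof -
  have N: "N > 0" using assms by auto
  have "(\<Sum>q<N. fejer M N q * cis (2 * pi * real q * real_of_int d / real N)) =
      (\<Sum>q<N. \<Sum>p<M. \<Sum>p'<M. cis (2 * pi * real q * real_of_int (int p - int p' + d) / real N)) / of_nat (M * N)"
  proof -
    have "cis (2 * pi * real q * real_of_int (int p - int p') / real N) * cis (2 * pi * real q * real_of_int d / real N)
        = cis (2 * pi * real q * real_of_int (int p - int p' + d) / real N)" for q p p'
      unfolding cis_mult by (rule arg_cong[where f = cis]) (simp add: algebra_simps flip: add_divide_distrib)
    then show ?thesis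
      unfolding fejer_def sum_divide_distrib[symmetric] times_divide_eq_left sum_distrib_right by simp
  qed
  also have "(\<Sum>q<N. \<Sum>p<M. \<Sum>p'<M. cis (2 * pi * real q * real_of_int (int p - int p' + d) / real N)) =
      (\<Sum>p<M. \<Sum>q<N. \<Sum>p'<M. cis (2 * pi * real q * real_of_int (int p - int p' + d) / real N))"
    by (rule sum.swap)
  also have "\<dots> = (\<Sum>p<M. \<Sum>p'<M. \<Sum>q<N. cis (2 * pi * real q * real_of_int (int p - int p' + d) / real N))"
    by (intro sum.cong refl sum.swap)
  also have "\<dots> = (\<Sum>p<M. \<Sum>p'<M. if int p - int p' + d = 0 then of_nat N else 0)"
    by (intro sum.cong refl sum_cis_roots_of_unity) (use assms in auto)
  also have "\<dots> = of_nat N * complex_of_real (\<Sum>p<M. \<Sum>p'<M. if int p - int p' + d = 0 then 1 else 0)"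
    by (simp add: sum_distrib_left if_distrib cong: if_cong)
  also have "\<dots> / of_nat (M * N) = complex_of_real ((\<Sum>p<M. \<Sum>p'<M. if int p - int p' + d = 0 then 1 else 0) / real M)"
    using N assms(1) by (simp add: field_simps)
  finally show ?thesis unfolding fejer_coeff_eq_count[OF assms(1)] .
qed

lemma fejer_nonneg: "complex_of_real (cmod (fejer M N q)) = fejer M N q"
proof -
  define S where "S = (\<Sum>p<M. cis (2 * pi * real q * real p / real N))"
  have "(\<Sum>p<M. \<Sum>p'<M. cis (2 * pi * real q * real_of_int (int p - int p') / real N)) = S * cnj S"
    unfolding S_def by (simp add: sum_product cis_cnj cis_mult algebra_simps diff_divide_distrib)
  also have "\<dots> = complex_of_real ((cmod S)\<^sup>2)" by (rule complex_norm_square[symmetric])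
  finally have "fejer M N q = complex_of_real ((cmod S)\<^sup>2 / real (M * N))" by (simp add: fejer_def)
  moreover have "0 \<le> (cmod S)\<^sup>2 / real (M * N)" by simp
  ultimately show ?thesis by (simp only: norm_of_real abs_of_nonneg)
qed

text \<open>The kernel is nonnegative, so its total mass is its transform at 0.\<close>

lemma sum_cmod_fejer:
  assumes "M > 0" "M \<le> N"
  shows "(\<Sum>q<N. cmod (fejer M N q)) = 1"
proof -
  have "complex_of_real (\<Sum>q<N. cmod (fejer M N q)) = (\<Sum>q<N. fejer M N q)" by (simp add: fejer_nonneg)
  also have "\<dots> = 1" using fejer_transform[of M 0 N] assms by (simp add: fejer_coeff_def)
  finally show ?thesis by (simp only: of_real_eq_1_iff)
qed

lemma fejer_coeff_tendsto: "(\<lambda>M. fejer_coeff M d) \<longlonglongrightarrow> 1"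
proof -
  have "(\<lambda>M. 1 - real_of_int \<bar>d\<bar> / real M) \<longlonglongrightarrow> 1 - 0"
    by (intro tendsto_intros lim_const_over_n)
  moreover have "\<forall>\<^sub>F M in sequentially. 1 - real_of_int \<bar>d\<bar> / real M = fejer_coeff M d"
    unfolding eventually_sequentially
    by (intro exI[of _ "nat \<bar>d\<bar> + 1"]) (auto simp: fejer_coeff_def diff_divide_distrib)
  ultimately show ?thesis by (auto intro: Lim_transform_eventually)
qed

text \<open>Isolates the coefficient of index n; its total mass 1 makes the projection onto a
  homogeneous component contractive.\<close>

definition fourier :: "nat \<Rightarrow> int \<Rightarrow> nat \<Rightarrow> complex" where
  "fourier N n q = cis (- (2 * pi * real q * real_of_int n / real N)) / of_nat N"

lemma fourier_transform:
  assumes "\<bar>d - n\<bar> < int N"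
  shows "(\<Sum>q<N. fourier N n q * cis (2 * pi * real q * real_of_int d / real N)) = (if d = n then 1 else 0)"
proof -
  have "(\<Sum>q<N. fourier N n q * cis (2 * pi * real q * real_of_int d / real N)) =
      (\<Sum>q<N. cis (2 * pi * real q * real_of_int (d - n) / real N)) / of_nat N"
    by (simp add: fourier_def sum_divide_distrib cis_mult algebra_simps diff_divide_distrib)
  then show ?thesis unfolding sum_cis_roots_of_unity[OF assms] using assms by auto
qed

lemma sum_cmod_fourier: "N > 0 \<Longrightarrow> (\<Sum>q<N. cmod (fourier N n q)) = 1"
  by (simp add: fourier_def norm_divide)

section \<open>Averages over the gauge action\<close>

locale ck_gauge = ck_family L k s for L :: "'p kgraph" and k :: nat and s :: "'p \<Rightarrow> 'u::cstar_alg" +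
  fixes \<gamma> :: "(nat \<Rightarrow> complex) \<Rightarrow> 'u \<Rightarrow> 'u"
  assumes gauge_hom: "unit_torus k z \<Longrightarrow> star_homomorphism (\<gamma> z)"
    and gauge_s: "unit_torus k z \<Longrightarrow> l \<in> P \<Longrightarrow> \<gamma> z (s l) = cscale (zpow k z (deg l)) (s l)"
begin

lemma gauge_e:
  assumes "t \<in> pairs"
  shows "\<gamma> (torus_point N j) (e t) = cscale (\<Prod>i<k. cis (2 * pi * real (j i) * real_of_int (dg t i) / real N)) (e t)"
proof -
  have t: "fst t \<in> P" "snd t \<in> P" using assms by (auto simp: pairs_def)
  let ?z = "torus_point N j"
  note h = gauge_hom[OF unit_torus_point, of N j]
  have zp: "?z i ^ n = cis (2 * pi * real (j i) * real n / real N)" for i n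
    unfolding torus_point_def Complex.DeMoivre by (rule arg_cong[where f = cis]) simp
  have "zpow k ?z (deg (fst t)) * cnj (zpow k ?z (deg (snd t)))
      = (\<Prod>i<k. cis (2 * pi * real (j i) * real_of_int (dg t i) / real N))"
    unfolding zpow_def zp cnj_prod prod.distrib[symmetric]
    by (intro prod.cong refl) (simp add: cis_cnj cis_mult dg_def algebra_simps diff_divide_distrib)
  then show ?thesis
    using t by (simp add: hom_mult[OF h] hom_star[OF h] gauge_s mult.commute)
qed

text \<open>Discrete form of the integral of u(z) \<gamma>_z(a) over the torus, with a weight u that
  is a product of one-variable kernels.\<close>

definition Avg :: "nat \<Rightarrow> (nat \<Rightarrow> nat \<Rightarrow> complex) \<Rightarrow> 'u \<Rightarrow> 'u" where
  "Avg N u a = (\<Sum>j\<in>grid k N. cscale (\<Prod>i<k. u i (j i)) (\<gamma> (torus_point N j) a))"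

lemma Avg_diff: "Avg N u (a - b) = Avg N u a - Avg N u b"
  by (simp add: Avg_def hom_diff[OF gauge_hom] cscale_diff_right sum_subtractf)

lemma Avg_zero: "Avg N u 0 = 0"
  by (simp add: Avg_def hom_zero[OF gauge_hom])

lemma Avg_add: "Avg N u (a + b) = Avg N u a + Avg N u b"
  by (simp add: Avg_def hom_add[OF gauge_hom] cscale_add_right sum.distrib)

lemma Avg_cscale: "Avg N u (cscale z a) = cscale z (Avg N u a)"
  by (simp add: Avg_def hom_cscale[OF gauge_hom] cscale_sum_right mult.commute)

text \<open>Gauge maps are contractive by \<open>norm_hom_le\<close>, and the sum of the absolute
  weights over the grid factors into one-variable sums.\<close>

lemma norm_Avg_le:
  assumes "\<And>i. i < k \<Longrightarrow> (\<Sum>q<N. cmod (u i q)) \<le> 1"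
  shows "norm (Avg N u a) \<le> norm a"
proof -
  have "norm (Avg N u a) \<le> (\<Sum>j\<in>grid k N. norm (cscale (\<Prod>i<k. u i (j i)) (\<gamma> (torus_point N j) a)))"
    unfolding Avg_def by (rule norm_sum)
  also have "\<dots> \<le> (\<Sum>j\<in>grid k N. (\<Prod>i<k. cmod (u i (j i))) * norm a)"
    unfolding norm_cscale prod_norm[symmetric]
    by (intro sum_mono mult_left_mono norm_hom_le gauge_hom prod_nonneg) auto
  also have "\<dots> = (\<Prod>i<k. \<Sum>q<N. cmod (u i q)) * norm a"
    by (simp add: prod_sum_PiE flip: sum_distrib_right)
  also have "\<dots> \<le> 1 * norm a"
    by (intro mult_right_mono prod_le_1) (auto simp: assms sum_nonneg)
  finally show ?thesis by simp
qed

text \<open>\<open>e t\<close> is an eigenvector of every gauge map, so averaging multiplies it by a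
  product of one-variable transforms.\<close>

lemma Avg_e:
  assumes "t \<in> pairs"
  shows "Avg N u (e t) = cscale (\<Prod>i<k. \<Sum>q<N. u i q * cis (2 * pi * real q * real_of_int (dg t i) / real N)) (e t)"
proof -
  have "(\<Prod>i<k. \<Sum>q<N. u i q * cis (2 * pi * real q * real_of_int (dg t i) / real N))
      = (\<Sum>j\<in>grid k N. \<Prod>i<k. u i (j i) * cis (2 * pi * real (j i) * real_of_int (dg t i) / real N))"
    by (rule prod_sum_PiE) auto
  then show ?thesis by (simp add: Avg_def gauge_e[OF assms] cscale_sum_left prod.distrib)
qed

lemma Avg_sum_e:
  assumes "finite F" "F \<subseteq> pairs"
    and "\<And>t i. t \<in> F \<Longrightarrow> i < k \<Longrightarrow> (\<Sum>q<N. u i q * cis (2 * pi * real q * real_of_int (dg t i) / real N)) = \<psi> i (dg t i)"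
  shows "Avg N u (\<Sum>t\<in>F. cscale (c t) (e t)) = (\<Sum>t\<in>F. cscale ((\<Prod>i<k. \<psi> i (dg t i)) * c t) (e t))"
  using assms
proof (induction F rule: finite_induct)
  case (insert t F)
  have "Avg N u (cscale (c t) (e t)) = cscale ((\<Prod>i<k. \<psi> i (dg t i)) * c t) (e t)"
    using insert.prems by (simp add: Avg_cscale Avg_e mult.commute)
  then show ?case using insert by (simp add: Avg_add)
qed (simp add: Avg_zero)

lemma Avg_in_ideal:
  assumes J: "closed_ideal J" and inv: "\<And>z. unit_torus k z \<Longrightarrow> \<gamma> z ` J \<subseteq> J" and "a \<in> J"
  shows "Avg N u a \<in> J"
  unfolding Avg_def by (intro ideal_sum[OF J] ideal_cscale[OF J]) (use inv[OF unit_torus_point] \<open>a \<in> J\<close> in blast)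

text \<open>Fejer means approximate \<open>a \<in> J\<close>, and only boundedly many Fourier coefficients contribute to them;
  each coefficient is approximated inside \<open>I\<close> by \<open>homogeneous_estimate\<close>. Integrals over the torus are replaced by finite
  averages over roots of unity.\<close>

theorem gauge_invariant_ideal_le:
  assumes J: "closed_ideal J" "\<And>z. unit_torus k z \<Longrightarrow> \<gamma> z ` J \<subseteq> J" "J \<subseteq> closure (Sp pairs)"
    and I: "closed_ideal I" "I \<subseteq> J" "\<And>v. v \<in> vertices L \<Longrightarrow> s v \<in> J \<Longrightarrow> s v \<in> I"
  shows "J \<subseteq> I"
proof
  fix a assume aJ: "a \<in> J"
  have approx: "\<exists>F c. finite F \<and> F \<subseteq> pairs \<and> norm (a - (\<Sum>t\<in>F. cscale (c t) (e t))) < d" if "d > 0" for d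
  proof -
    have "a \<in> closure (Sp pairs)" using aJ J(3) by blast
    then obtain x where "x \<in> Sp pairs" "dist x a < d" using \<open>d > 0\<close> by (auto simp: closure_approachable)
    moreover obtain F c where "finite F" "F \<subseteq> pairs" "x = (\<Sum>t\<in>F. cscale (c t) (e t))"
      using Sp_explicit[OF \<open>x \<in> Sp pairs\<close>] .
    ultimately show ?thesis by (auto simp: dist_norm norm_minus_commute)
  qed
  have "\<exists>y\<in>I. dist y a < \<epsilon>" if "\<epsilon> > 0" for \<epsilon>
  proof -
    \<comment> \<open>Five errors of size at most \<eta> arise, and the final inequality is
      strict.\<close>
    define \<eta> where "\<eta> = \<epsilon> / 6"
    have \<eta>: "\<eta> > 0" using \<open>\<epsilon> > 0\<close> by (simp add: \<eta>_def)
    obtain F c where F: "finite F" "F \<subseteq> pairs" "norm (a - (\<Sum>t\<in>F. cscale (c t) (e t))) < \<eta>"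
      using approx[OF \<eta>] by blast
    define fc where "fc M t = (\<Prod>i<k. complex_of_real (fejer_coeff M (dg t i)))" for M t
    let ?c = "\<Sum>t\<in>F. cscale (c t) (e t)"
    have "(\<lambda>M. \<Sum>t\<in>F. cscale (fc M t * c t) (e t)) \<longlonglongrightarrow> (\<Sum>t\<in>F. cscale ((\<Prod>i<k. complex_of_real 1) * c t) (e t))"
      unfolding fc_def by (intro tendsto_intros fejer_coeff_tendsto)
    then have "\<forall>\<^sub>F M in sequentially. norm ((\<Sum>t\<in>F. cscale (fc M t * c t) (e t)) - ?c) < \<eta>"
      using \<eta> by (simp add: tendsto_iff dist_norm)
    then have "\<forall>\<^sub>F M in sequentially. M > 0 \<and> norm ((\<Sum>t\<in>F. cscale (fc M t * c t) (e t)) - ?c) < \<eta>"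
      by (intro eventually_conj eventually_gt_at_top)
    then obtain M where M: "M > 0" "norm ((\<Sum>t\<in>F. cscale (fc M t * c t) (e t)) - ?c) < \<eta>"
      by (metis (no_types, lifting) eventually_sequentially order_refl)
    define Box :: "(nat \<Rightarrow> int) set" where "Box = PiE {..<k} (\<lambda>_. {- int M<..<int M})"
    have finBox: "finite Box" unfolding Box_def by (intro finite_PiE) auto
    \<comment> \<open>Error budget: each of the card Box homogeneous components contributes at most
      \<eta> / K. The added 1 makes K positive outright and at least 1.\<close>
    define K where "K = real (card Box) + 1"
    have K: "K > 0" by (simp add: K_def add_nonneg_pos)
    \<comment> \<open>A second, finer approximation, chosen only after M is fixed; the number of
      components kept depends on M but not on F'.\<close>
    obtain F' c' where F': "finite F'" "F' \<subseteq> pairs" "norm (a - (\<Sum>t\<in>F'. cscale (c' t) (e t))) < \<eta> / K"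
      using approx[of "\<eta> / K"] \<eta> K by auto
    let ?c' = "\<Sum>t\<in>F'. cscale (c' t) (e t)"
    define S where "S = (\<Sum>t\<in>F \<union> F'. \<Sum>i<k. nat \<bar>dg t i\<bar>)"
    \<comment> \<open>Large enough that neither the Fejer nor the Fourier transform suffers aliasing
      on the degrees in F and F'.\<close>
    define N where "N = 2 * M + S"
    have N: "int (2 * M) + \<bar>dg t i\<bar> \<le> int N" if "t \<in> F \<union> F'" "i < k" for t i
    proof -
      have "nat \<bar>dg t i\<bar> \<le> (\<Sum>i<k. nat \<bar>dg t i\<bar>)" using that by (intro member_le_sum) auto
      also have "\<dots> \<le> S"
        unfolding S_def using that F(1) F'(1) by (intro member_le_sum) auto
      finally show ?thesis by (simp add: N_def nat_le_iff)
    qed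
    have N0: "N > 0" "M \<le> N" using M(1) by (auto simp: N_def)
    define A where "A = Avg N (\<lambda>_. fejer M N)"
    have Anorm: "norm (A x) \<le> norm x" for x
      unfolding A_def by (rule norm_Avg_le) (simp add: sum_cmod_fejer M(1) N0)
    have Adiff: "A (x - y) = A x - A y" for x y unfolding A_def by (rule Avg_diff)
    have AF: "A (\<Sum>t\<in>F. cscale (c t) (e t)) = (\<Sum>t\<in>F. cscale (fc M t * c t) (e t))"
      unfolding A_def fc_def
      by (rule Avg_sum_e[OF F(1,2)], rule fejer_transform[OF M(1)]) (use N in fastforce)
    have AF': "A ?c' = (\<Sum>t\<in>F'. cscale (fc M t * c' t) (e t))"
      unfolding A_def fc_def
      by (rule Avg_sum_e[OF F'(1,2)], rule fejer_transform[OF M(1)]) (use N in fastforce)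
    \<comment> \<open>The restriction turns degrees into extensional functions, as the elements of
      \<open>Box\<close> are; on pairs, \<open>dg\<close> vanishes beyond k.\<close>
    define dk where "dk t = restrict (dg t) {..<k}" for t
    define cn where "cn n = (\<Sum>t | t \<in> F' \<and> dk t = n. cscale (c' t) (e t))" for n
    define fn where "fn n = (\<Prod>i<k. complex_of_real (fejer_coeff M (n i)))" for n
    have fc_fn: "fc M t = fn (dk t)" for t unfolding fc_def fn_def dk_def by (intro prod.cong) auto
    have group: "A ?c' = (\<Sum>n\<in>Box. cscale (fn n) (cn n))"
    proof -
      let ?F = "{t \<in> F'. dk t \<in> Box}"
      have "fc M t = 0" if t: "t \<in> F' - ?F" for t
      proof -
        have "dk t \<notin> Box" using t by blast
        then obtain i where i: "i < k" "dg t i \<notin> {- int M<..<int M}"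
          unfolding Box_def dk_def restrict_PiE_iff by blast
        then have "fejer_coeff M (dg t i) = 0" by (auto simp: fejer_coeff_def)
        then show ?thesis unfolding fc_def using i(1) by (intro prod_zero) auto
      qed
      then have "A ?c' = (\<Sum>t\<in>?F. cscale (fc M t * c' t) (e t))"
        unfolding AF' using F'(1) by (intro sum.mono_neutral_right) auto
      also have "\<dots> = (\<Sum>n\<in>Box. \<Sum>t | t \<in> ?F \<and> dk t = n. cscale (fc M t * c' t) (e t))"
        using F'(1) finBox by (intro sum.group[symmetric]) auto
      also have "\<dots> = (\<Sum>n\<in>Box. cscale (fn n) (cn n))"
      proof (intro sum.cong refl)
        fix n assume "n \<in> Box"
        then have "{t. t \<in> ?F \<and> dk t = n} = {t. t \<in> F' \<and> dk t = n}" by auto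
        then show "(\<Sum>t | t \<in> ?F \<and> dk t = n. cscale (fc M t * c' t) (e t)) = cscale (fn n) (cn n)"
          by (auto simp: cn_def cscale_sum_right fc_fn intro!: sum.cong)
      qed
      finally show ?thesis .
    qed
    have "\<exists>y\<in>I. norm (cn n - y) \<le> \<eta> / K" if n: "n \<in> Box" for n
    proof -
      \<comment> \<open>\<open>?V\<close> projects onto the component of degree n: it sends
        \<open>?c'\<close> to \<open>cn n\<close> and, being an average of gauge maps, keeps a
        inside J. So \<open>cn n\<close> is close to J.\<close>
      let ?V = "Avg N (\<lambda>i. fourier N (n i))" and ?G = "{t. t \<in> F' \<and> dk t = n}"
      have "?V ?c' = (\<Sum>t\<in>F'. cscale ((\<Prod>i<k. if dg t i = n i then 1 else 0) * c' t) (e t))"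
      proof (rule Avg_sum_e[OF F'(1,2)], rule fourier_transform)
        fix t i assume "t \<in> F'" "i < k"
        moreover from this n have "\<bar>n i\<bar> < int M" by (auto simp: Box_def PiE_def Pi_def)
        ultimately show "\<bar>dg t i - n i\<bar> < int N" using N[of t i] by auto
      qed
      also have "\<dots> = (\<Sum>t\<in>?G. cscale (c' t) (e t))"
      proof (rule sum.mono_neutral_cong_right)
        show "\<forall>t\<in>F' - ?G. cscale ((\<Prod>i<k. if dg t i = n i then 1 else 0) * c' t) (e t) = 0"
        proof
          fix t assume "t \<in> F' - ?G"
          then have "dk t \<noteq> n" by blast
          then obtain i where i: "dk t i \<noteq> n i" by blast
          moreover have "dk t i = n i" if "\<not> i < k" for i using that n by (auto simp: dk_def Box_def PiE_def extensional_def)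
          ultimately have "i < k" by blast
          then have "(\<Prod>i<k. if dg t i = n i then 1 else 0) = (0::complex)"
            using i by (intro prod_zero) (auto simp: dk_def)
          then show "cscale ((\<Prod>i<k. if dg t i = n i then 1 else 0) * c' t) (e t) = 0"
            by (simp only: mult_zero_left cscale_zero_left)
        qed
        show "cscale ((\<Prod>i<k. if dg t i = n i then 1 else 0) * c' t) (e t) = cscale (c' t) (e t)" if "t \<in> ?G" for t
        proof -
          have "(\<Prod>i<k. if dg t i = n i then 1 else 0) = (1::complex)" using that by (intro prod.neutral) (auto simp: dk_def)
          then show ?thesis by simp
        qed
      qed (use F'(1) in auto)
      finally have V: "?V ?c' = cn n" by (simp add: cn_def)
      have "norm (?V (?c' - a)) \<le> norm (?c' - a)"
        by (rule norm_Avg_le) (simp add: sum_cmod_fourier N0)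
      then have 1: "norm (cn n - ?V a) \<le> \<eta> / K" using F'(3) V by (simp add: Avg_diff norm_minus_commute)
      have "?V a \<in> J" by (rule Avg_in_ideal[OF J(1,2) aJ])
      moreover have "dg t = (\<lambda>i. if i < k then n i else 0)" if "t \<in> ?G" for t
      proof
        fix i
        have "restrict (dg t) {..<k} i = n i" "t \<in> pairs" using that F'(2) by (auto simp: dk_def)
        then show "dg t i = (if i < k then n i else 0)" using dg_outside[of t i] by (cases "i < k") auto
      qed
      ultimately have "\<exists>y\<in>I. norm (cn n - y) \<le> norm (cn n - ?V a)"
        using F'(1,2) by (intro homogeneous_estimate[OF J(1) I, where F = ?G and a = c']) (auto simp: cn_def)
      then show ?thesis using 1 order_trans by blast
    qed
    then obtain y where y: "\<And>n. n \<in> Box \<Longrightarrow> y n \<in> I" "\<And>n. n \<in> Box \<Longrightarrow> norm (cn n - y n) \<le> \<eta> / K" by metis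
    define b where "b = (\<Sum>n\<in>Box. cscale (fn n) (y n))"
    have bI: "b \<in> I" unfolding b_def by (intro ideal_sum[OF I(1)] ideal_cscale[OF I(1)] y)
    have fn1: "cmod (fn n) \<le> 1" for n
      unfolding fn_def prod_norm[symmetric] by (intro prod_le_1) (auto simp: fejer_coeff_bounds)
    have "norm (A ?c' - b) \<le> (\<Sum>n\<in>Box. norm (cscale (fn n) (cn n - y n)))"
      unfolding group b_def by (simp add: norm_sum flip: sum_subtractf cscale_diff_right del: norm_cscale)
    also have "\<dots> \<le> (\<Sum>n\<in>Box. 1 * (\<eta> / K))"
      unfolding norm_cscale by (intro sum_mono mult_mono fn1 y) auto
    also have "\<dots> \<le> \<eta>" using \<eta> K by (simp add: K_def field_simps)
    finally have s1: "norm (A ?c' - b) \<le> \<eta>" .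
    have "\<eta> / K \<le> \<eta>" using \<eta> K by (simp add: K_def field_simps)
    then have s2: "norm (A a - A ?c') \<le> \<eta>" using Anorm[of "a - ?c'"] F'(3) by (simp add: Adiff)
    have s3: "norm (A a - A ?c) \<le> \<eta>" using Anorm[of "a - ?c"] F(3) by (simp add: Adiff)
    have s4: "norm (A ?c - ?c) \<le> \<eta>" using M(2) by (simp add: AF)
    have five: "norm (x - y - z + u + w) \<le> 5 * \<eta>"
      if "norm x \<le> \<eta>" "norm y \<le> \<eta>" "norm z \<le> \<eta>" "norm u \<le> \<eta>" "norm w \<le> \<eta>" for x y z u w :: 'u
      using norm_triangle_ineq4[of x y] norm_triangle_ineq4[of "x - y" z] norm_triangle_ineq[of "x - y - z" u]
        norm_triangle_ineq[of "x - y - z + u" w] that by linarith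
    have eq: "a - b = (a - ?c) - (A ?c - ?c) - (A a - A ?c) + (A a - A ?c') + (A ?c' - b)" by simp
    have "norm (a - b) \<le> 5 * \<eta>"
      unfolding eq by (rule five[OF less_imp_le[OF F(3)] s4 s3 s2 s1])
    also have "\<dots> < \<epsilon>" using \<open>\<epsilon> > 0\<close> by (simp add: \<eta>_def)
    finally show ?thesis using bI by (intro bexI[of _ b]) (simp_all add: dist_norm norm_minus_commute)
  qed
  then have "a \<in> closure I" by (simp add: closure_approachable)
  then show "a \<in> I" using ideal_closed[OF I(1)] by simp
qed

end

section \<open>Annihilators\<close>

definition ideal_span :: "'u::cstar_alg set \<Rightarrow> 'u set" where
  "ideal_span X = \<Inter>{K. closed_ideal K \<and> X \<subseteq> K}"

lemma closed_ideal_ideal_span: "closed_ideal (ideal_span X)"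
  unfolding ideal_span_def closed_ideal_def by (auto intro!: closed_Inter)

lemma ideal_span_superset: "X \<subseteq> ideal_span X"
  by (auto simp: ideal_span_def)

lemma ideal_span_minimal: "closed_ideal K \<Longrightarrow> X \<subseteq> K \<Longrightarrow> ideal_span X \<subseteq> K"
  by (auto simp: ideal_span_def)

locale ck_full = ck_gauge L k s \<gamma> for L :: "'p kgraph" and k :: nat and s :: "'p \<Rightarrow> 'u::cstar_alg" and \<gamma> +
  fixes C :: "'u set"
  assumes C: "closed_ideal C" and s_in_C: "l \<in> P \<Longrightarrow> s l \<in> C" and C_closure: "C \<subseteq> closure (Sp pairs)"
    and gauge_C: "unit_torus k z \<Longrightarrow> \<gamma> z ` C \<subseteq> C" and s_nonzero: "v \<in> vertices L \<Longrightarrow> s v \<noteq> 0"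
begin

definition gauge_ideal :: "'u set \<Rightarrow> bool" where
  "gauge_ideal J \<longleftrightarrow> closed_ideal J \<and> J \<subseteq> C \<and> (\<forall>z. unit_torus k z \<longrightarrow> \<gamma> z ` J \<subseteq> J)"

definition H :: "'u set \<Rightarrow> 'p set" where "H J = {v \<in> vertices L. s v \<in> J}"
definition Hb :: "'u set \<Rightarrow> 'p set" where "Hb J = {rng l | l. l \<in> P \<and> src l \<in> H J}"
text \<open>Taken relative to C: in the ambient product every element supported on the other factors
  would annihilate J.\<close>

definition ann :: "'u set \<Rightarrow> 'u set" where "ann J = {x \<in> C. \<forall>y\<in>J. x * y = 0 \<and> y * x = 0}"

lemma gauge_ideal_eq:
  assumes "gauge_ideal J"
  shows "J = ideal_span (s ` H J)"
proof
  have J: "closed_ideal J" "J \<subseteq> C" "\<And>z. unit_torus k z \<Longrightarrow> \<gamma> z ` J \<subseteq> J" using assms by (auto simp: gauge_ideal_def)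
  show sub: "ideal_span (s ` H J) \<subseteq> J" by (rule ideal_span_minimal[OF J(1)]) (auto simp: H_def)
  show "J \<subseteq> ideal_span (s ` H J)"
  proof (rule gauge_invariant_ideal_le[OF J(1,3) _ closed_ideal_ideal_span sub])
    show "J \<subseteq> closure (Sp pairs)" using J(2) C_closure by blast
    fix v assume "v \<in> vertices L" "s v \<in> J"
    then have "s v \<in> s ` H J" unfolding H_def by blast
    then show "s v \<in> ideal_span (s ` H J)" by (rule subsetD[OF ideal_span_superset])
  qed
qed

lemma closed_ideal_ann:
  assumes J: "closed_ideal J"
  shows "closed_ideal (ann J)"
proof -
  have "ann J = C \<inter> (\<Inter>y\<in>J. {x. x * y = 0} \<inter> {x. y * x = 0})" by (auto simp: ann_def)
  moreover have "closed (C \<inter> (\<Inter>y\<in>J. {x. x * y = 0} \<inter> {x. y * x = 0}))"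
    by (intro closed_Int closed_INT ballI closed_Collect_eq continuous_intros ideal_closed[OF C])
  ultimately have "closed (ann J)" by simp
  moreover have "b * x \<in> ann J \<and> x * b \<in> ann J" if x: "x \<in> ann J" for x b
  proof -
    have xC: "x \<in> C" and x0: "\<And>y. y \<in> J \<Longrightarrow> x * y = 0 \<and> y * x = 0" using x by (simp_all add: ann_def)
    have "(b * x) * y = 0 \<and> y * (b * x) = 0 \<and> (x * b) * y = 0 \<and> y * (x * b) = 0" if y: "y \<in> J" for y
    proof (intro conjI)
      show "(b * x) * y = 0" using x0[OF y] by (simp add: mult.assoc)
      show "y * (b * x) = 0" using x0[OF ideal_mult_right[OF J y, of b]] by (simp add: mult.assoc)
      show "(x * b) * y = 0" using x0[OF ideal_mult_left[OF J y, of b]] by (simp add: mult.assoc)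
      have "y * (x * b) = (y * x) * b" by (rule mult.assoc[symmetric])
      then show "y * (x * b) = 0" using x0[OF y] by simp
    qed
    then show ?thesis unfolding ann_def using ideal_mult_left[OF C xC] ideal_mult_right[OF C xC] by blast
  qed
  ultimately show ?thesis
    unfolding closed_ideal_def
    by (auto simp: ann_def distrib_left distrib_right ideal_zero[OF C] ideal_add[OF C] ideal_cscale[OF C])
qed

text \<open>The kernel of f is a closed subspace containing the spanning elements, which are dense
  in C.\<close>

lemma closed_eq_zero_induct:
  fixes f :: "'u \<Rightarrow> 'u"
  assumes "bounded_linear f" "\<And>t z. t \<in> pairs \<Longrightarrow> f (cscale z (e t)) = 0" "b \<in> C"
  shows "f b = 0"
proof -
  interpret bounded_linear f by fact
  have "f x = 0" if "x \<in> Sp pairs" for x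
    using that by (induction rule: Sp_induct) (auto simp: add assms(2) zero)
  then have "Sp pairs \<subseteq> {x. f x = 0}" by blast
  moreover have "closed {x. f x = 0}"
    by (intro closed_Collect_eq linear_continuous_on assms(1) continuous_on_const)
  ultimately have "closure (Sp pairs) \<subseteq> {x. f x = 0}" by (rule closure_minimal)
  then show ?thesis using C_closure assms(3) by blast
qed

lemma bounded_linear_hom: "star_homomorphism \<phi> \<Longrightarrow> bounded_linear (\<phi> :: 'u \<Rightarrow> 'u)"
  by (rule bounded_linear_intro[where K = 1]) (auto simp: hom_add hom_scaleR norm_hom_le)

text \<open>The gauge maps are given only as endomorphisms. The composite fixes the generators
  because the two scalars are conjugate of modulus 1, and density extends this to C.\<close>

lemma gauge_inverse:
  assumes z: "unit_torus k z" and x: "x \<in> C"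
  shows "\<gamma> z (\<gamma> (\<lambda>i. cnj (z i)) x) = x"
proof -
  let ?z = "\<lambda>i. cnj (z i)"
  have z': "unit_torus k ?z" using z by (simp add: unit_torus_def)
  note h = gauge_hom[OF z] and h' = gauge_hom[OF z']
  have "\<gamma> z (\<gamma> ?z x) - x = 0"
  proof (rule closed_eq_zero_induct[OF _ _ x])
    show "bounded_linear (\<lambda>x. \<gamma> z (\<gamma> ?z x) - x)"
      using bounded_linear_compose[OF bounded_linear_hom[OF h] bounded_linear_hom[OF h']]
      by (intro bounded_linear_sub bounded_linear_ident) simp
    fix t w assume "t \<in> pairs"
    then have t: "fst t \<in> P" "snd t \<in> P" by (auto simp: pairs_def)
    have w: "zpow k ?z n * zpow k z n = 1" for n
    proof -
      have "cmod (zpow k z n) = 1" using z by (simp add: zpow_def norm_power unit_torus_def flip: prod_norm)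
      moreover have "zpow k ?z n = cnj (zpow k z n)" by (simp add: zpow_def)
      ultimately show ?thesis using complex_norm_square[of "zpow k z n"] by (simp add: mult.commute)
    qed
    have s: "\<gamma> z (\<gamma> ?z (s l)) = s l" if "l \<in> P" for l
      using that by (simp add: gauge_s[OF z] gauge_s[OF z'] hom_cscale[OF h] w)
    show "\<gamma> z (\<gamma> ?z (cscale w (e t))) - cscale w (e t) = 0"
      using t by (simp add: hom_cscale[OF h] hom_cscale[OF h'] hom_mult[OF h] hom_mult[OF h'] hom_star[OF h] hom_star[OF h'] s)
  qed
  then show ?thesis by simp
qed

text \<open>With y = \<gamma>_z(y') for y' in J, the product \<gamma>_z(x) y equals \<gamma>_z(x y')
  = 0; likewise on the other side.\<close>

lemma gauge_ideal_ann:
  assumes J: "gauge_ideal J"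
  shows "gauge_ideal (ann J)"
  unfolding gauge_ideal_def
proof (intro conjI allI impI)
  show "closed_ideal (ann J)" using J by (auto simp: gauge_ideal_def intro: closed_ideal_ann)
  show "ann J \<subseteq> C" by (auto simp: ann_def)
  fix z assume z: "unit_torus k z"
  let ?z = "\<lambda>i. cnj (z i)"
  have z': "unit_torus k ?z" using z by (simp add: unit_torus_def)
  note h = gauge_hom[OF z]
  show "\<gamma> z ` ann J \<subseteq> ann J"
  proof safe
    fix x assume x: "x \<in> ann J"
    have "\<gamma> z x * y = 0 \<and> y * \<gamma> z x = 0" if y: "y \<in> J" for y
    proof -
      have "y \<in> C" "\<gamma> ?z y \<in> J" using J y z' by (auto simp: gauge_ideal_def)
      then have "y = \<gamma> z (\<gamma> ?z y)" "x * \<gamma> ?z y = 0" "\<gamma> ?z y * x = 0"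
        using gauge_inverse[OF z] x by (auto simp: ann_def)
      then show ?thesis by (metis hom_mult[OF h] hom_zero[OF h])
    qed
    then show "\<gamma> z x \<in> ann J" using x gauge_C[OF z] by (auto simp: ann_def)
  qed
qed

lemma s_vertex_mult_s: "v \<in> vertices L \<Longrightarrow> l \<in> P \<Longrightarrow> v \<noteq> rng l \<Longrightarrow> s v * s l = 0"
  using s_vertex_orth[of v "rng l"] s_rng[of l] by (metis mult.assoc mult_zero_left rng_vertex)

lemma star_s_mult_vertex: "v \<in> vertices L \<Longrightarrow> l \<in> P \<Longrightarrow> v \<noteq> rng l \<Longrightarrow> star (s l) * s v = 0"
  using arg_cong[OF s_vertex_mult_s[of v l], of star] by (simp add: star_mult)

text \<open>A spanning term e (l, m) survives between p_v and p_w only if v = rng l and w = rng m.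
  Then p_w in J puts s m, and with it the common source projection, into J, so v would lie in
  \<open>Hb J\<close>.\<close>

lemma sandwich_zero:
  assumes J: "closed_ideal J" and v: "v \<in> vertices L" "v \<notin> Hb J" and w: "w \<in> H J" and b: "b \<in> C"
  shows "s v * b * s w = 0" "s w * b * s v = 0"
proof -
  have wv: "w \<in> vertices L" "s w \<in> J" using w by (auto simp: H_def)
  have no: "\<not> (rng l = v \<and> rng m = w \<and> l \<in> P \<and> m \<in> P \<and> src l = src m)" for l m
  proof safe
    assume lm: "v = rng l" "w = rng m" "l \<in> P" "m \<in> P" "src l = src m"
    have "s m = s w * s m" using lm by simp
    then have "s m \<in> J" using ideal_mult_right[OF J wv(2)] by metis
    then have "s (src m) \<in> J" using ideal_mult_left[OF J, of "s m" "star (s m)"] star_s_s[OF lm(4)] by simp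
    then have "src l \<in> H J" using lm by (simp add: H_def)
    then have "v \<in> Hb J" using lm unfolding Hb_def by blast
    then show False using v by blast
  qed
  have bl: "bounded_linear (\<lambda>b. x * b * y)" for x y :: 'u
    by (intro bounded_linear_mult_const bounded_linear_const_mult bounded_linear_ident)
  show "s v * b * s w = 0"
  proof (rule closed_eq_zero_induct[OF bl _ b])
    fix t z assume "t \<in> pairs"
    then obtain l m where t: "t = (l, m)" "l \<in> P" "m \<in> P" "src l = src m" by (auto simp: pairs_def)
    have "(s v * s l) * (star (s m) * s w) = 0"
      using no[of l m] s_vertex_mult_s[OF v(1) t(2)] star_s_mult_vertex[OF wv(1) t(3)] t by auto
    then show "s v * cscale z (e t) * s w = 0" using t(1) by (simp add: mult.assoc)
  qed
  show "s w * b * s v = 0"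
  proof (rule closed_eq_zero_induct[OF bl _ b])
    fix t z assume "t \<in> pairs"
    then obtain l m where t: "t = (l, m)" "l \<in> P" "m \<in> P" "src l = src m" by (auto simp: pairs_def)
    have "(s w * s l) * (star (s m) * s v) = 0"
      using no[of m l] s_vertex_mult_s[OF wv(1) t(2)] star_s_mult_vertex[OF v(1) t(3)] t by auto
    then show "s w * cscale z (e t) * s v = 0" using t(1) by (simp add: mult.assoc)
  qed
qed

text \<open>If v = rng l with src l in H J, then s l is in J and p_v s l = s l is nonzero.
  Conversely J is generated by its vertex projections, so killing those suffices, by
  \<open>sandwich_zero\<close>.\<close>

lemma H_ann:
  assumes J: "gauge_ideal J"
  shows "H (ann J) = vertices L - Hb J"
proof (intro set_eqI iffI)
  have Ji: "closed_ideal J" using J by (simp add: gauge_ideal_def)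
  fix v
  {
    assume v: "v \<in> H (ann J)"
    have "v \<notin> Hb J"
    proof
      assume "v \<in> Hb J"
      then obtain l where l: "v = rng l" "l \<in> P" "s (src l) \<in> J" by (auto simp: Hb_def H_def)
      have "s l * s (src l) \<in> J" by (rule ideal_mult_left[OF Ji l(3)])
      then have "s l \<in> J" using l by simp
      then have "s v * s l = 0" using v by (auto simp: H_def ann_def)
      then have "s (src l) = 0" using l star_s_s[OF l(2)] by simp
      then show False using s_nonzero[of "src l"] l by simp
    qed
    then show "v \<in> vertices L - Hb J" using v by (simp add: H_def)
  next
    assume v: "v \<in> vertices L - Hb J"
    \<comment> \<open>Allowing every b of C in the middle makes the condition define a two-sided
      ideal, so that it can be checked on the generators of J.\<close>
    define K where "K = (\<Inter>b\<in>C. {x. s v * b * x = 0} \<inter> {x. x * b * s v = 0})"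
    have "closed_ideal K"
      unfolding closed_ideal_def
    proof (intro conjI ballI allI)
      show "closed K" unfolding K_def
        by (intro closed_INT closed_Int ballI closed_Collect_eq continuous_intros)
      fix x c assume x: "x \<in> K"
      have xb: "s v * b * x = 0" "x * b * s v = 0" if "b \<in> C" for b using x that by (auto simp: K_def)
      have "s v * b * (c * x) = 0 \<and> (c * x) * b * s v = 0" if "b \<in> C" for b
        using xb(1)[OF ideal_mult_right[OF C that, of c]] xb(2)[OF that] by (simp add: mult.assoc)
      then show "c * x \<in> K" by (auto simp: K_def)
      have "s v * b * (x * c) = 0 \<and> (x * c) * b * s v = 0" if "b \<in> C" for b
      proof
        have "s v * b * (x * c) = s v * b * x * c" by (simp only: mult.assoc)
        then show "s v * b * (x * c) = 0" using xb(1)[OF that] by simp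
        show "(x * c) * b * s v = 0" using xb(2)[OF ideal_mult_left[OF C that, of c]] by (simp add: mult.assoc)
      qed
      then show "x * c \<in> K" by (auto simp: K_def)
    qed (auto simp: K_def distrib_left distrib_right)
    moreover have "s ` H J \<subseteq> K" using sandwich_zero[OF Ji] v by (auto simp: K_def)
    ultimately have "J \<subseteq> K" using gauge_ideal_eq[OF J] ideal_span_minimal by blast
    have "s v * x = 0 \<and> x * s v = 0" if "x \<in> J" for x
    proof -
      have vC: "s v \<in> C" and vv: "s v * s v = s v" using v s_in_C by auto
      \<comment> \<open>The choice b = p_v removes the middle factor again.\<close>
      have "s v * s v * x = 0" "x * s v * s v = 0" using \<open>J \<subseteq> K\<close> that vC by (auto simp: K_def)
      then show ?thesis using vv by (simp add: mult.assoc)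
    qed
    then show "v \<in> H (ann J)" using v s_in_C by (auto simp: H_def ann_def)
  }
qed

lemma ann_eq: "gauge_ideal J \<Longrightarrow> ann J = ideal_span (s ` (vertices L - Hb J))"
  using gauge_ideal_eq[OF gauge_ideal_ann] H_ann by metis

text \<open>By \<open>H_ann\<close>, w lies in \<open>Hb (ann J)\<close> exactly if some path with
  range w has its source outside \<open>Hb J\<close>.\<close>

lemma H_ann_ann:
  assumes J: "gauge_ideal J"
  shows "H (ann (ann J)) = {w \<in> vertices L. Tset L w \<subseteq> Hb J}"
proof -
  have "w \<in> Hb (ann J) \<longleftrightarrow> \<not> Tset L w \<subseteq> Hb J" for w
    unfolding Hb_def[of "ann J"] H_ann[OF J] Tset_def by auto
  then show ?thesis unfolding H_ann[OF gauge_ideal_ann[OF J]] by blast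
qed

lemma ann_ann_eq:
  "gauge_ideal J \<Longrightarrow> ann (ann J) = ideal_span (s ` {w \<in> vertices L. Tset L w \<subseteq> Hb J})"
  using gauge_ideal_eq[OF gauge_ideal_ann[OF gauge_ideal_ann]] H_ann_ann by metis

text \<open>A gauge-invariant ideal is determined by its vertex set, so equality of ideals reduces
  to equality of vertex sets.\<close>

lemma ann_ann_eq_iff:
  "gauge_ideal J \<Longrightarrow> ann (ann J) = J \<longleftrightarrow> H J = {w \<in> vertices L. Tset L w \<subseteq> Hb J}"
  using H_ann_ann ann_ann_eq gauge_ideal_eq by metis

end

section \<open>Ideals and annihilators of records inside the product\<close>

context cstar_record
begin

text \<open>Elements of the product act on the image of A through their A-coordinate, so an ideal of
  A is an ideal of the whole product.\<close>

lemma closed_ideal_emb: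
  assumes J: "is_ideal A J"
  shows "closed_ideal (emb A ` J)"
proof -
  have JC: "J \<subseteq> c_carrier A" using J by (simp add: is_ideal_def)
  have "c_zero A \<in> J" and add: "\<And>x y. x \<in> J \<Longrightarrow> y \<in> J \<Longrightarrow> c_add A x y \<in> J"
    and smul: "\<And>a x. x \<in> J \<Longrightarrow> c_smul A a x \<in> J"
    and mult: "\<And>b x. x \<in> J \<Longrightarrow> b \<in> c_carrier A \<Longrightarrow> c_mult A b x \<in> J"
      "\<And>b x. x \<in> J \<Longrightarrow> b \<in> c_carrier A \<Longrightarrow> c_mult A x b \<in> J"
    and cl: "c_closed_set A J" using J by (auto simp: is_ideal_def)
  have C: "\<And>x. x \<in> J \<Longrightarrow> x \<in> c_carrier A" using JC by blast
  show ?thesis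
    unfolding closed_ideal_def
  proof (intro conjI ballI allI)
    show "0 \<in> emb A ` J" using \<open>c_zero A \<in> J\<close> by (metis emb_zero imageI)
    show "closed (emb A ` J)" using cl c_closed_set_iff[OF JC] by simp
    fix x assume "x \<in> emb A ` J"
    then obtain x' where x: "x' \<in> J" "x = emb A x'" by blast
    show "cscale a x \<in> emb A ` J" for a using smul[OF x(1), of a] C[OF x(1)] x(2) by (metis emb_smul imageI)
    show "b * x \<in> emb A ` J" for b
      using mult(1)[OF x(1) Rep_cprod_closed[OF is_cstar]] emb_mult_right[OF C[OF x(1)]] x(2) by (metis imageI)
    show "x * b \<in> emb A ` J" for b
      using mult(2)[OF x(1) Rep_cprod_closed[OF is_cstar]] emb_mult_left[OF C[OF x(1)]] x(2) by (metis imageI)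
    fix y assume "y \<in> emb A ` J"
    then obtain y' where y: "y' \<in> J" "y = emb A y'" by blast
    show "x + y \<in> emb A ` J" using add[OF x(1) y(1)] C[OF x(1)] C[OF y(1)] x(2) y(2) by (metis emb_add imageI)
  qed
qed

lemma is_ideal_carrier: "is_ideal A (c_carrier A)"
  by (auto simp: is_ideal_def c_closed_set_def)

lemma is_ideal_vimage:
  assumes K: "closed_ideal K"
  shows "is_ideal A {x \<in> c_carrier A. emb A x \<in> K}"
proof -
  have "emb A ` {x \<in> c_carrier A. emb A x \<in> K} = emb A ` c_carrier A \<inter> K" by auto
  then have "c_closed_set A {x \<in> c_carrier A. emb A x \<in> K}"
    using closed_emb_carrier ideal_closed[OF K] by (subst c_closed_set_iff) auto
  then show ?thesis
    unfolding is_ideal_def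
    by (auto simp: ideal_zero[OF K] ideal_add[OF K] ideal_cscale[OF K] ideal_mult_left[OF K] ideal_mult_right[OF K])
qed

text \<open>One inclusion pulls closed ideals back along \<open>emb\<close>, by
  \<open>is_ideal_vimage\<close>; the other pushes ideals of A forward, by
  \<open>closed_ideal_emb\<close>.\<close>

lemma emb_ideal_gen:
  assumes X: "X \<subseteq> c_carrier A"
  shows "emb A ` ideal_gen A X = ideal_span (emb A ` X)"
proof
  show "emb A ` ideal_gen A X \<subseteq> ideal_span (emb A ` X)"
    unfolding ideal_span_def
  proof safe
    fix x K assume x: "x \<in> ideal_gen A X" and K: "closed_ideal K" "emb A ` X \<subseteq> K"
    have "X \<subseteq> {x \<in> c_carrier A. emb A x \<in> K}" using X K(2) by auto
    then show "emb A x \<in> K" using x is_ideal_vimage[OF K(1)] unfolding ideal_gen_def by blast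
  qed
  show "ideal_span (emb A ` X) \<subseteq> emb A ` ideal_gen A X"
  proof
    fix u assume u: "u \<in> ideal_span (emb A ` X)"
    have J: "u \<in> emb A ` J" if "is_ideal A J" "X \<subseteq> J" for J
      using u ideal_span_minimal[OF closed_ideal_emb[OF that(1)], of "emb A ` X"] that(2) by blast
    obtain x where x: "x \<in> c_carrier A" "u = emb A x" using J[OF is_ideal_carrier X] by blast
    have "x \<in> J" if "is_ideal A J" "X \<subseteq> J" for J
      using J[OF that] x that(1) by (auto simp: is_ideal_def)
    then show "u \<in> emb A ` ideal_gen A X" using x(2) by (auto simp: ideal_gen_def)
  qed
qed

lemma emb_annihilator:
  assumes "J \<subseteq> c_carrier A"
  shows "emb A ` annihilator A J = {x \<in> emb A ` c_carrier A. \<forall>y\<in>emb A ` J. x * y = 0 \<and> y * x = 0}"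
proof -
  have eq: "c_mult A x y = c_zero A \<longleftrightarrow> emb A x * emb A y = 0" if "x \<in> c_carrier A" "y \<in> c_carrier A" for x y
    using emb_eq_zero[of "c_mult A x y"] that by simp
  have "x \<in> annihilator A J \<longleftrightarrow> x \<in> c_carrier A \<and> (\<forall>y\<in>J. emb A x * emb A y = 0 \<and> emb A y * emb A x = 0)" for x
    unfolding annihilator_def using eq assms by blast
  then show ?thesis by auto
qed

lemma emb_image_eq_iff:
  "X \<subseteq> c_carrier A \<Longrightarrow> Y \<subseteq> c_carrier A \<Longrightarrow> emb A ` X = emb A ` Y \<longleftrightarrow> X = Y"
  by (rule inj_on_image_eq_iff[of _ "c_carrier A"]) (auto simp: inj_on_def)

end

theorem mainTheorem16:
  fixes L :: "'p kgraph" and k :: nat and A :: "'a cstar" and s :: "'p \<Rightarrow> 'a"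
    and J :: "'a set"
  assumes "0 < k"
    and "is_kgraph L k" and "row_finite L k" and "locally_convex L k"
    and "universal_CK L k A s"
    and "is_ideal A J" and "gauge_invariant L k A s J"
  shows "annihilator A J = ideal_gen A (s ` (vertices L - Hbar L A s J)) \<and>
         annihilator A (annihilator A J) =
           ideal_gen A (s ` {w \<in> vertices L. Tset L w \<subseteq> Hbar L A s J}) \<and>
         (regular_ideal A J \<longleftrightarrow> Hset L A s J = {w \<in> vertices L. Tset L w \<subseteq> Hbar L A s J})"
proof -
  have A: "is_cstar A" "CK_family L k A s" "gen_subalg A (s ` kg_paths L) = c_carrier A"
    using assms(5) by (auto simp: universal_CK_def)
  interpret cstar_record A using A(1) by unfold_locales
  let ?s = "\<lambda>l. emb A (s l)" and ?J = "emb A ` J" and ?C = "emb A ` c_carrier A"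
  have sC: "s l \<in> c_carrier A" if "l \<in> kg_paths L" for l using A(2) that by (auto simp: CK_family_def)
  have ck: "ck_relations L k ?s"
    using CK_family_iff[of L k s] assms(2,3) sC A(2) kgraph.intro[OF assms(2)] by blast
  interpret ck_family L k ?s
    by unfold_locales (use assms ck in auto)
  have "\<exists>\<phi>. star_hom A A \<phi> \<and> (\<forall>l\<in>P. \<phi> (s l) = c_smul A (zpow k z (deg l)) (s l))"
    if "unit_torus k z" for z
    using gauge_automorphism_exists[OF assms(5,2,3), of z] that by (simp add: unit_torus_def)
  then obtain \<phi> where \<phi>: "\<And>z. unit_torus k z \<Longrightarrow> star_hom A A (\<phi> z)"
      "\<And>z l. unit_torus k z \<Longrightarrow> l \<in> P \<Longrightarrow> \<phi> z (s l) = c_smul A (zpow k z (deg l)) (s l)"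
    by metis
  \<comment> \<open>The lift to the whole product reads off the A-coordinate; it is a star
    homomorphism that kills the other factors.\<close>
  define \<gamma> where "\<gamma> z u = emb A (\<phi> z (Rep_cprod u A))" for z u
  have \<gamma>_emb: "\<gamma> z (emb A x) = emb A (\<phi> z x)" if "x \<in> c_carrier A" for z x using that by (simp add: \<gamma>_def)
  have \<phi>C: "\<phi> z x \<in> c_carrier A" if "unit_torus k z" "x \<in> c_carrier A" for z x
    using \<phi>(1)[OF that(1)] that(2) by (auto simp: star_hom_def)
  interpret ck_gauge L k ?s \<gamma>
  proof
    fix z assume z: "unit_torus k z"
    have h: "star_hom A A (\<phi> z)" by (rule \<phi>(1)[OF z])
    have Rep: "Rep_cprod u A \<in> c_carrier A" for u using A(1) by simp
    show "star_homomorphism (\<gamma> z)"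
      using h \<phi>C[OF z] Rep A(1) unfolding star_homomorphism_def star_hom_def \<gamma>_def cprod_rep' by simp
    show "\<gamma> z (?s l) = cscale (zpow k z (deg l)) (?s l)" if "l \<in> P" for l
      using \<phi>(2)[OF z that] sC[OF that] by (simp add: \<gamma>_emb)
  qed
  \<comment> \<open>The closed span is a closed star-subalgebra containing the generators, so it
    exhausts the algebra that they generate.\<close>
  have "closed_star_subalg A {x \<in> c_carrier A. emb A x \<in> closure (Sp pairs)}"
  proof -
    have "emb A ` {x \<in> c_carrier A. emb A x \<in> closure (Sp pairs)} = ?C \<inter> closure (Sp pairs)" by auto
    then have "c_closed_set A {x \<in> c_carrier A. emb A x \<in> closure (Sp pairs)}"
      using closed_emb_carrier by (subst c_closed_set_iff) auto
    then show ?thesis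
      using star_subalgebra_closure_Sp unfolding closed_star_subalg_def star_subalgebra_def by auto
  qed
  moreover have "s ` P \<subseteq> {x \<in> c_carrier A. emb A x \<in> closure (Sp pairs)}"
    using sC s_in_Sp closure_subset by blast
  ultimately have "gen_subalg A (s ` P) \<subseteq> {x \<in> c_carrier A. emb A x \<in> closure (Sp pairs)}"
    unfolding gen_subalg_def by blast
  then have C_closure: "?C \<subseteq> closure (Sp pairs)" using A(3) by auto
  interpret ck_full L k ?s \<gamma> ?C
  proof
    show "closed_ideal ?C" by (rule closed_ideal_emb[OF is_ideal_carrier])
    show "?s l \<in> ?C" if "l \<in> P" for l using sC[OF that] by simp
    show "\<gamma> z ` ?C \<subseteq> ?C" if "unit_torus k z" for z using \<phi>C[OF that] by (auto simp: \<gamma>_emb)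
    show "?s v \<noteq> 0" if "v \<in> vertices L" for v
      using universal_vertex_nonzero[OF assms(5,2,3,4) that] sC[of v] that by simp
  qed (rule C_closure)
  have JC: "J \<subseteq> c_carrier A" using assms(6) by (simp add: is_ideal_def)
  have "gauge_ideal ?J"
    unfolding gauge_ideal_def
  proof (intro conjI allI impI)
    show "closed_ideal ?J" by (rule closed_ideal_emb[OF assms(6)])
    show "?J \<subseteq> ?C" using JC by blast
    fix z assume z: "unit_torus k z"
    \<comment> \<open>\<open>gauge_invariant\<close> covers every endomorphism with the gauge action
      on generators, in particular the chosen \<open>\<phi> z\<close>.\<close>
    then have "\<phi> z ` J \<subseteq> J"
      using assms(7) \<phi> unfolding gauge_invariant_def unit_torus_def by blast
    then show "\<gamma> z ` ?J \<subseteq> ?J" using JC by (auto simp: \<gamma>_emb subset_iff)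
  qed
  have H: "H ?J = Hset L A s J"
  proof -
    have "emb A (s v) \<in> ?J \<longleftrightarrow> s v \<in> J" if "v \<in> vertices L" for v
      using JC sC[of v] that by (auto simp: image_iff)
    then show ?thesis by (auto simp: H_def Hset_def)
  qed
  have Hb: "Hb ?J = Hbar L A s J" unfolding Hb_def H Hbar_def ..
  have ann: "ann (emb A ` I) = emb A ` annihilator A I" if "I \<subseteq> c_carrier A" for I
    unfolding ann_def emb_annihilator[OF that] ..
  have annC: "annihilator A I \<subseteq> c_carrier A" for I by (auto simp: annihilator_def)
  have gen: "ideal_span (?s ` V) = emb A ` ideal_gen A (s ` V)" "ideal_gen A (s ` V) \<subseteq> c_carrier A"
    if "V \<subseteq> vertices L" for V
  proof -
    have "s ` V \<subseteq> c_carrier A" using that sC by auto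
    then show "ideal_span (?s ` V) = emb A ` ideal_gen A (s ` V)" "ideal_gen A (s ` V) \<subseteq> c_carrier A"
      using emb_ideal_gen is_ideal_carrier unfolding ideal_gen_def by (auto simp: image_image)
  qed
  have 1: "annihilator A J = ideal_gen A (s ` (vertices L - Hbar L A s J))"
    using ann_eq[OF \<open>gauge_ideal ?J\<close>] emb_image_eq_iff[OF annC gen(2)] unfolding Hb ann[OF JC] gen(1)[OF Diff_subset] by blast
  let ?W = "{w \<in> vertices L. Tset L w \<subseteq> Hbar L A s J}"
  have W: "?W \<subseteq> vertices L" by blast
  have 2: "annihilator A (annihilator A J) = ideal_gen A (s ` ?W)"
    using ann_ann_eq[OF \<open>gauge_ideal ?J\<close>] emb_image_eq_iff[OF annC gen(2)[OF W]]
    unfolding Hb ann[OF JC] ann[OF annC] gen(1)[OF W] by blast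
  have 3: "regular_ideal A J \<longleftrightarrow> Hset L A s J = ?W"
    using ann_ann_eq_iff[OF \<open>gauge_ideal ?J\<close>] emb_image_eq_iff[OF annC JC]
    unfolding Hb H ann[OF JC] ann[OF annC] regular_ideal_def by blast
  from 1 2 3 show ?thesis by blast
qed

end
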